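(* The $d$-quasi-forest deletion problem is fixed-parameter tractable parameterized by $k$ and $d$: there is an algorithm that, given a graph $G$ on $n$ vertices and integers $k,d$, decides whether there exists $X \subseteq V(G)$ with $|X| \le k$ such that $G - X$ is a $d$-quasi-forest, in time $f(k,d)\, n^{O(1)}$ for some computable function $f$.
   Context: A $d$-quasi-forest is a graph in which each connected component admits a feedback vertex set (a vertex set whose deletion leaves an acyclic graph) of size at most $d$. *)

theory Defs
  imports "Graph_Theory.Digraph_Component"
begin

section \<open>Random access machines\<close>

text \<open>
  Algorithms are structured programs for the unit-cost random access machine with integer
  cells and the arithmetic operations addition and subtraction. There is no multiplication,
  so after \<open>t\<close> steps of a fixed program every cell holds a number of bit length \<open>O(t)\<close> plus
  the largest bit length in the input; hence unit-cost time agrees with logarithmic-cost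
  (and Turing machine) time up to polynomial factors. Memory cells are addressed by integers.
\<close>

type_synonym store = "int \<Rightarrow> int"

datatype exp = Const int | Mem exp | Add exp exp | Sub exp exp

primrec eval :: "exp \<Rightarrow> store \<Rightarrow> int" where
  "eval (Const z) s = z"
| "eval (Mem e) s = s (eval e s)"
| "eval (Add a b) s = eval a s + eval b s"
| "eval (Sub a b) s = eval a s - eval b s"

text \<open>
  \<open>Store a e\<close> writes the value of \<open>e\<close> to the cell whose address is the value of \<open>a\<close>
  (indirect addressing); \<open>IfPos\<close> and \<open>WhilePos\<close> test whether a value is positive.
\<close>

datatype com =
    Skip
  | Store exp exp
  | Seq com com
  | IfPos exp com com
  | WhilePos exp com

text \<open>
  \<open>exec c s t s'\<close>: started in \<open>s\<close>, the program \<open>c\<close> halts in \<open>s'\<close> after exactly \<open>t\<close> steps.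
  Evaluating an expression is charged together with the command containing it: the number
  of operations in it is bounded by a constant depending on the program only.
\<close>

inductive exec :: "com \<Rightarrow> store \<Rightarrow> nat \<Rightarrow> store \<Rightarrow> bool" where
  Skip: "exec Skip s 1 s"
| Store: "exec (Store a e) s 1 (s(eval a s := eval e s))"
| Seq: "exec c1 s t1 s' \<Longrightarrow> exec c2 s' t2 s'' \<Longrightarrow> exec (Seq c1 c2) s (t1 + t2) s''"
| IfTrue: "eval b s > 0 \<Longrightarrow> exec c1 s t s' \<Longrightarrow> exec (IfPos b c1 c2) s (t + 1) s'"
| IfFalse: "eval b s \<le> 0 \<Longrightarrow> exec c2 s t s' \<Longrightarrow> exec (IfPos b c1 c2) s (t + 1) s'"
| WhileFalse: "eval b s \<le> 0 \<Longrightarrow> exec (WhilePos b c) s 1 s"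
| WhileTrue: "eval b s > 0 \<Longrightarrow> exec c s t1 s' \<Longrightarrow> exec (WhilePos b c) s' t2 s''
    \<Longrightarrow> exec (WhilePos b c) s (t1 + t2 + 1) s''"

inductive_cases SeqE: "exec (Seq c1 c2) s t s'"
inductive_cases IfPosE: "exec (IfPos b c1 c2) s t s'"
inductive_cases WhilePosE: "exec (WhilePos b c) s t s'"

lemma exec_deterministic:
  "exec c s t s' \<Longrightarrow> exec c s u s'' \<Longrightarrow> u = t \<and> s'' = s'"
proof (induction arbitrary: u s'' rule: exec.induct)
  case (Skip s)
  then show ?case by (rule exec.cases) simp_all
next
  case (Store a e s)
  then show ?case by (rule exec.cases) simp_all
next
  case (Seq c1 s t1 s1 c2 t2 s2)
  from Seq.prems obtain v1 v2 r
    where u: "u = v1 + v2" and 1: "exec c1 s v1 r" and 2: "exec c2 r v2 s''"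
    by (rule SeqE)
  from Seq.IH(1)[OF 1] have "v1 = t1" "r = s1" by simp_all
  with Seq.IH(2)[of v2 s''] 2 u show ?case by simp
next
  case (IfTrue b s c1 t s1 c2)
  from IfTrue.prems show ?case
  proof (rule IfPosE)
    fix v assume "u = Suc v" "exec c1 s v s''"
    with IfTrue.IH[of v s''] show ?thesis by simp
  next
    assume "eval b s \<le> 0"
    with IfTrue.hyps(1) show ?thesis by linarith
  qed
next
  case (IfFalse b s c2 t s1 c1)
  from IfFalse.prems show ?case
  proof (rule IfPosE)
    assume "0 < eval b s"
    with IfFalse.hyps(1) show ?thesis by linarith
  next
    fix v assume "u = Suc v" "exec c2 s v s''"
    with IfFalse.IH[of v s''] show ?thesis by simp
  qed
next
  case (WhileFalse b s c)
  from WhileFalse.prems show ?case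
  proof (rule WhilePosE)
    assume "u = Suc 0" "s'' = s"
    then show ?thesis by simp
  next
    assume "0 < eval b s"
    with WhileFalse.hyps show ?thesis by linarith
  qed
next
  case (WhileTrue b s c t1 s1 t2 s2)
  from WhileTrue.prems show ?case
  proof (rule WhilePosE)
    assume "eval b s \<le> 0"
    with WhileTrue.hyps(1) show ?thesis by linarith
  next
    fix v1 r v2
    assume u: "u = Suc (v1 + v2)" and 1: "exec c s v1 r" and 2: "exec (WhilePos b c) r v2 s''"
    from WhileTrue.IH(1)[OF 1] have "v1 = t1" "r = s1" by simp_all
    with WhileTrue.IH(2)[of v2 s''] 2 u show ?thesis by simp
  qed
qed

text \<open>Cell \<open>0\<close> holds the output; all cells that are not part of the input are initially \<open>0\<close>.\<close>

definition computable2 :: "(int \<Rightarrow> int \<Rightarrow> nat) \<Rightarrow> bool" where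
  "computable2 f \<longleftrightarrow>
    (\<exists>p. \<forall>x y. \<exists>t s. exec p ((\<lambda>_. 0)(0 := x, 1 := y)) t s \<and> s 0 = int (f x y))"

definition decides_within :: "com \<Rightarrow> store \<Rightarrow> bool \<Rightarrow> nat \<Rightarrow> bool" where
  "decides_within p inp answer T \<longleftrightarrow>
    (\<exists>t s. exec p inp t s \<and> t \<le> T \<and> s 0 = (if answer then 1 else 0))"

text \<open>
  An instance consists of a graph on the vertices \<open>0, \<dots>, n - 1\<close>, given by its adjacency matrix
  in row-major order from cell \<open>3\<close> on, preceded by \<open>n\<close> and the two parameters.
\<close>

definition encode :: "nat pair_pre_digraph \<Rightarrow> int \<Rightarrow> int \<Rightarrow> store" where
  "encode G k d = (let n = card (pverts G) in
    (\<lambda>a. if a = 0 then int n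
         else if a = 1 then k
         else if a = 2 then d
         else if \<exists>i<n. \<exists>j<n. a = int (3 + n * i + j) \<and> (i, j) \<in> parcs G then 1
         else 0))"

section \<open>Quasi-forests\<close>

text \<open>
  Finite simple undirected graphs are loop-free symmetric digraphs without parallel arcs
  (\<^locale>\<open>pair_graph\<close>). There the directed cycles include the walks \<open>u, v, u\<close> along a single
  edge; the cycles of the undirected graph are those of length at least three. Moreover,
  the strongly connected components are exactly the connected components.
\<close>

definition acyclic_graph :: "('a, 'b) pre_digraph \<Rightarrow> bool" where
  "acyclic_graph G \<longleftrightarrow> \<not> (\<exists>p. pre_digraph.cycle G p \<and> length p \<ge> 3)"

definition feedback_vertex_set :: "('a, 'b) pre_digraph \<Rightarrow> 'a set \<Rightarrow> bool" where
  "feedback_vertex_set G S \<longleftrightarrow> S \<subseteq> verts G \<and> acyclic_graph (G \<restriction> (verts G - S))"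

definition quasi_forest :: "int \<Rightarrow> ('a, 'b) pre_digraph \<Rightarrow> bool" where
  "quasi_forest d G \<longleftrightarrow>
    (\<forall>C \<in> pre_digraph.sccs G. \<exists>S. feedback_vertex_set C S \<and> int (card S) \<le> d)"

definition has_quasi_forest_deletion :: "('a, 'b) pre_digraph \<Rightarrow> int \<Rightarrow> int \<Rightarrow> bool" where
  "has_quasi_forest_deletion G k d \<longleftrightarrow>
    (\<exists>X \<subseteq> verts G. int (card X) \<le> k \<and> quasi_forest d (G \<restriction> (verts G - X)))"

end

theory Submission
  imports Defs
begin

text \<open>
  The algorithm is an iterative compression: the vertices are added one at a time, and from a solution
  \<open>(oX, oH)\<close> of the previous graph, consisting of at most \<open>k\<close> deleted vertices \<open>oX\<close> and feedback
  vertices \<open>oH\<close>, at most \<open>d\<close> in every component, a solution of the next graph is sought. The program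
  guesses the roles of the vertices in \<open>X0\<close>, that is, \<open>oX\<close> and the new vertex. If a vertex of \<open>X0\<close>
  that is kept has more than \<open>k + d\<close> cyclic components of the old solution next to it, then the guess
  is wrong, since more than \<open>d\<close> of them stay intact and become one component. So the part of the graph
  that these vertices reach contains boundedly many vertices of \<open>oH\<close> in cyclic components.

  This part is eliminated leaf by leaf as in the disjoint compression algorithm for feedback vertex set.
  A leaf of the undecided part that is attached to a single component of the kept vertices and has at most
  one neighbour among those outside the feedback vertex set is kept: a solution that uses it may use its
  undecided neighbour instead. For any other leaf the role is guessed, and so it is for a vertex of \<open>oH\<close>
  when no leaf exists. A potential function bounds the number of guesses in terms of \<open>k\<close> and \<open>d\<close>.
  All guesses are the ternary digits of one number, so that the search is a loop over numbers.
\<close>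

section \<open>A loop language over arrays of natural numbers\<close>

text \<open>What separates the problem from feedback vertex set is that \<open>d\<close> counts per
  component. The total number of feedback vertices is unbounded in \<open>k\<close> and
  \<open>d\<close>, and merging two components can violate the bound without closing any cycle. The
  potential therefore mixes four resources: a deletion spends the budget \<open>k\<close>, a
  feedback vertex spends an allowance proportional to the number of components of kept vertices, a
  merger lowers that number, and a kept vertex with two neighbours in the kept forest lowers the
  number of its trees. Only vertices taken from a leafless remainder can raise these terms, and they
  pay for it by leaving a set of bounded size. An attempt is a deterministic run fed with a number,
  so no branching state has to be stored. A wrong number does no harm, because the outcome of every
  attempt is verified independently; the theory of the elimination serves completeness only. The
  machine can neither multiply nor divide, so the number of attempts is a generous tower of powers
  that repeated doubling and tripling produce. The loop language has total semantics, which allows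
  correctness to be proved by loop invariants and time by counting rounds.\<close>

datatype nexp = Cst nat | In nexp | Ar nat nexp | Pl nexp nexp

datatype ncom = Nop | Put nat nexp nexp | Sq ncom ncom | Lt nexp nexp ncom ncom | For nat nexp ncom

type_synonym arrs = "nat \<Rightarrow> nat \<Rightarrow> nat"

primrec val :: "nexp \<Rightarrow> (nat \<Rightarrow> nat) \<Rightarrow> arrs \<Rightarrow> nat" where
  "val (Cst z) inp \<sigma> = z"
| "val (In e) inp \<sigma> = inp (val e inp \<sigma>)"
| "val (Ar j e) inp \<sigma> = \<sigma> j (val e inp \<sigma>)"
| "val (Pl a b) inp \<sigma> = val a inp \<sigma> + val b inp \<sigma>"

definition upd :: "arrs \<Rightarrow> nat \<Rightarrow> nat \<Rightarrow> nat \<Rightarrow> arrs" where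
  "upd \<sigma> j i x = \<sigma>(j := (\<sigma> j)(i := x))"

primrec sem :: "ncom \<Rightarrow> (nat \<Rightarrow> nat) \<Rightarrow> arrs \<Rightarrow> arrs" where
  "sem Nop inp \<sigma> = \<sigma>"
| "sem (Put j a e) inp \<sigma> = upd \<sigma> j (val a inp \<sigma>) (val e inp \<sigma>)"
| "sem (Sq c1 c2) inp \<sigma> = sem c2 inp (sem c1 inp \<sigma>)"
| "sem (Lt a b c1 c2) inp \<sigma> = (if val a inp \<sigma> < val b inp \<sigma> then sem c1 inp \<sigma> else sem c2 inp \<sigma>)"
| "sem (For x e c) inp \<sigma> =
    ((\<lambda>\<tau>. let \<tau>' = sem c inp \<tau> in upd \<tau>' x 0 (Suc (\<tau>' x 0))) ^^ val e inp \<sigma>) (upd \<sigma> x 0 0)"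

primrec reads :: "nexp \<Rightarrow> nat set" where
  "reads (Cst z) = {}"
| "reads (In e) = reads e"
| "reads (Ar j e) = insert j (reads e)"
| "reads (Pl a b) = reads a \<union> reads b"

primrec writes :: "ncom \<Rightarrow> nat set" where
  "writes Nop = {}"
| "writes (Put j a e) = {j}"
| "writes (Sq c1 c2) = writes c1 \<union> writes c2"
| "writes (Lt a b c1 c2) = writes c1 \<union> writes c2"
| "writes (For x e c) = insert x (writes c)"

primrec wfe :: "nexp \<Rightarrow> bool" where
  "wfe (Cst z) = True"
| "wfe (In e) = wfe e"
| "wfe (Ar j e) = (j < 64 \<and> wfe e)"
| "wfe (Pl a b) = (wfe a \<and> wfe b)"

text \<open>A loop must change neither its counter nor the value of its bound; only then does it agree
  with its compilation into a while loop.\<close>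

primrec wfc :: "ncom \<Rightarrow> bool" where
  "wfc Nop = True"
| "wfc (Put j a e) = (j < 64 \<and> wfe a \<and> wfe e)"
| "wfc (Sq c1 c2) = (wfc c1 \<and> wfc c2)"
| "wfc (Lt a b c1 c2) = (wfe a \<and> wfe b \<and> wfc c1 \<and> wfc c2)"
| "wfc (For x e c) = (x < 64 \<and> wfe e \<and> wfc c \<and> x \<notin> writes c \<and> reads e \<inter> insert x (writes c) = {})"

lemma upd_other [simp]: "j' \<noteq> j \<Longrightarrow> upd \<sigma> j i x j' = \<sigma> j'"
  by (simp add: upd_def)

lemma upd_same [simp]: "upd \<sigma> j i x j = (\<sigma> j)(i := x)"
  by (simp add: upd_def)

lemma val_cong: "(\<And>j. j \<in> reads e \<Longrightarrow> \<sigma> j = \<tau> j) \<Longrightarrow> val e inp \<sigma> = val e inp \<tau>"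
  by (induction e) auto

lemma sem_frame: "j \<notin> writes c \<Longrightarrow> sem c inp \<sigma> j = \<sigma> j"
proof (induction c arbitrary: \<sigma>)
  case (For x e c)
  have "((\<lambda>\<tau>. let \<tau>' = sem c inp \<tau> in upd \<tau>' x 0 (Suc (\<tau>' x 0))) ^^ m) (upd \<sigma> x 0 0) j = \<sigma> j" for m
    using For by (induction m) (auto simp: Let_def)
  then show ?case by simp
qed auto

lemma sem_For:
  assumes "x \<notin> writes c"
    and "I 0 (upd \<sigma> x 0 0)"
    and "\<And>i \<tau>. i < val e inp \<sigma> \<Longrightarrow> I i \<tau> \<Longrightarrow> \<tau> x 0 = i \<Longrightarrow> I (Suc i) (upd (sem c inp \<tau>) x 0 (Suc i))"
  shows "I (val e inp \<sigma>) (sem (For x e c) inp \<sigma>)"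
proof -
  let ?f = "\<lambda>\<tau>. let \<tau>' = sem c inp \<tau> in upd \<tau>' x 0 (Suc (\<tau>' x 0))"
  have "m \<le> val e inp \<sigma> \<Longrightarrow> I m ((?f ^^ m) (upd \<sigma> x 0 0)) \<and> (?f ^^ m) (upd \<sigma> x 0 0) x 0 = m" for m
  proof (induction m)
    case 0
    then show ?case using assms(2) by simp
  next
    case (Suc m)
    let ?\<tau> = "(?f ^^ m) (upd \<sigma> x 0 0)"
    have \<tau>: "I m ?\<tau>" "?\<tau> x 0 = m" using Suc by auto
    have "sem c inp ?\<tau> x = ?\<tau> x" using assms(1) by (simp add: sem_frame)
    then have "?f ?\<tau> = upd (sem c inp ?\<tau>) x 0 (Suc m)" using \<tau> by (simp add: Let_def)
    then show ?case using assms(3)[of m ?\<tau>] \<tau> Suc.prems by simp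
  qed
  then show ?thesis by simp
qed

subsection \<open>Compilation\<close>

text \<open>The arrays are interleaved in the cells with negative addresses; the input occupies the others.\<close>

definition addr :: "nat \<Rightarrow> nat \<Rightarrow> int" where
  "addr j i = - 1 - int j - 64 * int i"

lemma addr_inj [simp]:
  assumes "j < 64" "j' < 64"
  shows "addr j i = addr j' i' \<longleftrightarrow> j = j' \<and> i = i'"
proof
  note j = assms
  assume "addr j i = addr j' i'"
  with j have *: "j + 64 * i = j' + 64 * i'" unfolding addr_def by linarith
  from arg_cong[OF *, of "\<lambda>z. z mod 64"] j have "j = j'" by simp
  with * show "j = j' \<and> i = i'" by simp
qed simp

lemma addr_neg: "addr j i < 0"
  by (simp add: addr_def)

definition dbl :: "exp \<Rightarrow> exp" where "dbl e = Add e e"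

text \<open>Six nested \<open>dbl\<close> multiply by 64, the stride of \<open>addr\<close>, with
  additions only.\<close>

primrec cexp :: "nexp \<Rightarrow> exp" where
  "cexp (Cst z) = Const (int z)"
| "cexp (In e) = Mem (cexp e)"
| "cexp (Ar j e) = Mem (Sub (Const (- 1 - int j)) (dbl (dbl (dbl (dbl (dbl (dbl (cexp e))))))))"
| "cexp (Pl a b) = Add (cexp a) (cexp b)"

definition cadr :: "nat \<Rightarrow> nexp \<Rightarrow> exp" where
  "cadr j e = Sub (Const (- 1 - int j)) (dbl (dbl (dbl (dbl (dbl (dbl (cexp e)))))))"

primrec compile :: "ncom \<Rightarrow> com" where
  "compile Nop = Skip"
| "compile (Put j a e) = Store (cadr j a) (cexp e)"
| "compile (Sq c1 c2) = Seq (compile c1) (compile c2)"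
| "compile (Lt a b c1 c2) = IfPos (Sub (cexp b) (cexp a)) (compile c1) (compile c2)"
| "compile (For x e c) = Seq (Store (cadr x (Cst 0)) (Const 0))
    (WhilePos (Sub (cexp e) (cexp (Ar x (Cst 0))))
      (Seq (compile c) (Store (cadr x (Cst 0)) (cexp (Pl (Ar x (Cst 0)) (Cst 1))))))"

definition rep :: "(nat \<Rightarrow> nat) \<Rightarrow> arrs \<Rightarrow> store \<Rightarrow> bool" where
  "rep inp \<sigma> s \<longleftrightarrow> (\<forall>a. s (int a) = int (inp a)) \<and> (\<forall>j<64. \<forall>i. s (addr j i) = int (\<sigma> j i))"

lemma eval_cexp: "rep inp \<sigma> s \<Longrightarrow> wfe e \<Longrightarrow> eval (cexp e) s = int (val e inp \<sigma>)"
  by (induction e) (auto simp: rep_def dbl_def addr_def)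

lemma eval_cadr: "rep inp \<sigma> s \<Longrightarrow> wfe e \<Longrightarrow> eval (cadr j e) s = addr j (val e inp \<sigma>)"
  by (simp add: cadr_def dbl_def addr_def eval_cexp)

lemma rep_upd: "rep inp \<sigma> s \<Longrightarrow> j < 64 \<Longrightarrow> rep inp (upd \<sigma> j i x) (s(addr j i := int x))"
  using addr_neg[of j i] by (auto simp: rep_def upd_def)

section \<open>Running time of compiled loop programs\<close>

primrec bdd :: "nat \<Rightarrow> ncom \<Rightarrow> (nat \<Rightarrow> nat) \<Rightarrow> arrs \<Rightarrow> bool" where
  "bdd B Nop inp \<sigma> = True"
| "bdd B (Put j a e) inp \<sigma> = True"
| "bdd B (Sq c1 c2) inp \<sigma> = (bdd B c1 inp \<sigma> \<and> bdd B c2 inp (sem c1 inp \<sigma>))"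
| "bdd B (Lt a b c1 c2) inp \<sigma> = (if val a inp \<sigma> < val b inp \<sigma> then bdd B c1 inp \<sigma> else bdd B c2 inp \<sigma>)"
| "bdd B (For x e c) inp \<sigma> = (val e inp \<sigma> \<le> B \<and> (\<forall>i < val e inp \<sigma>.
    bdd B c inp (((\<lambda>\<tau>. let \<tau>' = sem c inp \<tau> in upd \<tau>' x 0 (Suc (\<tau>' x 0))) ^^ i) (upd \<sigma> x 0 0))))"

text \<open>Steps of the compiled program if no loop met in the run makes more than \<open>B\<close>
  rounds (\<open>bdd\<close>). A round costs its body, the increment and the test; a loop adds its
  initialisation and the last, failing test.\<close>

primrec tb :: "nat \<Rightarrow> ncom \<Rightarrow> nat" where
  "tb B Nop = 1"
| "tb B (Put j a e) = 1"
| "tb B (Sq c1 c2) = tb B c1 + tb B c2"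
| "tb B (Lt a b c1 c2) = tb B c1 + tb B c2 + 1"
| "tb B (For x e c) = 2 + B * (tb B c + 2)"

lemma exec_compile:
  assumes "wfc c" "rep inp \<sigma> s" "bdd B c inp \<sigma>"
  shows "\<exists>t s'. exec (compile c) s t s' \<and> rep inp (sem c inp \<sigma>) s' \<and> t \<le> tb B c"
  using assms
proof (induction c arbitrary: \<sigma> s)
  case Nop
  then show ?case using exec.Skip by fastforce
next
  case (Put j a e)
  then have "rep inp (upd \<sigma> j (val a inp \<sigma>) (val e inp \<sigma>)) (s(eval (cadr j a) s := eval (cexp e) s))"
    by (simp add: eval_cadr eval_cexp rep_upd)
  then show ?case using exec.Store by fastforce
next
  case (Sq c1 c2)
  from Sq.IH(1)[of \<sigma> s] Sq.prems obtain t1 s1 where 1: "exec (compile c1) s t1 s1"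
    "rep inp (sem c1 inp \<sigma>) s1" "t1 \<le> tb B c1" by auto
  from Sq.IH(2)[of "sem c1 inp \<sigma>" s1] 1 Sq.prems obtain t2 s2 where 2: "exec (compile c2) s1 t2 s2"
    "rep inp (sem c2 inp (sem c1 inp \<sigma>)) s2" "t2 \<le> tb B c2" by auto
  show ?case using exec.Seq[OF 1(1) 2(1)] 1 2 by (intro exI[of _ "t1 + t2"] exI[of _ s2]) auto
next
  case (Lt a b c1 c2)
  show ?case
  proof (cases "val a inp \<sigma> < val b inp \<sigma>")
    case True
    with Lt.IH(1)[of \<sigma> s] Lt.prems obtain t s' where *: "exec (compile c1) s t s'"
      "rep inp (sem c1 inp \<sigma>) s'" "t \<le> tb B c1" by auto
    have "eval (Sub (cexp b) (cexp a)) s > 0" using True Lt.prems by (simp add: eval_cexp)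
    from exec.IfTrue[OF this *(1)] * True show ?thesis
      by (intro exI[of _ "t + 1"] exI[of _ s']) auto
  next
    case False
    with Lt.IH(2)[of \<sigma> s] Lt.prems obtain t s' where *: "exec (compile c2) s t s'"
      "rep inp (sem c2 inp \<sigma>) s'" "t \<le> tb B c2" by auto
    have "eval (Sub (cexp b) (cexp a)) s \<le> 0" using False Lt.prems by (simp add: eval_cexp)
    from exec.IfFalse[OF this *(1)] * False show ?thesis
      by (intro exI[of _ "t + 1"] exI[of _ s']) auto
  qed
next
  case (For x e c)
  let ?f = "\<lambda>\<tau>. let \<tau>' = sem c inp \<tau> in upd \<tau>' x 0 (Suc (\<tau>' x 0))"
  define m where "m = val e inp \<sigma>"
  define st where "st i = (?f ^^ i) (upd \<sigma> x 0 0)" for i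
  have x: "x < 64" "x \<notin> writes c" "wfe e" "wfc c" and m: "m \<le> B"
    and rd: "\<And>j. j \<in> reads e \<Longrightarrow> j \<noteq> x \<and> j \<notin> writes c"
    and bc: "\<And>i. i < m \<Longrightarrow> bdd B c inp (st i)" using For.prems by (auto simp: st_def m_def)
  have st_Suc: "st (Suc i) = ?f (st i)" for i by (simp add: st_def)
  have st_x: "st i x 0 = i" for i
    by (induction i) (simp_all add: st_Suc Let_def sem_frame x, simp add: st_def)
  \<comment> \<open>The compiled loop evaluates its bound anew before every round; by
    well-formedness the value never changes, so there are exactly \<open>m\<close> rounds.\<close>
  have st_e: "val e inp (st i) = m" for i
  proof -
    have "j \<noteq> x \<Longrightarrow> j \<notin> writes c \<Longrightarrow> st i j = \<sigma> j" for j
      by (induction i) (simp_all add: st_Suc Let_def sem_frame, simp add: st_def)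
    then show ?thesis unfolding m_def using rd by (intro val_cong) auto
  qed
  define b where "b = Sub (cexp e) (cexp (Ar x (Cst 0)))"
  define ini where "ini = Store (cadr x (Cst 0)) (Const 0)"
  define inc where "inc = Store (cadr x (Cst 0)) (cexp (Pl (Ar x (Cst 0)) (Cst 1)))"
  have compile_For: "compile (For x e c) = Seq ini (WhilePos b (Seq (compile c) inc))"
    by (simp only: compile.simps b_def ini_def inc_def)
  have eval_b: "eval b s = int m - int i" if "rep inp (st i) s" for s i
    using eval_cexp[OF that, of e] eval_cexp[OF that, of "Ar x (Cst 0)"] x st_e st_x
    by (simp add: b_def)
  have ini: "\<exists>s'. exec ini s 1 s' \<and> rep inp (st 0) s'"
  proof -
    have "rep inp (st 0) (s(eval (cadr x (Cst 0)) s := eval (Const 0) s))"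
      using rep_upd[OF For.prems(2) x(1), of 0 0] eval_cadr[OF For.prems(2), of "Cst 0" x]
      by (simp add: st_def)
    then show ?thesis unfolding ini_def using exec.Store by blast
  qed
  have inc: "\<exists>s'. exec inc s 1 s' \<and> rep inp (st (Suc i)) s'" if "rep inp (sem c inp (st i)) s" for s i
  proof -
    have fr: "sem c inp (st i) x 0 = i" using x by (simp add: sem_frame st_x)
    have "eval (cadr x (Cst 0)) s = addr x 0" using eval_cadr[OF that, of "Cst 0" x] by simp
    moreover have "eval (cexp (Pl (Ar x (Cst 0)) (Cst 1))) s = int (Suc i)"
      using eval_cexp[OF that, of "Pl (Ar x (Cst 0)) (Cst 1)"] x(1) fr by (simp del: cexp.simps)
    moreover have "st (Suc i) = upd (sem c inp (st i)) x 0 (Suc i)"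
      unfolding st_Suc by (simp only: Let_def fr)
    ultimately have "rep inp (st (Suc i))
        (s(eval (cadr x (Cst 0)) s := eval (cexp (Pl (Ar x (Cst 0)) (Cst 1))) s))"
      using rep_upd[OF that x(1), of 0 "Suc i"] by (simp only: )
    then show ?thesis unfolding inc_def using exec.Store by blast
  qed
  \<comment> \<open>Induction on the number \<open>r\<close> of rounds still to come, that is, from
    the last round backwards.\<close>
  have loop: "\<exists>t s'. exec (WhilePos b (Seq (compile c) inc)) s t s' \<and> rep inp (st m) s' \<and>
      t \<le> 1 + r * (tb B c + 2)" if "rep inp (st (m - r)) s" "r \<le> m" for r s
    using that
  proof (induction r arbitrary: s)
    case 0
    then have "eval b s \<le> 0" using eval_b[of m s] by simp
    from exec.WhileFalse[OF this] 0 show ?case by (intro exI[of _ 1] exI[of _ s]) auto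
  next
    case (Suc r)
    let ?i = "m - Suc r"
    have i: "?i < m" "Suc ?i = m - r" using Suc.prems by auto
    have pos: "eval b s > 0" using eval_b[OF Suc.prems(1)] i by simp
    from For.IH[OF x(4) Suc.prems(1) bc[OF i(1)]] obtain t1 s1
      where 1: "exec (compile c) s t1 s1" "rep inp (sem c inp (st ?i)) s1" "t1 \<le> tb B c" by auto
    from inc[OF 1(2)] obtain s2 where 2: "exec inc s1 1 s2" "rep inp (st (m - r)) s2"
      unfolding i(2) by auto
    from Suc.IH[OF 2(2)] Suc.prems obtain t2 s3 where 3: "exec (WhilePos b (Seq (compile c) inc)) s2 t2 s3"
      "rep inp (st m) s3" "t2 \<le> 1 + r * (tb B c + 2)" by auto
    have "t1 + 1 + t2 + 1 \<le> 1 + Suc r * (tb B c + 2)" using 1(3) 3(3) by simp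
    with exec.WhileTrue[OF pos exec.Seq[OF 1(1) 2(1)] 3(1)] 3(2) show ?case by blast
  qed
  from ini obtain s0 where 0: "exec ini s 1 s0" "rep inp (st 0) s0" by blast
  from loop[of m s0] 0(2) obtain t s' where 2: "exec (WhilePos b (Seq (compile c) inc)) s0 t s'"
    "rep inp (st m) s'" "t \<le> 1 + m * (tb B c + 2)" by auto
  have "m * (tb B c + 2) \<le> B * (tb B c + 2)" using m by (rule mult_right_mono) simp
  then have "1 + t \<le> tb B (For x e c)" using 2(3) by simp
  moreover have "sem (For x e c) inp \<sigma> = st m" by (simp add: st_def m_def)
  ultimately show ?case using exec.Seq[OF 0(1) 2(1)] 2(2) unfolding compile_For by metis
qed

lemma bdd_mono: "bdd B c inp \<sigma> \<Longrightarrow> B \<le> B' \<Longrightarrow> bdd B' c inp \<sigma>"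
  by (induction c arbitrary: \<sigma>) auto

text \<open>Loop programs always halt: each of the finitely many rounds has its own bound by
  induction, and the maximum covers all of them. This suffices where only computability is
  claimed.\<close>

lemma bdd_exists: "\<exists>B. bdd B c inp \<sigma>"
proof (induction c arbitrary: \<sigma>)
  case (Sq c1 c2)
  obtain B1 where 1: "bdd B1 c1 inp \<sigma>" using Sq.IH(1)[of \<sigma>] by (rule exE)
  obtain B2 where 2: "bdd B2 c2 inp (sem c1 inp \<sigma>)" using Sq.IH(2)[of "sem c1 inp \<sigma>"] by (rule exE)
  from bdd_mono[OF 1, of "max B1 B2"] bdd_mono[OF 2, of "max B1 B2"]
  have "bdd (max B1 B2) (Sq c1 c2) inp \<sigma>" by simp
  then show ?case by (rule exI)
next
  case (Lt a b c1 c2)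
  then show ?case by (cases "val a inp \<sigma> < val b inp \<sigma>") simp_all
next
  case (For x e c)
  define st where
    "st i = ((\<lambda>\<tau>. let \<tau>' = sem c inp \<tau> in upd \<tau>' x 0 (Suc (\<tau>' x 0))) ^^ i) (upd \<sigma> x 0 0)" for i
  define b where "b i = (SOME B. bdd B c inp (st i))" for i
  have b: "bdd (b i) c inp (st i)" for i
    unfolding b_def by (rule someI_ex) (rule For.IH)
  define B where "B = Max (insert (val e inp \<sigma>) (b ` {..<val e inp \<sigma>}))"
  have "bdd B c inp (st i)" if "i < val e inp \<sigma>" for i
    unfolding B_def using that by (intro bdd_mono[OF b[of i]] Max_ge) auto
  moreover have "val e inp \<sigma> \<le> B" unfolding B_def by (rule Max_ge) auto
  ultimately have "bdd B (For x e c) inp \<sigma>" unfolding st_def by simp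
  then show ?case by (rule exI)
qed simp_all

primrec bounds :: "ncom \<Rightarrow> nexp set" where
  "bounds Nop = {}"
| "bounds (Put j a e) = {}"
| "bounds (Sq c1 c2) = bounds c1 \<union> bounds c2"
| "bounds (Lt a b c1 c2) = bounds c1 \<union> bounds c2"
| "bounds (For x e c) = insert e (bounds c)"

text \<open>Bounds that read no array written by the program keep their value during the whole run,
  so they may be checked in the initial state.\<close>

lemma bdd_static:
  assumes "\<And>e. e \<in> bounds c \<Longrightarrow> reads e \<inter> W = {} \<and> val e inp \<sigma> \<le> B" "writes c \<subseteq> W"
  shows "bdd B c inp \<sigma>"
  using assms
proof (induction c arbitrary: \<sigma>)
  case (Sq c1 c2)
  have "val e inp (sem c1 inp \<sigma>) = val e inp \<sigma>" if "e \<in> bounds c2" for e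
    using Sq.prems that by (intro val_cong sem_frame) auto
  then show ?case using Sq by auto
next
  case (For x e c)
  let ?st = "\<lambda>i. ((\<lambda>\<tau>. let \<tau>' = sem c inp \<tau> in upd \<tau>' x 0 (Suc (\<tau>' x 0))) ^^ i) (upd \<sigma> x 0 0)"
  have "j \<notin> W \<Longrightarrow> ?st i j = \<sigma> j" for i j
  proof -
    assume "j \<notin> W"
    then have "j \<noteq> x" "j \<notin> writes c" using For.prems(2) by auto
    then show "?st i j = \<sigma> j" by (induction i) (auto simp: Let_def sem_frame)
  qed
  then have "val e' inp (?st i) = val e' inp \<sigma>" if "e' \<in> bounds c" for i e'
    using For.prems that by (intro val_cong) auto
  then have "bdd B c inp (?st i)" for i using For.prems by (intro For.IH) auto
  then show ?case using For.prems by auto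
qed auto

lemma poly_weaken:
  fixes C D D' B :: nat
  assumes "\<And>B. f B \<le> C * (B + 1) ^ D"
  shows "f B \<le> C * (B + 1) ^ (D + D')"
  by (rule order_trans[OF assms]) (intro mult_left_mono power_increasing, auto)

text \<open>Exponents of consecutive parts are added and each loop contributes one more factor, so
  \<open>C\<close> and \<open>D\<close> depend on the program only. Bounded loop counts thus give
  polynomial time.\<close>

lemma tb_poly: "\<exists>C D. \<forall>B. tb B c \<le> C * (B + 1) ^ D"
proof (induction c)
  case Nop
  show ?case by (intro exI[of _ 1] exI[of _ 0]) simp
next
  case (Put j a e)
  show ?case by (intro exI[of _ 1] exI[of _ 0]) simp
next
  case (Sq c1 c2)
  then obtain C1 D1 C2 D2 where 1: "\<And>B. tb B c1 \<le> C1 * (B + 1) ^ D1"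
    and 2: "\<And>B. tb B c2 \<le> C2 * (B + 1) ^ D2" by blast
  have "tb B (Sq c1 c2) \<le> (C1 + C2) * (B + 1) ^ (D1 + D2)" for B
    using add_mono[OF poly_weaken[OF 1, of B D2] poly_weaken[OF 2, of B D1]]
    by (simp add: distrib_right add.commute[of D2 D1])
  then show ?case by blast
next
  case (Lt a b c1 c2)
  then obtain C1 D1 C2 D2 where 1: "\<And>B. tb B c1 \<le> C1 * (B + 1) ^ D1"
    and 2: "\<And>B. tb B c2 \<le> C2 * (B + 1) ^ D2" by blast
  have "tb B (Lt a b c1 c2) \<le> (C1 + C2 + 1) * (B + 1) ^ (D1 + D2)" for B
  proof -
    have "1 \<le> (B + 1) ^ (D1 + D2)" by (rule one_le_power) simp
    from add_mono[OF add_mono[OF poly_weaken[OF 1, of B D2] poly_weaken[OF 2, of B D1]] this]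
    show ?thesis by (simp add: distrib_right add.commute[of D2 D1])
  qed
  then show ?case by blast
next
  case (For x e c)
  then obtain C D where CD: "\<And>B. tb B c \<le> C * (B + 1) ^ D" by blast
  have "tb B (For x e c) \<le> (C + 4) * (B + 1) ^ Suc D" for B
  proof -
    have "1 \<le> (B + 1) ^ D" by (rule one_le_power) simp
    then have p: "4 \<le> 4 * (B + 1) ^ D" by simp
    have "tb B (For x e c) \<le> 2 + B * (C * (B + 1) ^ D + 2)"
      using mult_left_mono[OF CD[of B], of B] by (simp add: distrib_left)
    also have "\<dots> \<le> (B + 1) * (C * (B + 1) ^ D + 4)" by (simp add: distrib_left distrib_right)
    also have "\<dots> \<le> (B + 1) * (C * (B + 1) ^ D + 4 * (B + 1) ^ D)"
      using p by (intro mult_left_mono add_left_mono) auto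
    also have "\<dots> = (C + 4) * (B + 1) ^ Suc D" by (simp add: distrib_right distrib_left mult_ac)
    finally show ?thesis .
  qed
  then show ?case by blast
qed

section \<open>Forests and components of vertex sets\<close>

locale sgraph =
  fixes E :: "nat \<Rightarrow> nat \<Rightarrow> bool" and n :: nat
  assumes E_sym: "E u v \<Longrightarrow> E v u" and E_irrefl: "\<not> E u u" and E_bound: "E u v \<Longrightarrow> v < n"
begin

definition nb :: "nat \<Rightarrow> nat set \<Rightarrow> nat set" where
  "nb v A = {u \<in> A. E v u}"

text \<open>Forests as graphs whose nonempty induced subgraphs all have a vertex of degree at most
  one. This form passes to subsets at once and fits the removal of leaves;
  \<open>acyclic_graph_sub\<close> identifies it with the absence of cycles of length at least
  three.\<close>

definition acyc :: "nat set \<Rightarrow> bool" where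
  "acyc A \<longleftrightarrow> (\<forall>T \<subseteq> A. T \<noteq> {} \<longrightarrow> (\<exists>v \<in> T. card (nb v T) \<le> 1))"

text \<open>A vertex outside \<open>A\<close> is connected to itself only, so reflexivity holds
  without a membership condition.\<close>

definition conn :: "nat set \<Rightarrow> nat \<Rightarrow> nat \<Rightarrow> bool" where
  "conn A = (\<lambda>a b. a \<in> A \<and> b \<in> A \<and> E a b)\<^sup>*\<^sup>*"

text \<open>A single set \<open>H\<close> collects the feedback vertices of all components; the size
  condition becomes a count in the component of each vertex.\<close>

definition hb :: "nat \<Rightarrow> nat set \<Rightarrow> nat set \<Rightarrow> bool" where
  "hb d A H \<longleftrightarrow> (\<forall>x \<in> A. card {h \<in> H. h \<in> A \<and> conn A x h} \<le> d)"

definition sol :: "nat \<Rightarrow> nat \<Rightarrow> nat set \<Rightarrow> nat set \<Rightarrow> nat set \<Rightarrow> bool" where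
  "sol k d V X H \<longleftrightarrow> X \<subseteq> V \<and> H \<subseteq> V - X \<and> card X \<le> k \<and> acyc (V - X - H) \<and> hb d (V - X) H"

lemma finite_nb [simp]: "finite (nb v A)"
  by (rule finite_subset[of _ "{..<n}"]) (auto simp: nb_def dest: E_bound)

lemma nb_mono: "A \<subseteq> B \<Longrightarrow> nb v A \<subseteq> nb v B"
  by (auto simp: nb_def)

lemma card_nb_mono: "A \<subseteq> B \<Longrightarrow> card (nb v A) \<le> card (nb v B)"
  by (intro card_mono nb_mono) auto

lemma nb_insert_self [simp]: "nb v (insert v A) = nb v A"
  by (auto simp: nb_def E_irrefl)

lemma acyc_subset: "acyc B \<Longrightarrow> A \<subseteq> B \<Longrightarrow> acyc A"
  by (auto simp: acyc_def)

lemma acyc_insert: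
  assumes "acyc A" "card (nb v A) \<le> 1"
  shows "acyc (insert v A)"
  unfolding acyc_def
proof (intro allI impI)
  fix T assume T: "T \<subseteq> insert v A" "T \<noteq> {}"
  show "\<exists>w \<in> T. card (nb w T) \<le> 1"
  proof (cases "v \<in> T")
    case True
    have "card (nb v T) \<le> card (nb v A)" using card_nb_mono[OF T(1), of v] by simp
    with True assms(2) show ?thesis by (intro bexI[of _ v]) auto
  next
    case False
    with T assms(1) show ?thesis unfolding acyc_def by blast
  qed
qed

section \<open>Connectivity inside a vertex set and feedback vertices per component\<close>

lemma conn_refl [simp]: "conn A x x"
  by (simp add: conn_def)

lemma conn_step: "a \<in> A \<Longrightarrow> b \<in> A \<Longrightarrow> E a b \<Longrightarrow> conn A a b"
  by (auto simp: conn_def)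

lemma conn_trans: "conn A x y \<Longrightarrow> conn A y z \<Longrightarrow> conn A x z"
  by (auto simp: conn_def)

lemma conn_sym: "conn A x y \<Longrightarrow> conn A y x"
  unfolding conn_def by (induction rule: rtranclp_induct)
    (auto intro: converse_rtranclp_into_rtranclp E_sym)

lemma conn_mono: "conn A x y \<Longrightarrow> A \<subseteq> B \<Longrightarrow> conn B x y"
  unfolding conn_def by (erule rtranclp_mono[THEN predicate2D, rotated]) auto

lemma conn_in: "conn A x y \<Longrightarrow> x \<in> A \<Longrightarrow> y \<in> A"
  unfolding conn_def by (induction rule: rtranclp_induct) auto

lemma conn_bound: "conn A x y \<Longrightarrow> y \<in> insert x {..<n}"
  unfolding conn_def by (induction rule: rtranclp_induct) (auto dest: E_bound)

lemma conn_closed: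
  assumes "conn A x y" "x \<in> C" "\<And>a b. a \<in> C \<Longrightarrow> b \<in> A \<Longrightarrow> E a b \<Longrightarrow> b \<in> C"
  shows "y \<in> C \<and> conn (A \<inter> C) x y"
  using assms(1) unfolding conn_def[of A]
proof (induction rule: rtranclp_induct)
  case base
  show ?case using assms(2) by simp
next
  case (step y z)
  then have "z \<in> C" using assms(3) by blast
  with step have "conn (A \<inter> C) y z" by (intro conn_step) auto
  with step \<open>z \<in> C\<close> show ?case by (blast intro: conn_trans)
qed

lemma finite_hubs [simp]: "finite {h \<in> H. h \<in> A \<and> conn A x h}"
proof (rule finite_subset)
  show "{h \<in> H. h \<in> A \<and> conn A x h} \<subseteq> insert x {..<n}"
    by (intro subsetI, elim CollectE conjE) (rule conn_bound)
qed simp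

text \<open>A walk through \<open>v\<close> leaves and re-enters \<open>C\<close> at neighbours of
  \<open>v\<close>, which are connected in \<open>C\<close> already, so the detour can be replaced.
  Attaching \<open>v\<close> merges nothing.\<close>

lemma conn_attach:
  assumes "conn (insert v C) x y" "x \<in> C" "v \<notin> C"
    and nbs: "\<And>a b. a \<in> nb v C \<Longrightarrow> b \<in> nb v C \<Longrightarrow> conn C a b"
  shows "(y \<in> C \<longrightarrow> conn C x y) \<and> (y = v \<longrightarrow> (\<exists>a \<in> nb v C. conn C x a))"
  using assms(1) unfolding conn_def[of "insert v C"]
proof (induction rule: rtranclp_induct)
  case base
  show ?case using assms(2,3) by auto
next
  case (step y z)
  have xC: "y \<in> C \<Longrightarrow> conn C x y" using step.IH by blast
  consider "y \<in> C" "z \<in> C" | "y \<in> C" "z = v" | "y = v" "z \<in> C"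
    using step.hyps(2) E_irrefl by blast
  then show ?case
  proof cases
    case 1
    then have "conn C y z" using step.hyps by (intro conn_step) auto
    with 1 xC assms(3) show ?thesis by (blast intro: conn_trans)
  next
    case 2
    then have "y \<in> nb v C" using step.hyps E_sym by (auto simp: nb_def)
    with 2 xC assms(3) show ?thesis by blast
  next
    case 3
    then have "z \<in> nb v C" using step.hyps by (auto simp: nb_def)
    with 3 step.IH nbs assms(3) show ?thesis by (blast intro: conn_trans)
  qed
qed

lemma hb_mono:
  assumes "hb d B H" "A \<subseteq> B" "H' \<subseteq> H"
  shows "hb d A H'"
  unfolding hb_def
proof
  fix x assume "x \<in> A"
  have "card {h \<in> H'. h \<in> A \<and> conn A x h} \<le> card {h \<in> H. h \<in> B \<and> conn B x h}"
    using assms(2,3) conn_mono by (intro card_mono) auto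
  also have "\<dots> \<le> d" using assms(1,2) \<open>x \<in> A\<close> by (auto simp: hb_def)
  finally show "card {h \<in> H'. h \<in> A \<and> conn A x h} \<le> d" .
qed

text \<open>The new vertex joins at most one component and is no feedback vertex itself, so no count
  rises. The condition on its neighbours is the negation of \<open>multi\<close>, and it also covers
  vertices of degree at most one.\<close>

lemma hb_attach:
  assumes "hb d C H" "v \<notin> C" "v \<notin> H"
    and nbs: "\<And>a b. a \<in> nb v C \<Longrightarrow> b \<in> nb v C \<Longrightarrow> conn C a b"
  shows "hb d (insert v C) H"
  unfolding hb_def
proof
  let ?S = "\<lambda>A x. {h \<in> H. h \<in> A \<and> conn A x h}"
  have old: "card (?S (insert v C) x) \<le> d" if "x \<in> C" for x
  proof -
    have "?S (insert v C) x \<subseteq> ?S C x"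
    proof (intro subsetI, elim CollectE conjE)
      fix h assume h: "h \<in> H" "h \<in> insert v C" "conn (insert v C) x h"
      then have "h \<in> C" using assms(3) by auto
      with conn_attach[OF h(3) that assms(2) nbs] h(1) show "h \<in> ?S C x" by simp
    qed
    then have "card (?S (insert v C) x) \<le> card (?S C x)" by (rule card_mono[OF finite_hubs])
    also have "\<dots> \<le> d" using assms(1) that unfolding hb_def by (rule bspec)
    finally show ?thesis .
  qed
  fix x assume x: "x \<in> insert v C"
  show "card (?S (insert v C) x) \<le> d"
  proof (cases "x \<in> C")
    case True
    then show ?thesis by (rule old)
  next
    case False
    with x have x: "x = v" by simp
    show ?thesis
    proof (cases "nb v C = {}")
      case True
      have "h = v" if "conn (insert v C) v h" for h
        using that unfolding conn_def
        by (cases rule: converse_rtranclpE) (use True E_irrefl in \<open>auto simp: nb_def\<close>)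
      then have S: "?S (insert v C) x = {}" using assms(3) x by auto
      show ?thesis unfolding S by simp
    next
      case False
      then obtain a where a: "a \<in> C" "E v a" by (auto simp: nb_def)
      then have "conn (insert v C) a v" using E_sym by (intro conn_step) auto
      then have "?S (insert v C) x \<subseteq> ?S (insert v C) a"
        unfolding x using conn_trans[of "insert v C" a v] by (intro subsetI, elim CollectE conjE) simp
      then have "card (?S (insert v C) x) \<le> card (?S (insert v C) a)"
        by (rule card_mono[OF finite_hubs])
      with old[OF a(1)] show ?thesis by linarith
    qed
  qed
qed

text \<open>A feedback vertex and its neighbour lie in the same component, so replacing one by the
  other raises no count. If \<open>T\<close> is empty, the feedback vertex is simply
  dropped.\<close>

lemma hb_swap:
  assumes "hb d A H" "v \<in> A" "v \<in> H" "T \<subseteq> nb v A" "card T \<le> 1"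
  shows "hb d A (H - {v} \<union> T)"
  unfolding hb_def
proof
  fix x assume x: "x \<in> A"
  let ?S = "\<lambda>H. {h \<in> H. h \<in> A \<and> conn A x h}"
  have le: "card (?S H) \<le> d" using assms(1) x by (auto simp: hb_def)
  have "card (?S (H - {v} \<union> T)) \<le> card (?S H)"
  proof (cases "\<exists>u \<in> T. conn A x u")
    case False
    then have "?S (H - {v} \<union> T) \<subseteq> ?S H" by blast
    then show ?thesis by (rule card_mono[OF finite_hubs])
  next
    case True
    then obtain u where u: "u \<in> T" "conn A x u" by blast
    have "finite T" using assms(4) by (rule finite_subset) simp
    with u assms(5) have T: "T = {u}" using card_le_Suc0_iff_eq[of T] by auto
    have "u \<in> A" "E v u" using u assms(4) by (auto simp: nb_def)
    then have "conn A u v" using assms(2) E_sym by (intro conn_step) auto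
    with u(2) have "conn A x v" by (rule conn_trans)
    then have v: "v \<in> ?S H" using assms(2,3) by simp
    have "?S (H - {v} \<union> T) \<subseteq> insert u (?S H - {v})" using T by auto
    then have "card (?S (H - {v} \<union> T)) \<le> card (insert u (?S H - {v}))"
      by (rule card_mono[rotated]) (rule finite.insertI[OF finite_Diff[OF finite_hubs]])
    also have "\<dots> \<le> Suc (card (?S H - {v}))" by (rule card_insert_le_m1) simp_all
    also have "\<dots> = card (?S H)" by (rule card_Suc_Diff1[OF finite_hubs v])
    finally show ?thesis .
  qed
  with le show "card (?S (H - {v} \<union> T)) \<le> d" by linarith
qed

section \<open>The number of components of a vertex set\<close>

definition cpt :: "nat set \<Rightarrow> nat \<Rightarrow> nat set" where
  "cpt A x = {y. conn A x y}"

definition ncomp :: "nat set \<Rightarrow> nat" where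
  "ncomp A = card (cpt A ` A)"

lemma cpt_eq_iff: "cpt A x = cpt A y \<longleftrightarrow> conn A x y"
proof
  assume eq: "cpt A x = cpt A y"
  have "y \<in> cpt A y" by (simp add: cpt_def)
  then show "conn A x y" unfolding eq[symmetric] by (simp add: cpt_def)
next
  assume xy: "conn A x y"
  show "cpt A x = cpt A y"
    unfolding cpt_def using conn_trans[OF xy] conn_trans[OF conn_sym[OF xy]] by blast
qed

lemma cpt_subset: "x \<in> A \<Longrightarrow> cpt A x \<subseteq> A"
  using conn_in by (auto simp: cpt_def)

text \<open>After the insertion of \<open>v\<close>, the component of an old vertex is a function of
  its component before, namely the union taken here. Counting images under this merging map shows
  that the old vertices never get more components.\<close>

lemma Union_cpt_insert: "(\<Union>y \<in> cpt A x. cpt (insert v A) y) = cpt (insert v A) x"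
proof (intro equalityI subsetI)
  fix z assume "z \<in> (\<Union>y \<in> cpt A x. cpt (insert v A) y)"
  then obtain y where "conn A x y" "conn (insert v A) y z" by (auto simp: cpt_def)
  then show "z \<in> cpt (insert v A) x"
    using conn_mono[of A x y "insert v A"] conn_trans[of "insert v A" x y z] by (auto simp: cpt_def)
next
  fix z assume "z \<in> cpt (insert v A) x"
  moreover have "x \<in> cpt A x" by (simp add: cpt_def)
  ultimately show "z \<in> (\<Union>y \<in> cpt A x. cpt (insert v A) y)" by blast
qed

lemma cpt_insert_image:
  shows "cpt (insert v A) ` A = (\<lambda>K. \<Union>y\<in>K. cpt (insert v A) y) ` (cpt A ` A)"
  by (simp add: image_image Union_cpt_insert)

lemma ncomp_insert:
  assumes "finite A" "v \<notin> A"
  shows "ncomp (insert v A) \<le> Suc (ncomp A)"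
proof -
  have "card (cpt (insert v A) ` A) \<le> ncomp A"
    unfolding cpt_insert_image ncomp_def using assms(1) by (intro card_image_le) auto
  moreover have "card (insert (cpt (insert v A) v) (cpt (insert v A) ` A)) \<le> Suc (card (cpt (insert v A) ` A))"
    using assms(1) by (intro card_insert_le_m1) auto
  ultimately show ?thesis by (simp add: ncomp_def)
qed

lemma ncomp_insert_nb:
  assumes "finite A" "v \<notin> A" "nb v A \<noteq> {}"
  shows "ncomp (insert v A) \<le> ncomp A"
proof -
  obtain a where a: "a \<in> A" "E v a" using assms(3) by (auto simp: nb_def)
  then have "cpt (insert v A) v = cpt (insert v A) a"
    unfolding cpt_eq_iff by (intro conn_step) auto
  then have "cpt (insert v A) ` insert v A = cpt (insert v A) ` A" using a by auto
  then have "ncomp (insert v A) = card (cpt (insert v A) ` A)" by (simp add: ncomp_def)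
  also have "\<dots> \<le> ncomp A"
    unfolding cpt_insert_image ncomp_def using assms(1) by (intro card_image_le) auto
  finally show ?thesis .
qed

text \<open>The components of \<open>a\<close> and \<open>b\<close> have the same image under the
  merging map, so one of them can be left out of the domain, and \<open>v\<close> lies in their
  common image.\<close>

lemma ncomp_insert_merge:
  assumes "finite A" "v \<notin> A" "a \<in> nb v A" "b \<in> nb v A" "\<not> conn A a b"
  shows "Suc (ncomp (insert v A)) \<le> ncomp A"
proof -
  let ?\<Phi> = "\<lambda>K. \<Union>y\<in>K. cpt (insert v A) y"
  have ab: "a \<in> A" "E v a" "b \<in> A" "E v b" using assms(3,4) by (auto simp: nb_def)
  have eq: "cpt (insert v A) v = cpt (insert v A) a" "cpt (insert v A) v = cpt (insert v A) b"
    unfolding cpt_eq_iff using ab by (auto intro!: conn_step)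
  have \<Phi>: "?\<Phi> (cpt A x) = cpt (insert v A) x" for x
    by (rule Union_cpt_insert)
  have ne: "cpt A a \<noteq> cpt A b" using assms(5) by (simp add: cpt_eq_iff)
  have "cpt (insert v A) ` insert v A = cpt (insert v A) ` A"
    using eq(1) ab(1) by (simp add: insert_absorb)
  also have "\<dots> = ?\<Phi> ` (cpt A ` A)" by (rule cpt_insert_image)
  also have "\<dots> = insert (?\<Phi> (cpt A b)) (?\<Phi> ` (cpt A ` A - {cpt A b}))"
    using arg_cong[OF insert_Diff[OF imageI[OF ab(3), of "cpt A"]], of "image ?\<Phi>"]
    by (simp only: image_insert)
  also have "\<dots> = ?\<Phi> ` (cpt A ` A - {cpt A b})"
  proof (rule insert_absorb)
    have "?\<Phi> (cpt A b) = ?\<Phi> (cpt A a)" unfolding \<Phi> using eq by (rule trans[OF sym, rotated])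
    moreover have "cpt A a \<in> cpt A ` A - {cpt A b}" using ne ab(1) by simp
    ultimately show "?\<Phi> (cpt A b) \<in> ?\<Phi> ` (cpt A ` A - {cpt A b})" by (rule image_eqI)
  qed
  finally have "ncomp (insert v A) = card (?\<Phi> ` (cpt A ` A - {cpt A b}))"
    by (simp only: ncomp_def)
  moreover have "card (?\<Phi> ` (cpt A ` A - {cpt A b})) \<le> card (cpt A ` A - {cpt A b})"
    using assms(1) by (intro card_image_le) simp
  moreover have "Suc (card (cpt A ` A - {cpt A b})) = ncomp A"
    unfolding ncomp_def using assms(1) ab by (intro card_Suc_Diff1) auto
  ultimately show ?thesis by linarith
qed

lemma ncomp_le_card: "finite A \<Longrightarrow> ncomp A \<le> card A"
  unfolding ncomp_def by (rule card_image_le)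

text \<open>Every component of the smaller set lies inside one of \<open>B\<close>. This keeps the
  component term of the measure above the number of feedback vertices.\<close>

lemma hubs_le_ncomp:
  assumes "hb d B H" "A \<subseteq> B" "finite A"
  shows "card (H \<inter> A) \<le> d * ncomp A"
proof -
  have "H \<inter> A \<subseteq> (\<Union>K \<in> cpt A ` A. H \<inter> K)" by (auto simp: cpt_def)
  moreover have fin: "finite K" if "K \<in> cpt A ` A" for K
  proof -
    from that obtain x where "x \<in> A" "K = cpt A x" by blast
    then have "K \<subseteq> A" by (simp add: cpt_subset)
    then show ?thesis using assms(3) by (rule finite_subset)
  qed
  ultimately have "card (H \<inter> A) \<le> card (\<Union>K \<in> cpt A ` A. H \<inter> K)"
    using assms(3) by (intro card_mono) auto
  also have "\<dots> \<le> (\<Sum>K \<in> cpt A ` A. card (H \<inter> K))"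
    using assms(3) by (intro card_UN_le) auto
  also have "\<dots> \<le> (\<Sum>K \<in> cpt A ` A. d)"
  proof (intro sum_mono)
    fix K assume "K \<in> cpt A ` A"
    then obtain x where x: "x \<in> A" "K = cpt A x" by blast
    have "H \<inter> K \<subseteq> {h \<in> H. h \<in> A \<and> conn A x h}"
      unfolding x(2) cpt_def using conn_in[OF _ x(1)] by blast
    then have "card (H \<inter> K) \<le> card {h \<in> H. h \<in> A \<and> conn A x h}"
      by (rule card_mono[OF finite_hubs])
    also have "\<dots> \<le> d" using hb_mono[OF assms(1,2) order_refl] x(1) unfolding hb_def by (rule bspec)
    finally show "card (H \<inter> K) \<le> d" .
  qed
  also have "\<dots> = d * ncomp A" by (simp add: ncomp_def)
  finally show ?thesis .
qed

text \<open>Twice the number of edges inside \<open>A\<close>. For a finite forest,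
  \<open>2 * card A - degsum A\<close> is twice its number of trees.\<close>

definition degsum :: "nat set \<Rightarrow> nat" where
  "degsum A = (\<Sum>v\<in>A. card (nb v A))"

lemma degsum_insert:
  assumes "finite A" "v \<notin> A"
  shows "degsum (insert v A) = degsum A + 2 * card (nb v A)"
proof -
  have "card (nb w (insert v A)) = card (nb w A) + (if E v w then 1 else 0)" if "w \<in> A" for w
  proof -
    have "nb w (insert v A) = (if E v w then insert v (nb w A) else nb w A)"
      using E_sym by (auto simp: nb_def)
    moreover have "v \<notin> nb w A" using assms(2) by (auto simp: nb_def)
    ultimately show ?thesis by simp
  qed
  then have "(\<Sum>w\<in>A. card (nb w (insert v A))) = (\<Sum>w\<in>A. card (nb w A) + (if E v w then 1 else 0))"
    by (intro sum.cong) auto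
  also have "\<dots> = degsum A + card (nb v A)"
    using assms(1) by (simp add: sum.distrib degsum_def nb_def sum.If_cases Int_def)
  finally show ?thesis using assms by (simp add: degsum_def[of "insert v A"])
qed

text \<open>Removing a vertex of degree at most one lowers the left side by at most two and the
  right side by two.\<close>

lemma degsum_le:
  assumes "finite A" "acyc A"
  shows "degsum A \<le> 2 * card A"
  using assms
proof (induction "card A" arbitrary: A)
  case 0
  then show ?case by (simp add: degsum_def)
next
  case (Suc m)
  then obtain v where v: "v \<in> A" "card (nb v A) \<le> 1" unfolding acyc_def
    by (metis card.empty nat.distinct(1) order_refl)
  have A: "insert v (A - {v}) = A" using v by auto
  have "degsum (A - {v}) \<le> 2 * card (A - {v})"
    using Suc v by (intro Suc.hyps(1)) (auto intro: acyc_subset)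
  moreover have "degsum A = degsum (A - {v}) + 2 * card (nb v (A - {v}))"
    using degsum_insert[of "A - {v}" v] Suc.prems A by simp
  moreover have "card (nb v (A - {v})) \<le> 1" using v card_nb_mono[of "A - {v}" A v] by auto
  moreover have "card A = Suc (card (A - {v}))" using v Suc.prems by (intro card.remove)
  ultimately show ?case by simp
qed

end

section \<open>The elimination process\<close>

text \<open>
  The vertices of \<open>F\<close> are undecided, those of \<open>X\<close> are deleted, those of \<open>H\<close> are feedback vertices,
  and those of \<open>O\<close> are neither. The vertices of \<open>N\<close> are kept as well, but it is known that
  they lie on no cycle that avoids \<open>H\<close>, so they matter for connectivity only. A vertex of the graph
  in none of the five sets has been discarded because it was pendant.
\<close>

datatype cfg = Cfg (cF: "nat set") (cO: "nat set") (cN: "nat set") (cH: "nat set") (cX: "nat set")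

text \<open>The digit \<open>r\<close> stands for deleted, feedback vertex or kept. For a kept
  vertex, \<open>a\<close> is the number of its neighbours in \<open>O\<close>: a leaf without any
  lies on no cycle and goes to \<open>N\<close>, because as a new tree of \<open>O\<close> it would
  raise the measure by two. Vertices of \<open>X0\<close> and hubs are placed with
  \<open>a = 1\<close>, since they may lie on cycles.\<close>

fun place :: "nat \<Rightarrow> nat \<Rightarrow> nat \<Rightarrow> cfg \<Rightarrow> cfg" where
  "place r a v (Cfg F O' N H X) =
    (if r = 0 then Cfg (F - {v}) O' N H (insert v X)
     else if r = 1 then Cfg (F - {v}) O' N (insert v H) X
     else if a = 0 then Cfg (F - {v}) O' (insert v N) H X
     else Cfg (F - {v}) (insert v O') N H X)"

context sgraph
begin

definition leaves :: "nat set \<Rightarrow> nat set" where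
  "leaves F = {v \<in> F. card (nb v F) \<le> 1}"

text \<open>Keeping such a vertex merges components of kept vertices and adds up their feedback
  vertices, so the exchange argument does not apply; in return the component count in
  \<open>mu\<close> drops.\<close>

definition multi :: "nat set \<Rightarrow> nat \<Rightarrow> bool" where
  "multi U v \<longleftrightarrow> (\<exists>a \<in> nb v U. \<exists>b \<in> nb v U. \<not> conn U a b)"

text \<open>The second component is the guess, read as a sequence of ternary digits from the least
  significant one on.\<close>

fun step :: "nat set \<Rightarrow> cfg \<times> nat \<Rightarrow> cfg \<times> nat" where
  "step oH (Cfg F O' N H X, c) =
    (if leaves F \<noteq> {} then
       (let v = Max (leaves F); a = card (nb v O'); U = O' \<union> N \<union> H in
        if nb v U = {} then (Cfg (F - {v}) O' N H X, c)
        else if a \<le> 1 \<and> \<not> multi U v then (place 2 a v (Cfg F O' N H X), c)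
        else (place (c mod 3) a v (Cfg F O' N H X), c div 3))
     else if F \<inter> oH \<noteq> {} then (place (c mod 3) 1 (Max (F \<inter> oH)) (Cfg F O' N H X), c div 3)
     else (Cfg F O' N H X, c))"

end

text \<open>\<open>R\<close> is closed under the edges of the graph without \<open>X1\<close>, so
  the elimination inside it is independent of the rest. The old solution enters through
  \<open>stuck\<close> alone: a leafless remainder contains vertices of \<open>oH\<close>, all of
  them in \<open>Q\<close>.\<close>

locale run = sgraph +
  fixes V X0 X1 R Q oH :: "nat set" and k d :: nat
  assumes V: "V \<subseteq> {..<n}" and R: "R \<subseteq> V - X1"
    and R_closed: "v \<in> R \<Longrightarrow> u \<in> V - X1 \<Longrightarrow> E v u \<Longrightarrow> u \<in> R"
    and stuck: "F \<subseteq> R - X0 \<Longrightarrow> leaves F = {} \<Longrightarrow> F \<noteq> {} \<Longrightarrow> F \<inter> oH \<noteq> {} \<and> F \<inter> oH \<subseteq> Q"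
begin

text \<open>The partial solution of the configuration can be completed by deleting \<open>Y\<close> and adding \<open>S\<close>
  to the feedback vertices.\<close>

fun ext :: "cfg \<Rightarrow> nat set \<Rightarrow> nat set \<Rightarrow> bool" where
  "ext (Cfg F O' N H X) Y S \<longleftrightarrow> Y \<subseteq> F \<and> S \<subseteq> F - Y \<and> card Y + card X \<le> k \<and>
     acyc (F \<union> O' - Y - S) \<and> hb d (F \<union> O' \<union> N \<union> H - Y) (H \<union> S)"

text \<open>Completing the configuration yields a solution of the whole graph, in which the vertices of
  \<open>N\<close> and the discarded ones can be put back one by one as leaves.\<close>

fun lift :: "cfg \<Rightarrow> bool" where
  "lift (Cfg F O' N H X) \<longleftrightarrow> (\<forall>Y S. Y \<subseteq> F \<longrightarrow> S \<subseteq> F - Y \<longrightarrow> acyc (F \<union> O' - Y - S) \<longrightarrow>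
     hb d (F \<union> O' \<union> N \<union> H - Y) (H \<union> S) \<longrightarrow> acyc (V - (X \<union> Y) - (H \<union> S)) \<and> hb d (V - (X \<union> Y)) (H \<union> S))"

text \<open>\<open>F\<close> and \<open>O\<close> stay inside \<open>R\<close>; \<open>N\<close> and
  \<open>H\<close> may also contain the vertices outside \<open>R\<close>, to which
  \<open>settle\<close> has given their old role.\<close>

fun shape :: "cfg \<Rightarrow> bool" where
  "shape (Cfg F O' N H X) \<longleftrightarrow> F \<subseteq> R - X0 \<and> O' \<subseteq> R \<and> F \<union> O' \<union> N \<union> H \<subseteq> V - X \<and> X1 \<subseteq> X \<and> X \<subseteq> V \<and>
     F \<inter> (O' \<union> N \<union> H) = {} \<and> O' \<inter> (N \<union> H) = {} \<and> N \<inter> H = {}"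

text \<open>Every digit that the process consumes on the way to a solution decreases this measure.\<close>

fun mu :: "cfg \<Rightarrow> int" where
  "mu (Cfg F O' N H X) = int k - int (card X) + int ((d + 1) * ncomp ((O' \<union> N \<union> H) \<inter> R))
     - int (card (H \<inter> R)) + 2 * int (card O') - int (degsum O') + int ((d + 4) * card (F \<inter> Q))"

section \<open>Completions before and after a step of the elimination\<close>

lemma fin: "A \<subseteq> V \<Longrightarrow> finite A"
  using finite_subset[OF subset_trans[OF _ V] finite_lessThan] .

lemma shapeD:
  assumes "shape (Cfg F O' N H X)"
  shows "F \<subseteq> R - X0" "O' \<subseteq> R" "F \<union> O' \<union> N \<union> H \<subseteq> V - X" "X1 \<subseteq> X" "X \<subseteq> V"
    "F \<inter> (O' \<union> N \<union> H) = {}" "O' \<inter> (N \<union> H) = {}" "N \<inter> H = {}"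
  using assms by simp_all

lemma shape_notin:
  assumes "shape (Cfg F O' N H X)" "v \<in> F"
  shows "v \<notin> O'" "v \<notin> N" "v \<notin> H" "v \<notin> X"
  using shapeD(3,6)[OF assms(1)] assms(2) by blast+

lemma shape_finite:
  assumes "shape (Cfg F O' N H X)"
  shows "finite F" "finite O'" "finite N" "finite H" "finite X"
  using shapeD(3,5)[OF assms] by (auto intro!: fin)

lemma ext_discard:
  assumes "ext (Cfg F O' N H X) Y S" "v \<notin> O' \<union> N \<union> H"
  shows "ext (Cfg (F - {v}) O' N H X) (Y - {v}) (S - {v})"
proof -
  have ex: "Y \<subseteq> F" "S \<subseteq> F - Y" "card Y + card X \<le> k" "acyc (F \<union> O' - Y - S)"
    "hb d (F \<union> O' \<union> N \<union> H - Y) (H \<union> S)" using assms(1) by simp_all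
  have "acyc (F - {v} \<union> O' - (Y - {v}) - (S - {v}))"
    by (rule acyc_subset[OF ex(4)]) (use assms(2) in blast)
  moreover have "hb d (F - {v} \<union> O' \<union> N \<union> H - (Y - {v})) (H \<union> (S - {v}))"
    by (rule hb_mono[OF ex(5)]) (use assms(2) in blast)+
  moreover have "card (Y - {v}) + card X \<le> k" using card_Diff1_le[of Y v] ex(3) by linarith
  moreover have "Y - {v} \<subseteq> F - {v}" "S - {v} \<subseteq> F - {v} - (Y - {v})" using ex(1,2) by blast+
  ultimately show ?thesis unfolding ext.simps by blast
qed

text \<open>The completion itself tells the right digit: \<open>v\<close> is in \<open>Y\<close>, in
  \<open>S\<close> or in neither. In the last case \<open>N\<close> is as good as \<open>O\<close>,
  since moving a vertex to \<open>N\<close> only weakens the acyclicity condition.\<close>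

lemma ext_place:
  assumes "ext (Cfg F O' N H X) Y S" "shape (Cfg F O' N H X)" "v \<in> F"
  obtains r Y' S' where "r < 3" "ext (place r a v (Cfg F O' N H X)) Y' S'" "r = 0 \<longrightarrow> card X < k"
proof -
  note v = shape_notin[OF assms(2,3)] and X = shape_finite(5)[OF assms(2)]
  have ex: "Y \<subseteq> F" "S \<subseteq> F - Y" "card Y + card X \<le> k" "acyc (F \<union> O' - Y - S)"
    "hb d (F \<union> O' \<union> N \<union> H - Y) (H \<union> S)" using assms(1) by simp_all
  consider "v \<in> Y" | "v \<in> S" "v \<notin> Y" | "v \<notin> S" "v \<notin> Y" by blast
  then show thesis
  proof cases
    case 1
    have "finite Y" using ex(1) shape_finite(1)[OF assms(2)] by (rule finite_subset)
    then have "card Y = Suc (card (Y - {v}))" using 1 by (rule card.remove)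
    moreover have "card (insert v X) = Suc (card X)" using X v by simp
    ultimately have c: "card (Y - {v}) + card (insert v X) = card Y + card X" "card Y > 0"
      by linarith+
    have e: "F - {v} \<union> O' - (Y - {v}) - S = F \<union> O' - Y - S"
      "F - {v} \<union> O' \<union> N \<union> H - (Y - {v}) = F \<union> O' \<union> N \<union> H - Y" using 1 v by blast+
    have "Y - {v} \<subseteq> F - {v}" "S \<subseteq> F - {v} - (Y - {v})" using ex(1,2) 1 by blast+
    then have "ext (Cfg (F - {v}) O' N H (insert v X)) (Y - {v}) S"
      unfolding ext.simps e c(1) using ex(3-5) by (intro conjI)
    then have ext0: "ext (place 0 a v (Cfg F O' N H X)) (Y - {v}) S" by simp
    have "card X < k" using c(2) ex(3) by linarith
    then show thesis by (intro that[OF _ ext0]) simp_all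
  next
    case 2
    have e: "F - {v} \<union> O' - Y - (S - {v}) = F \<union> O' - Y - S"
      "F - {v} \<union> O' \<union> N \<union> insert v H - Y = F \<union> O' \<union> N \<union> H - Y"
      "insert v H \<union> (S - {v}) = H \<union> S" using 2 v assms(3) by blast+
    have "Y \<subseteq> F - {v}" "S - {v} \<subseteq> F - {v} - Y" using ex(1,2) 2 by blast+
    then have "ext (Cfg (F - {v}) O' N (insert v H) X) Y (S - {v})"
      unfolding ext.simps e using ex(3-5) by (intro conjI)
    then have ext1: "ext (place 1 a v (Cfg F O' N H X)) Y (S - {v})" by simp
    show thesis by (rule that[OF _ ext1]) simp_all
  next
    case 3
    have e: "F - {v} \<union> insert v O' - Y - S = F \<union> O' - Y - S"
      "F - {v} \<union> O' \<union> insert v N \<union> H - Y = F \<union> O' \<union> N \<union> H - Y"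
      "F - {v} \<union> insert v O' \<union> N \<union> H - Y = F \<union> O' \<union> N \<union> H - Y" using 3 assms(3) by blast+
    have YS: "Y \<subseteq> F - {v}" "S \<subseteq> F - {v} - Y" using ex(1,2) 3 by blast+
    have "acyc (F - {v} \<union> O' - Y - S)" by (rule acyc_subset[OF ex(4)]) blast
    with YS have "ext (Cfg (F - {v}) O' (insert v N) H X) Y S"
      unfolding ext.simps e using ex(3,5) by (intro conjI)
    moreover from YS have "ext (Cfg (F - {v}) (insert v O') N H X) Y S"
      unfolding ext.simps e using ex(3-5) by (intro conjI)
    ultimately have ext2: "ext (place 2 a v (Cfg F O' N H X)) Y S" by simp
    show thesis by (rule that[OF _ ext2]) simp_all
  qed
qed

text \<open>The exchange argument: a vertex \<open>v\<close> of degree at most two that is attached to a single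
  component of undeletable vertices can be replaced by its neighbour in \<open>F\<close>.\<close>

lemma ext_det:
  assumes "ext (Cfg F O' N H X) Y S" "shape (Cfg F O' N H X)" "v \<in> F"
    and "card (nb v F) \<le> 1" "card (nb v O') \<le> 1" "\<not> multi (O' \<union> N \<union> H) v"
  shows "\<exists>Y' S'. ext (place 2 (card (nb v O')) v (Cfg F O' N H X)) Y' S'"
proof -
  note v = shape_notin[OF assms(2,3)] and dis = shapeD(6)[OF assms(2)]
  have ex: "Y \<subseteq> F" "S \<subseteq> F - Y" "card Y + card X \<le> k" "acyc (F \<union> O' - Y - S)"
    "hb d (F \<union> O' \<union> N \<union> H - Y) (H \<union> S)" using assms(1) by simp_all
  let ?U = "O' \<union> N \<union> H" and ?a = "card (nb v O')" and ?Nb = "nb v F"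
  have Nb: "?Nb \<subseteq> F" "v \<notin> ?Nb" by (auto simp: nb_def E_irrefl)
  consider "v \<in> Y" | "v \<in> S" "v \<notin> Y" | "v \<notin> S" "v \<notin> Y" by blast
  then show ?thesis
  proof cases
    case 1
    \<comment> \<open>The leaf \<open>v\<close> has at most one neighbour in \<open>F\<close>, and
      deleting this one instead of \<open>v\<close> costs no more. Afterwards \<open>v\<close> is
      adjacent to at most one vertex of \<open>O\<close> and to one component of the kept
      vertices.\<close>
    let ?Y = "Y - {v} \<union> ?Nb" and ?S = "S - ?Nb"
    have "finite Y" using ex(1) shape_finite(1)[OF assms(2)] by (rule finite_subset)
    then have "card Y = Suc (card (Y - {v}))" using 1 by (rule card.remove)
    with card_Un_le[of "Y - {v}" ?Nb] have c: "card ?Y + card X \<le> k" using ex(3) assms(4) by linarith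
    have s: "?Y \<subseteq> F - {v}" "?S \<subseteq> F - {v} - ?Y" using ex(1,2) Nb 1 by blast+
    have "acyc (F - {v} \<union> O' - ?Y - ?S)"
      by (rule acyc_subset[OF ex(4)]) (use v 1 in blast)
    moreover have "acyc (F - {v} \<union> insert v O' - ?Y - ?S)"
    proof -
      have "acyc (insert v (F - {v} \<union> O' - ?Y - ?S))"
      proof (rule acyc_insert)
        have "nb v (F - {v} \<union> O' - ?Y - ?S) \<subseteq> nb v O'" by (auto simp: nb_def)
        then have "card (nb v (F - {v} \<union> O' - ?Y - ?S)) \<le> card (nb v O')" by (intro card_mono) auto
        with assms(5) show "card (nb v (F - {v} \<union> O' - ?Y - ?S)) \<le> 1" by simp
      qed fact
      then show ?thesis by (rule acyc_subset) auto
    qed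
    moreover have "hb d (insert v (F \<union> ?U - Y - ?Nb)) (H \<union> ?S)"
    proof (rule hb_attach)
      show "hb d (F \<union> ?U - Y - ?Nb) (H \<union> ?S)"
        by (rule hb_mono[OF ex(5)]) auto
      show "v \<notin> F \<union> ?U - Y - ?Nb" "v \<notin> H \<union> ?S" using 1 v ex by auto
      fix x y assume "x \<in> nb v (F \<union> ?U - Y - ?Nb)" "y \<in> nb v (F \<union> ?U - Y - ?Nb)"
      then have "x \<in> nb v ?U" "y \<in> nb v ?U" by (auto simp: nb_def)
      with assms(6) have "conn ?U x y" by (auto simp: multi_def)
      then show "conn (F \<union> ?U - Y - ?Nb) x y"
        by (rule conn_mono) (use dis ex(1) Nb(1) in blast)
    qed
    moreover have "insert v (F \<union> ?U - Y - ?Nb) = F - {v} \<union> insert v O' \<union> N \<union> H - ?Y"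
      "insert v (F \<union> ?U - Y - ?Nb) = F - {v} \<union> O' \<union> insert v N \<union> H - ?Y"
      using 1 Nb v dis by blast+
    ultimately have "ext (Cfg (F - {v}) O' (insert v N) H X) ?Y ?S"
      "ext (Cfg (F - {v}) (insert v O') N H X) ?Y ?S"
      unfolding ext.simps using c s by simp_all
    then have "ext (place 2 ?a v (Cfg F O' N H X)) ?Y ?S" by simp
    then show ?thesis by blast
  next
    case 2
    \<comment> \<open>A neighbour that is deleted anyway does not become a feedback vertex; then
      \<open>v\<close> merely loses its role.\<close>
    let ?T = "?Nb - Y"
    show ?thesis
    proof (cases "?a = 0")
      \<comment> \<open>Here \<open>v\<close> moves to \<open>N\<close>, outside the acyclicity
        condition, so it can stop being a feedback vertex without a substitute.\<close>
      case True
      have "acyc (F - {v} \<union> O' - Y - (S - {v}))" by (rule acyc_subset[OF ex(4)]) (use v in auto)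
      moreover have "F - {v} \<union> O' \<union> insert v N \<union> H - Y = F \<union> O' \<union> N \<union> H - Y" using 2 assms(3) by blast
      moreover have "hb d (F \<union> O' \<union> N \<union> H - Y) (H \<union> (S - {v}))" by (rule hb_mono[OF ex(5)]) auto
      moreover have "Y \<subseteq> F - {v}" "S - {v} \<subseteq> F - {v} - Y" using ex(1,2) 2 by blast+
      ultimately have "ext (place 2 ?a v (Cfg F O' N H X)) Y (S - {v})"
        using ex(3) True by simp
      then show ?thesis by blast
    next
      case False
      let ?S = "S - {v} \<union> ?T"
      have "card ?T \<le> card ?Nb" by (intro card_mono) auto
      then have T: "card ?T \<le> 1" using assms(4) by linarith
      have "acyc (insert v (F \<union> O' - Y - S - ?Nb))"
      proof (rule acyc_insert)
        show "acyc (F \<union> O' - Y - S - ?Nb)" by (rule acyc_subset[OF ex(4)]) auto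
        have "nb v (F \<union> O' - Y - S - ?Nb) \<subseteq> nb v O'" by (auto simp: nb_def)
        then have "card (nb v (F \<union> O' - Y - S - ?Nb)) \<le> card (nb v O')" by (intro card_mono) auto
        with assms(5) show "card (nb v (F \<union> O' - Y - S - ?Nb)) \<le> 1" by simp
      qed
      then have "acyc (F - {v} \<union> insert v O' - Y - ?S)"
        by (rule acyc_subset) (use dis Nb in auto)
      moreover have "hb d (F \<union> O' \<union> N \<union> H - Y) (H \<union> S - {v} \<union> ?T)"
        by (rule hb_swap[OF ex(5)]) (use 2 assms(3) T ex in \<open>auto simp: nb_def\<close>)
      moreover have "H \<union> S - {v} \<union> ?T = H \<union> ?S" using v by auto
      moreover have "F - {v} \<union> insert v O' \<union> N \<union> H - Y = F \<union> O' \<union> N \<union> H - Y" using 2 assms(3) by blast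
      moreover have "Y \<subseteq> F - {v}" "?S \<subseteq> F - {v} - Y" using ex(1,2) 2 Nb by blast+
      ultimately have "ext (place 2 ?a v (Cfg F O' N H X)) Y ?S"
        using ex(3) False by simp
      then show ?thesis by blast
    qed
  next
    case 3
    have e: "F - {v} \<union> insert v O' - Y - S = F \<union> O' - Y - S"
      "F - {v} \<union> O' \<union> insert v N \<union> H - Y = F \<union> O' \<union> N \<union> H - Y"
      "F - {v} \<union> insert v O' \<union> N \<union> H - Y = F \<union> O' \<union> N \<union> H - Y" using 3 assms(3) by blast+
    have YS: "Y \<subseteq> F - {v}" "S \<subseteq> F - {v} - Y" using ex(1,2) 3 by blast+
    have "acyc (F - {v} \<union> O' - Y - S)" by (rule acyc_subset[OF ex(4)]) blast
    with YS have "ext (Cfg (F - {v}) O' (insert v N) H X) Y S"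
      unfolding ext.simps e using ex(3,5) by (intro conjI)
    moreover from YS have "ext (Cfg (F - {v}) (insert v O') N H X) Y S"
      unfolding ext.simps e using ex(3-5) by (intro conjI)
    ultimately have "ext (place 2 ?a v (Cfg F O' N H X)) Y S" by simp
    then show ?thesis by blast
  qed
qed

lemma lift_discard:
  assumes "lift (Cfg F O' N H X)" "shape (Cfg F O' N H X)" "v \<in> F"
    and "card (nb v F) \<le> 1" "nb v (O' \<union> N \<union> H) = {}"
  shows "lift (Cfg (F - {v}) O' N H X)"
  unfolding lift.simps
proof (intro allI impI)
  fix Y S assume Y: "Y \<subseteq> F - {v}" and S: "S \<subseteq> F - {v} - Y"
    and ac: "acyc (F - {v} \<union> O' - Y - S)" and h: "hb d (F - {v} \<union> O' \<union> N \<union> H - Y) (H \<union> S)"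
  note v = shape_notin[OF assms(2,3)]
  have le: "card (nb v A) \<le> 1" if "A \<subseteq> F \<union> (O' \<union> N \<union> H)" for A
  proof -
    have "nb v A \<subseteq> nb v F" using that assms(5) by (auto simp: nb_def)
    then have "card (nb v A) \<le> card (nb v F)" by (intro card_mono) auto
    with assms(4) show ?thesis by simp
  qed
  have "acyc (insert v (F - {v} \<union> O' - Y - S))" by (intro acyc_insert ac le) auto
  then have 1: "acyc (F \<union> O' - Y - S)" by (rule acyc_subset) auto
  have "hb d (insert v (F - {v} \<union> O' \<union> N \<union> H - Y)) (H \<union> S)"
  proof (rule hb_attach[OF h])
    fix x y assume "x \<in> nb v (F - {v} \<union> O' \<union> N \<union> H - Y)" "y \<in> nb v (F - {v} \<union> O' \<union> N \<union> H - Y)"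
    moreover have "card (nb v (F - {v} \<union> O' \<union> N \<union> H - Y)) \<le> Suc 0"
      unfolding One_nat_def[symmetric] by (rule le) auto
    ultimately have "x = y" by (subst (asm) card_le_Suc0_iff_eq) auto
    then show "conn (F - {v} \<union> O' \<union> N \<union> H - Y) x y" by simp
  qed (use v S in auto)
  moreover have "insert v (F - {v} \<union> O' \<union> N \<union> H - Y) = F \<union> O' \<union> N \<union> H - Y" using assms(3) Y by auto
  ultimately have 2: "hb d (F \<union> O' \<union> N \<union> H - Y) (H \<union> S)" by simp
  have "Y \<subseteq> F" "S \<subseteq> F - Y" using Y S by auto
  with assms(1) 1 2 show "acyc (V - (X \<union> Y) - (H \<union> S)) \<and> hb d (V - (X \<union> Y)) (H \<union> S)" by simp
qed

text \<open>A completion of the new configuration is one of the old, with \<open>v\<close> returned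
  to the deleted, the feedback or the remaining vertices. Only \<open>N\<close> calls for an
  argument, since the new condition ignores cycles through \<open>v\<close>: by \<open>leaf\<close>,
  at most one neighbour of \<open>v\<close> is left.\<close>

lemma lift_place:
  assumes "lift (Cfg F O' N H X)" "shape (Cfg F O' N H X)" "v \<in> F" "r < 3"
    and leaf: "a = 0 \<Longrightarrow> card (nb v F) \<le> 1 \<and> nb v O' = {}"
  shows "lift (place r a v (Cfg F O' N H X))"
proof -
  note v = shape_notin[OF assms(2,3)]
  note L = assms(1)[unfolded lift.simps, rule_format]
  consider "r = 0" | "r = 1" | "r = 2" "a = 0" | "r = 2" "a \<noteq> 0" using assms(4) by linarith
  then show ?thesis
  proof cases
    case 1
    have "acyc (V - (insert v X \<union> Y) - (H \<union> S)) \<and> hb d (V - (insert v X \<union> Y)) (H \<union> S)"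
      if "Y \<subseteq> F - {v}" "S \<subseteq> F - {v} - Y" "acyc (F - {v} \<union> O' - Y - S)"
        "hb d (F - {v} \<union> O' \<union> N \<union> H - Y) (H \<union> S)" for Y S
    proof -
      have e: "F - {v} \<union> O' - Y - S = F \<union> O' - insert v Y - S" "insert v X \<union> Y = X \<union> insert v Y"
        "F - {v} \<union> O' \<union> N \<union> H - Y = F \<union> O' \<union> N \<union> H - insert v Y" using v by auto
      show ?thesis unfolding e by (rule L) (use that assms(3) in \<open>auto simp: e\<close>)
    qed
    then show ?thesis using 1 by simp
  next
    case 2
    have "acyc (V - (X \<union> Y) - (insert v H \<union> S)) \<and> hb d (V - (X \<union> Y)) (insert v H \<union> S)"
      if "Y \<subseteq> F - {v}" "S \<subseteq> F - {v} - Y" "acyc (F - {v} \<union> O' - Y - S)"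
        "hb d (F - {v} \<union> O' \<union> N \<union> insert v H - Y) (insert v H \<union> S)" for Y S
    proof -
      have "v \<notin> Y" using that by auto
      then have e: "F - {v} \<union> O' - Y - S = F \<union> O' - Y - insert v S" "insert v H \<union> S = H \<union> insert v S"
        "F - {v} \<union> O' \<union> N \<union> insert v H - Y = F \<union> O' \<union> N \<union> H - Y" using v assms(3) by auto
      have "acyc (F \<union> O' - Y - insert v S)" "hb d (F \<union> O' \<union> N \<union> H - Y) (H \<union> insert v S)"
        using that(3,4) unfolding e .
      then show ?thesis unfolding e(2) by (intro L) (use that assms(3) in auto)
    qed
    then show ?thesis using 2 by simp
  next
    case 3
    have "acyc (V - (X \<union> Y) - (H \<union> S)) \<and> hb d (V - (X \<union> Y)) (H \<union> S)"
      if "Y \<subseteq> F - {v}" "S \<subseteq> F - {v} - Y" "acyc (F - {v} \<union> O' - Y - S)"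
        "hb d (F - {v} \<union> O' \<union> insert v N \<union> H - Y) (H \<union> S)" for Y S
    proof -
      have "v \<notin> Y" using that by auto
      then have e: "F - {v} \<union> O' \<union> insert v N \<union> H - Y = F \<union> O' \<union> N \<union> H - Y" using assms(3) by auto
      have "acyc (insert v (F - {v} \<union> O' - Y - S))"
      proof (rule acyc_insert[OF that(3)])
        have "nb v (F - {v} \<union> O' - Y - S) \<subseteq> nb v F" using leaf[OF 3(2)] by (auto simp: nb_def)
        then have "card (nb v (F - {v} \<union> O' - Y - S)) \<le> card (nb v F)" by (intro card_mono) auto
        with leaf[OF 3(2)] show "card (nb v (F - {v} \<union> O' - Y - S)) \<le> 1" by simp
      qed
      then have "acyc (F \<union> O' - Y - S)" by (rule acyc_subset) auto
      then show ?thesis using that(4) unfolding e by (intro L) (use that in auto)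
    qed
    then show ?thesis using 3 by simp
  next
    case 4
    have "acyc (V - (X \<union> Y) - (H \<union> S)) \<and> hb d (V - (X \<union> Y)) (H \<union> S)"
      if "Y \<subseteq> F - {v}" "S \<subseteq> F - {v} - Y" "acyc (F - {v} \<union> insert v O' - Y - S)"
        "hb d (F - {v} \<union> insert v O' \<union> N \<union> H - Y) (H \<union> S)" for Y S
    proof -
      have "v \<notin> Y" "v \<notin> S" using that by auto
      then have e: "F - {v} \<union> insert v O' \<union> N \<union> H - Y = F \<union> O' \<union> N \<union> H - Y"
        "F - {v} \<union> insert v O' - Y - S = F \<union> O' - Y - S" using assms(3) by auto
      show ?thesis using that(3,4) unfolding e by (intro L) (use that in auto)
    qed
    then show ?thesis using 4 by simp
  qed
qed

section \<open>Effect of the steps on the invariant and on the measure\<close>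

lemma shape_place:
  assumes "shape (Cfg F O' N H X)" "v \<in> F"
  shows "shape (place r a v (Cfg F O' N H X))"
  using assms R by (auto simp: subset_iff disjoint_iff)

lemma shape_discard: "shape (Cfg F O' N H X) \<Longrightarrow> shape (Cfg (F - {v}) O' N H X)"
  by auto

text \<open>The measure counts components inside \<open>R\<close> only; by closedness of
  \<open>R\<close> no neighbour of an undecided vertex is missed.\<close>

lemma nb_R:
  assumes "shape (Cfg F O' N H X)" "v \<in> F"
  shows "nb v ((O' \<union> N \<union> H) \<inter> R) = nb v (O' \<union> N \<union> H)"
proof -
  have "v \<in> R" "O' \<union> N \<union> H \<subseteq> V - X1" using shapeD(1,3,4)[OF assms(1)] assms(2) by blast+
  then show ?thesis using R_closed[of v] unfolding nb_def by blast
qed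

lemma card_F_Q:
  assumes "shape (Cfg F O' N H X)" "v \<in> F"
  shows "card ((F - {v}) \<inter> Q) \<le> card (F \<inter> Q)" "v \<in> Q \<Longrightarrow> Suc (card ((F - {v}) \<inter> Q)) = card (F \<inter> Q)"
proof -
  have F: "finite (F \<inter> Q)" using shape_finite(1)[OF assms(1)] by simp
  then show "card ((F - {v}) \<inter> Q) \<le> card (F \<inter> Q)" by (rule card_mono) blast
  assume "v \<in> Q"
  then have "v \<in> F \<inter> Q" using assms(2) by blast
  moreover have "(F - {v}) \<inter> Q = F \<inter> Q - {v}" by blast
  ultimately show "Suc (card ((F - {v}) \<inter> Q)) = card (F \<inter> Q)"
    using card_Suc_Diff1[OF F, of v] by (simp only:)
qed

lemma mu_discard:
  assumes "shape (Cfg F O' N H X)" "v \<in> F"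
  shows "mu (Cfg (F - {v}) O' N H X) \<le> mu (Cfg F O' N H X)"
proof -
  have "(d + 4) * card ((F - {v}) \<inter> Q) \<le> (d + 4) * card (F \<inter> Q)"
    by (rule mult_le_mono2) (rule card_F_Q[OF assms])
  then show ?thesis unfolding mu.simps by linarith
qed

text \<open>The exact change. A vertex entering \<open>O\<close> changes
  \<open>2 * card O' - degsum O'\<close> by two minus twice its number of neighbours there. The
  terms with \<open>Q\<close> are left open because \<open>v\<close> may or may not belong to
  \<open>Q\<close>.\<close>

lemma mu_place:
  assumes "shape (Cfg F O' N H X)" "v \<in> F"
  shows "mu (place r a v (Cfg F O' N H X)) =
    (mu (Cfg F O' N H X) + (if r = 0 then - 1 else
      int ((d + 1) * ncomp (insert v ((O' \<union> N \<union> H) \<inter> R))) - int ((d + 1) * ncomp ((O' \<union> N \<union> H) \<inter> R))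
      + (if r = 1 then - 1 else if a = 0 then 0 else 2 - 2 * int (card (nb v O')))))
    + int ((d + 4) * card ((F - {v}) \<inter> Q)) - int ((d + 4) * card (F \<inter> Q))"
proof -
  note v = shape_notin[OF assms] and fin = shape_finite[OF assms(1)]
  have vR: "v \<in> R" using shapeD(1)[OF assms(1)] assms(2) by blast
  have e: "(O' \<union> N \<union> insert v H) \<inter> R = insert v ((O' \<union> N \<union> H) \<inter> R)"
    "(O' \<union> insert v N \<union> H) \<inter> R = insert v ((O' \<union> N \<union> H) \<inter> R)"
    "(insert v O' \<union> N \<union> H) \<inter> R = insert v ((O' \<union> N \<union> H) \<inter> R)" using vR by blast+
  have "insert v H \<inter> R = insert v (H \<inter> R)" using vR by blast
  then have h: "card (insert v H \<inter> R) = Suc (card (H \<inter> R))" using v fin by simp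
  have x: "card (insert v X) = Suc (card X)" and o: "card (insert v O') = Suc (card O')"
    using v fin by simp_all
  have g: "degsum (insert v O') = degsum O' + 2 * card (nb v O')" using v fin by (intro degsum_insert) simp_all
  show ?thesis
    by (cases "r = 0"; cases "r = 1"; cases "a = 0")
      (simp_all only: place.simps mu.simps e h x o g if_True if_False refl, simp_all)
qed

text \<open>Sign analysis for \<open>mu_place\<close>: \<open>p\<close> and \<open>q\<close> are the
  weighted component counts after and before placing the vertex, and \<open>a\<close> is its number
  of neighbours in \<open>O\<close>.\<close>

lemma
  fixes p q r a :: nat
  defines "\<Delta> \<equiv> if r = 0 then - 1 else int p - int q + (if r = 1 then - 1 else if a = 0 then 0 else 2 - 2 * int a)"
  shows delta_le: "p \<le> q \<Longrightarrow> \<Delta> \<le> 0"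
    and delta_less_degree: "p \<le> q \<Longrightarrow> r < 2 \<or> 2 \<le> a \<Longrightarrow> \<Delta> < 0"
    and delta_less_merge: "p < q \<Longrightarrow> \<Delta> < 0"
  unfolding \<Delta>_def by auto

text \<open>A vertex with a kept neighbour founds no new component, and it enters either
  \<open>N\<close> or, next to an existing tree, \<open>O\<close>; so no term rises.\<close>

lemma mu_det:
  assumes "shape (Cfg F O' N H X)" "v \<in> F" "nb v (O' \<union> N \<union> H) \<noteq> {}"
  shows "mu (place 2 (card (nb v O')) v (Cfg F O' N H X)) \<le> mu (Cfg F O' N H X)"
proof -
  note v = shape_notin[OF assms(1,2)] and fin = shape_finite[OF assms(1)]
  let ?U = "(O' \<union> N \<union> H) \<inter> R"
  have "ncomp (insert v ?U) \<le> ncomp ?U"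
    using v fin assms(3) nb_R[OF assms(1,2)] by (intro ncomp_insert_nb) auto
  then have "(d + 1) * ncomp (insert v ?U) \<le> (d + 1) * ncomp ?U" by (rule mult_le_mono2)
  moreover have "(d + 4) * card ((F - {v}) \<inter> Q) \<le> (d + 4) * card (F \<inter> Q)"
    by (rule mult_le_mono2) (rule card_F_Q[OF assms(1,2)])
  ultimately show ?thesis unfolding mu_place[OF assms(1,2)]
    using delta_le[of "(d + 1) * ncomp (insert v ?U)" "(d + 1) * ncomp ?U" 2 "card (nb v O')"] by linarith
qed

text \<open>Deletion spends budget, a new feedback vertex counts in \<open>H\<close>, a kept vertex
  with two neighbours in \<open>O\<close> adds two edges, and otherwise \<open>v\<close> merges two
  components. The last case explains the weight \<open>d + 1\<close>: with weight \<open>d\<close> a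
  merger would not count for \<open>d = 0\<close>.\<close>

lemma mu_guess:
  assumes "shape (Cfg F O' N H X)" "v \<in> F" "r < 3"
    and br: "card (nb v O') \<ge> 2 \<or> multi (O' \<union> N \<union> H) v"
  shows "mu (place r (card (nb v O')) v (Cfg F O' N H X)) < mu (Cfg F O' N H X)"
proof -
  note v = shape_notin[OF assms(1,2)] and fin = shape_finite[OF assms(1)]
  let ?U = "(O' \<union> N \<union> H) \<inter> R"
  have vU: "finite ?U" "v \<notin> ?U" using v fin by auto
  have q: "(d + 4) * card ((F - {v}) \<inter> Q) \<le> (d + 4) * card (F \<inter> Q)"
    by (rule mult_le_mono2) (rule card_F_Q[OF assms(1,2)])
  have "nb v (O' \<union> N \<union> H) \<noteq> {}"
  proof (cases "multi (O' \<union> N \<union> H) v")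
    case True
    then show ?thesis by (auto simp: multi_def)
  next
    case False
    with br have "nb v O' \<noteq> {}" by auto
    then show ?thesis by (auto simp: nb_def)
  qed
  then have "ncomp (insert v ?U) \<le> ncomp ?U"
    unfolding nb_R[OF assms(1,2), symmetric] by (rule ncomp_insert_nb[OF vU])
  then have c: "(d + 1) * ncomp (insert v ?U) \<le> (d + 1) * ncomp ?U" by (rule mult_le_mono2)
  show ?thesis
  proof (cases "r = 2 \<and> card (nb v O') < 2")
    case False
    then have "r < 2 \<or> 2 \<le> card (nb v O')" using assms(3) by linarith
    from delta_less_degree[OF c this] show ?thesis using q unfolding mu_place[OF assms(1,2)] by linarith
  next
    case True
    then have "multi (O' \<union> N \<union> H) v" using br by auto
    then obtain x y where xy: "x \<in> nb v (O' \<union> N \<union> H)" "y \<in> nb v (O' \<union> N \<union> H)" "\<not> conn (O' \<union> N \<union> H) x y"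
      by (auto simp: multi_def)
    have "\<not> conn ?U x y" using xy(3) conn_mono[of ?U x y "O' \<union> N \<union> H"] by blast
    then have "Suc (ncomp (insert v ?U)) \<le> ncomp ?U"
      using xy(1,2) unfolding nb_R[OF assms(1,2), symmetric] by (intro ncomp_insert_merge[OF vU])
    then have "(d + 1) * Suc (ncomp (insert v ?U)) \<le> (d + 1) * ncomp ?U" by (rule mult_le_mono2)
    then have c': "(d + 1) * ncomp (insert v ?U) < (d + 1) * ncomp ?U" by simp
    from delta_less_merge[OF c', of r "card (nb v O')"] show ?thesis
      using q unfolding mu_place[OF assms(1,2)] by linarith
  qed
qed

text \<open>Here \<open>v\<close> may have no kept neighbour at all: a new component costs
  \<open>d + 1\<close> and a new tree of \<open>O\<close> costs two. Leaving \<open>Q\<close> pays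
  \<open>d + 4\<close>, one more than the sum.\<close>

lemma mu_stuck:
  assumes "shape (Cfg F O' N H X)" "v \<in> F" "v \<in> Q" "r < 3"
  shows "mu (place r 1 v (Cfg F O' N H X)) < mu (Cfg F O' N H X)"
proof -
  note v = shape_notin[OF assms(1,2)] and fin = shape_finite[OF assms(1)]
  let ?U = "(O' \<union> N \<union> H) \<inter> R"
  have "ncomp (insert v ?U) \<le> Suc (ncomp ?U)" using v fin by (intro ncomp_insert) auto
  then have "(d + 1) * ncomp (insert v ?U) \<le> (d + 1) * Suc (ncomp ?U)" by (rule mult_le_mono2)
  then have c: "(d + 1) * ncomp (insert v ?U) \<le> (d + 1) * ncomp ?U + (d + 1)" by simp
  have q: "(d + 4) * card (F \<inter> Q) = (d + 4) * card ((F - {v}) \<inter> Q) + (d + 4)"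
    unfolding card_F_Q(2)[OF assms(1-3), symmetric] by simp
  have "(if r = 0 then - 1 else int ((d + 1) * ncomp (insert v ?U)) - int ((d + 1) * ncomp ?U)
      + (if r = 1 then - 1 else if (1::nat) = 0 then 0 else 2 - 2 * int (card (nb v O')))) < int d + 4"
    using c by (auto simp del: of_nat_mult mult_Suc)
  then show ?thesis unfolding mu_place[OF assms(1,2)] q by linarith
qed

text \<open>The terms pair up: at most \<open>k\<close> deletions, at most \<open>d\<close> feedback
  vertices in each component of kept vertices, and at most as many edges as vertices in the forest
  \<open>O\<close>.\<close>

lemma mu_nonneg:
  assumes "shape (Cfg F O' N H X)" "ext (Cfg F O' N H X) Y S"
  shows "mu (Cfg F O' N H X) \<ge> 0"
proof -
  have ex: "Y \<subseteq> F" "S \<subseteq> F - Y" "card Y + card X \<le> k" "acyc (F \<union> O' - Y - S)"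
    "hb d (F \<union> O' \<union> N \<union> H - Y) (H \<union> S)" using assms(2) by simp_all
  note fin = shape_finite[OF assms(1)] and dis = shapeD(6)[OF assms(1)]
  let ?U = "(O' \<union> N \<union> H) \<inter> R"
  have U: "finite ?U" "?U \<subseteq> F \<union> O' \<union> N \<union> H - Y" using fin dis ex(1) by auto
  have "card (H \<inter> R) \<le> card ((H \<union> S) \<inter> ?U)" using U by (intro card_mono) auto
  also have "\<dots> \<le> d * ncomp ?U" by (rule hubs_le_ncomp[OF ex(5) U(2,1)])
  also have "\<dots> \<le> (d + 1) * ncomp ?U" by simp
  finally have h: "card (H \<inter> R) \<le> (d + 1) * ncomp ?U" .
  have "acyc O'" by (rule acyc_subset[OF ex(4)]) (use dis ex in blast)
  then have "degsum O' \<le> 2 * card O'" by (rule degsum_le[OF fin(2)])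
  with h ex(3) show ?thesis unfolding mu.simps by linarith
qed

text \<open>A step either ignores the guess or removes its last digit \<open>r\<close>, and in the
  latter case the same \<open>r\<close> is right for every continuation \<open>c\<close>. A
  successful number can therefore be assembled backwards, starting from the guesses made
  last.\<close>

lemma step_cases:
  assumes sh: "shape (Cfg F O' N H X)" and li: "lift (Cfg F O' N H X)"
    and ex: "ext (Cfg F O' N H X) Y S" and ne: "F \<noteq> {}"
  obtains st' where "\<And>c. step oH (Cfg F O' N H X, c) = (st', c)" "shape st'" "lift st'"
      "\<exists>Y S. ext st' Y S" "mu st' \<le> mu (Cfg F O' N H X)" "card (cF st') < card F"
  | r st' where "\<And>c. step oH (Cfg F O' N H X, 3 * c + r) = (st', c)" "shape st'" "lift st'"
      "\<exists>Y S. ext st' Y S" "mu st' < mu (Cfg F O' N H X)" "card (cF st') < card F" "r < 3"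
proof -
  note fin = shape_finite[OF sh]
  have F_place: "card (cF (place r a v (Cfg F O' N H X))) < card F" if "v \<in> F" for r a v
    using card_Diff1_less[OF fin(1) that] by simp
  let ?U = "O' \<union> N \<union> H"
  show thesis
  proof (cases "leaves F = {}")
    case False
    define v where "v = Max (leaves F)"
    have "finite (leaves F)" using fin(1) by (simp add: leaves_def)
    then have "v \<in> leaves F" unfolding v_def using False by (rule Max_in)
    then have v: "v \<in> F" "card (nb v F) \<le> 1" by (auto simp: leaves_def)
    note nv = shape_notin[OF sh v(1)]
    let ?a = "card (nb v O')"
    consider "nb v ?U = {}" | "nb v ?U \<noteq> {}" "?a \<le> 1" "\<not> multi ?U v"
      | "nb v ?U \<noteq> {}" "?a \<ge> 2 \<or> multi ?U v" by linarith
    then show thesis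
    proof cases
      case 1
      show thesis
      proof (rule that(1))
        show "step oH (Cfg F O' N H X, c) = (Cfg (F - {v}) O' N H X, c)" for c
          using False 1 by (simp add: v_def Let_def)
        show "shape (Cfg (F - {v}) O' N H X)" by (rule shape_discard[OF sh])
        show "lift (Cfg (F - {v}) O' N H X)" by (rule lift_discard[OF li sh v 1])
        show "\<exists>Y S. ext (Cfg (F - {v}) O' N H X) Y S"
          using ext_discard[OF ex, of v] nv by blast
        show "mu (Cfg (F - {v}) O' N H X) \<le> mu (Cfg F O' N H X)" by (rule mu_discard[OF sh v(1)])
        show "card (cF (Cfg (F - {v}) O' N H X)) < card F" using card_Diff1_less[OF fin(1) v(1)] by simp
      qed
    next
      case 2
      let ?st = "place 2 ?a v (Cfg F O' N H X)"
      show thesis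
      proof (rule that(1))
        show "step oH (Cfg F O' N H X, c) = (?st, c)" for c
          using False 2 by (simp add: v_def Let_def del: place.simps)
        show "shape ?st" by (rule shape_place[OF sh v(1)])
        show "lift ?st" by (rule lift_place[OF li sh v(1)]) (use v in simp_all)
        show "\<exists>Y S. ext ?st Y S" by (rule ext_det[OF ex sh v 2(2,3)])
        show "mu ?st \<le> mu (Cfg F O' N H X)" by (rule mu_det[OF sh v(1) 2(1)])
        show "card (cF ?st) < card F" by (rule F_place[OF v(1)])
      qed
    next
      case 3
      obtain r Y' S' where r: "r < 3" "ext (place r ?a v (Cfg F O' N H X)) Y' S'"
        by (rule ext_place[OF ex sh v(1)])
      let ?st = "place r ?a v (Cfg F O' N H X)"
      show thesis
      proof (rule that(2))
        show "step oH (Cfg F O' N H X, 3 * c + r) = (?st, c)" for c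
        proof -
          have "(3 * c + r) mod 3 = r" "(3 * c + r) div 3 = c" "\<not> (?a \<le> 1 \<and> \<not> multi ?U v)"
            using r(1) 3(2) by auto
          then show ?thesis using False 3(1) by (simp only: step.simps Let_def v_def[symmetric]) simp
        qed
        show "shape ?st" by (rule shape_place[OF sh v(1)])
        show "lift ?st" by (rule lift_place[OF li sh v(1) r(1)]) (use v in simp_all)
        show "\<exists>Y S. ext ?st Y S" using r(2) by blast
        show "mu ?st < mu (Cfg F O' N H X)" by (rule mu_guess[OF sh v(1) r(1) 3(2)])
        show "card (cF ?st) < card F" by (rule F_place[OF v(1)])
      qed fact
    qed
  next
    case True
    define v where "v = Max (F \<inter> oH)"
    have st: "F \<inter> oH \<noteq> {}" "F \<inter> oH \<subseteq> Q" using stuck[OF shapeD(1)[OF sh] True ne] by blast+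
    then have "v \<in> F \<inter> oH" unfolding v_def using fin(1) by (intro Max_in) simp_all
    with st have v: "v \<in> F" "v \<in> Q" by blast+
    obtain r Y' S' where r: "r < 3" "ext (place r 1 v (Cfg F O' N H X)) Y' S'"
      by (rule ext_place[OF ex sh v(1)])
    let ?st = "place r 1 v (Cfg F O' N H X)"
    show thesis
    proof (rule that(2))
      show "step oH (Cfg F O' N H X, 3 * c + r) = (?st, c)" for c
      proof -
        have "(3 * c + r) mod 3 = r" "(3 * c + r) div 3 = c" using r(1) by auto
        then show ?thesis using True st(1) by (simp only: step.simps v_def[symmetric]) simp
      qed
      show "shape ?st" by (rule shape_place[OF sh v(1)])
      show "lift ?st" by (rule lift_place[OF li sh v(1) r(1)]) simp
      show "\<exists>Y S. ext ?st Y S" using r(2) by blast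
      show "mu ?st < mu (Cfg F O' N H X)" by (rule mu_stuck[OF sh v r(1)])
      show "card (cF ?st) < card F" by (rule F_place[OF v(1)])
    qed fact
  qed
qed

lemma step_done: "cF st = {} \<Longrightarrow> step oH (st, c) = (st, c)"
  by (cases st) (simp add: leaves_def)

text \<open>\<open>l\<close> bounds the digits still to be read and \<open>j\<close> the vertices
  still undecided. Steps with empty \<open>F\<close> are idle, which permits a fixed number of
  steps.\<close>

lemma steps_reach_solution:
  assumes "shape st" "lift st" "ext st Y S" "mu st \<le> int l" "card (cF st) \<le> j"
  shows "\<exists>c < 3 ^ l. \<exists>st' c'. (step oH ^^ j) (st, c) = (st', c') \<and> cF st' = {} \<and> sol k d V (cX st') (cH st')"
  using assms
proof (induction j arbitrary: st Y S l)
  case 0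
  obtain F O' N H X where st: "st = Cfg F O' N H X" by (cases st)
  have F: "F = {}" using 0(5) shape_finite(1)[OF 0(1)[unfolded st]] by (simp add: st)
  have ex: "Y = {}" "S = {}" "card X \<le> k" "acyc O'" "hb d (O' \<union> N \<union> H) H"
    using 0(3) unfolding st F by auto
  have "acyc (V - X - H) \<and> hb d (V - X) H"
    using 0(2)[unfolded st F lift.simps, rule_format, of "{}" "{}"] ex(4,5) by simp
  moreover have "X \<subseteq> V" "H \<subseteq> V - X" using shapeD(3,5)[OF 0(1)[unfolded st]] by blast+
  ultimately have "sol k d V X H" using ex(3) by (simp add: sol_def)
  then show ?case by (intro exI[of _ 0]) (simp add: st F)
next
  case (Suc j)
  obtain F O' N H X where st: "st = Cfg F O' N H X" by (cases st)
  show ?case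
  proof (cases "F = {}")
    case True
    then have "card (cF st) \<le> j" by (simp add: st)
    from Suc.IH[OF Suc.prems(1-4) this] show ?thesis
      using step_done[of st] True by (simp add: funpow_Suc_right st del: funpow.simps step.simps)
  next
    case False
    show ?thesis
    proof (rule step_cases[OF Suc.prems(1-3)[unfolded st] False])
      fix st' assume s: "\<And>c. step oH (Cfg F O' N H X, c) = (st', c)" "shape st'" "lift st'"
        "\<exists>Y S. ext st' Y S" "mu st' \<le> mu (Cfg F O' N H X)" "card (cF st') < card F"
      obtain Y' S' where e: "ext st' Y' S'" using s(4) by blast
      have "mu st' \<le> int l" "card (cF st') \<le> j" using s(5,6) Suc.prems(4,5) by (simp_all add: st)
      from Suc.IH[OF s(2,3) e this] show ?thesis
        by (simp add: funpow_Suc_right st s(1) del: funpow.simps step.simps)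
    next
      fix r st' assume s: "\<And>c. step oH (Cfg F O' N H X, 3 * c + r) = (st', c)" "shape st'" "lift st'"
        "\<exists>Y S. ext st' Y S" "mu st' < mu (Cfg F O' N H X)" "card (cF st') < card F" "r < 3"
      obtain Y' S' where e: "ext st' Y' S'" using s(4) by blast
      \<comment> \<open>The measure is nonnegative while a completion exists, so a strict drop shows
        that the digit budget \<open>l\<close> was positive.\<close>
      have "mu st' \<ge> 0" using s(2) e by (cases st') (simp only: mu_nonneg)
      then obtain l' where l: "l = Suc l'" using s(5) Suc.prems(4) by (cases l) (auto simp: st)
      have "mu st' \<le> int l'" "card (cF st') \<le> j" using s(5,6) Suc.prems(4,5) by (simp_all add: st l)
      from Suc.IH[OF s(2,3) e this] obtain c st2 c' where c: "c < 3 ^ l'"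
        "(step oH ^^ j) (st', c) = (st2, c')" "cF st2 = {}" "sol k d V (cX st2) (cH st2)" by blast
      have "(step oH ^^ Suc j) (st, 3 * c + r) = (st2, c')"
        using c(2) by (simp add: funpow_Suc_right st s(1) del: funpow.simps step.simps)
      moreover have "3 * c + r < 3 ^ l" using c(1) s(7) by (simp add: l)
      ultimately show ?thesis using c(3,4) by blast
    qed
  qed
qed

end

section \<open>Iterative compression\<close>

context sgraph
begin

lemma acyc_Un:
  assumes "acyc A" "acyc B" and sep: "\<And>u v. u \<in> A \<Longrightarrow> v \<in> B \<Longrightarrow> \<not> E u v"
  shows "acyc (A \<union> B)"
  unfolding acyc_def
proof (intro allI impI)
  fix T assume T: "T \<subseteq> A \<union> B" "T \<noteq> {}"
  show "\<exists>v \<in> T. card (nb v T) \<le> 1"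
  proof (cases "T \<inter> A = {}")
    case True
    with T have "T \<subseteq> B" by blast
    with assms(2) T(2) show ?thesis unfolding acyc_def by blast
  next
    case False
    then obtain v where v: "v \<in> T \<inter> A" "card (nb v (T \<inter> A)) \<le> 1"
      using assms(1)[unfolded acyc_def, rule_format, of "T \<inter> A"] by auto
    have "nb v T = nb v (T \<inter> A)" using v(1) T(1) sep unfolding nb_def by blast
    with v(2) have "card (nb v T) \<le> 1" by simp
    with v(1) show ?thesis by blast
  qed
qed

lemma hb_Un:
  assumes "hb d A H" "hb d B H" and sep: "\<And>u v. u \<in> A \<Longrightarrow> v \<in> B \<Longrightarrow> \<not> E u v"
  shows "hb d (A \<union> B) H"
proof -
  have *: "card {h \<in> H. h \<in> A \<union> B \<and> conn (A \<union> B) x h} \<le> d"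
    if "hb d C H" "x \<in> C" "\<And>a b. a \<in> C \<Longrightarrow> b \<in> A \<union> B \<Longrightarrow> E a b \<Longrightarrow> b \<in> C" "(A \<union> B) \<inter> C \<subseteq> C" for x C
  proof -
    have "{h \<in> H. h \<in> A \<union> B \<and> conn (A \<union> B) x h} \<subseteq> {h \<in> H. h \<in> C \<and> conn C x h}"
    proof (intro subsetI, elim CollectE conjE)
      fix h assume h: "h \<in> H" "conn (A \<union> B) x h"
      have "h \<in> C \<and> conn ((A \<union> B) \<inter> C) x h"
        by (rule conn_closed[OF h(2) that(2)]) (rule that(3))
      with h(1) conn_mono[OF _ that(4), of x h] show "h \<in> {h \<in> H. h \<in> C \<and> conn C x h}" by simp
    qed
    then have "card {h \<in> H. h \<in> A \<union> B \<and> conn (A \<union> B) x h} \<le> card {h \<in> H. h \<in> C \<and> conn C x h}"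
      by (rule card_mono[OF finite_hubs])
    also have "\<dots> \<le> d" using that(1,2) unfolding hb_def by (rule bspec)
    finally show ?thesis .
  qed
  show ?thesis
    unfolding hb_def
  proof
    fix x assume "x \<in> A \<union> B"
    then show "card {h \<in> H. h \<in> A \<union> B \<and> conn (A \<union> B) x h} \<le> d"
    proof
      assume "x \<in> A"
      then show ?thesis by (rule *[OF assms(1)]) (use sep in blast)+
    next
      assume "x \<in> B"
      then show ?thesis by (rule *[OF assms(2)]) (use sep E_sym in blast)+
    qed
  qed
qed

lemma hb_Int: "hb d A (H \<inter> A) \<longleftrightarrow> hb d A H"
proof -
  have "{h \<in> H \<inter> A. h \<in> A \<and> conn A x h} = {h \<in> H. h \<in> A \<and> conn A x h}" for x by blast
  then show ?thesis by (simp add: hb_def)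
qed

text \<open>The vertices outside \<open>X0\<close> that no remaining vertex of \<open>X0\<close> reaches keep their old role.\<close>

fun settle :: "nat set \<Rightarrow> nat set \<Rightarrow> cfg \<Rightarrow> cfg" where
  "settle X0 oH (Cfg F O' N H X) = (let A = F \<union> O' \<union> H; R = {v. \<exists>w \<in> X0. w \<in> A \<and> conn A w v} in
     Cfg (F \<inter> R) O' (N \<union> (F - R - oH)) (H \<union> ((F - R) \<inter> oH)) X)"

fun ini :: "nat set \<Rightarrow> nat \<Rightarrow> nat \<Rightarrow> cfg \<times> nat" where
  "ini X0 0 c = (Cfg {} {} {} {} {}, c)"
| "ini X0 (Suc v) c = (case ini X0 v c of (Cfg F O' N H X, c') \<Rightarrow>
     if v \<in> X0 then (place (c' mod 3) 1 v (Cfg F O' N H X), c' div 3)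
     else (Cfg (insert v F) O' N H X, c'))"

text \<open>On the way to a solution every step shrinks a nonempty \<open>F\<close>, so
  \<open>n\<close> steps suffice.\<close>

definition attempt :: "nat set \<Rightarrow> nat set \<Rightarrow> nat \<Rightarrow> nat \<Rightarrow> cfg" where
  "attempt X0 oH m c = (case ini X0 m c of (st, c') \<Rightarrow> fst ((step oH ^^ n) (settle X0 oH st, c')))"

text \<open>\<open>e\<close> is the rest of the guess, left to the elimination. Each vertex of
  \<open>X0\<close> prepends one digit to it, so every distribution of roles, described by
  \<open>X1\<close> and \<open>H1\<close>, is realised by a small number.\<close>

lemma ini_guess:
  "\<exists>c < 3 ^ card (X0 \<inter> {..<m}) * (e + 1). ini X0 m c =
    (Cfg ({..<m} - X0) ((X0 - X1 - H1) \<inter> {..<m}) {} (X0 \<inter> (H1 - X1) \<inter> {..<m}) (X0 \<inter> X1 \<inter> {..<m}), e)"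
proof (induction m arbitrary: e)
  case 0
  show ?case by (intro exI[of _ e]) simp
next
  case (Suc v)
  have lt: "{..<Suc v} = insert v {..<v}" by (simp add: lessThan_Suc)
  show ?case
  proof (cases "v \<in> X0")
    case False
    have eq: "X0 \<inter> {..<Suc v} = X0 \<inter> {..<v}" using False by (auto simp: lt)
    from Suc.IH[of e] obtain c where c: "c < 3 ^ card (X0 \<inter> {..<v}) * (e + 1)" "ini X0 v c =
      (Cfg ({..<v} - X0) ((X0 - X1 - H1) \<inter> {..<v}) {} (X0 \<inter> (H1 - X1) \<inter> {..<v}) (X0 \<inter> X1 \<inter> {..<v}), e)"
      by blast
    have "ini X0 (Suc v) c = (Cfg ({..<Suc v} - X0) ((X0 - X1 - H1) \<inter> {..<Suc v}) {}
        (X0 \<inter> (H1 - X1) \<inter> {..<Suc v}) (X0 \<inter> X1 \<inter> {..<Suc v}), e)"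
      using c(2) False by (auto simp: lt)
    with c(1) show ?thesis unfolding eq by blast
  next
    case True
    define r :: nat where "r = (if v \<in> X1 then 0 else if v \<in> H1 then 1 else 2)"
    have r: "r < 3" by (simp add: r_def)
    have "X0 \<inter> {..<Suc v} = insert v (X0 \<inter> {..<v})" using True by (auto simp: lt)
    then have cd: "card (X0 \<inter> {..<Suc v}) = Suc (card (X0 \<inter> {..<v}))" by simp
    \<comment> \<open>The smaller vertices read their digits first, so the number that they leave
      over must end with the digit for \<open>v\<close>.\<close>
    from Suc.IH[of "3 * e + r"] obtain c where c: "c < 3 ^ card (X0 \<inter> {..<v}) * (3 * e + r + 1)" "ini X0 v c =
      (Cfg ({..<v} - X0) ((X0 - X1 - H1) \<inter> {..<v}) {} (X0 \<inter> (H1 - X1) \<inter> {..<v}) (X0 \<inter> X1 \<inter> {..<v}), 3 * e + r)"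
      by blast
    have m: "(3 * e + r) mod 3 = r" "(3 * e + r) div 3 = e" using r by auto
    have "ini X0 (Suc v) c = (place r 1 v (Cfg ({..<v} - X0) ((X0 - X1 - H1) \<inter> {..<v}) {}
        (X0 \<inter> (H1 - X1) \<inter> {..<v}) (X0 \<inter> X1 \<inter> {..<v})), e)"
      using True by (simp only: ini.simps c(2) prod.case cfg.case m if_True)
    also have "\<dots> = (Cfg ({..<Suc v} - X0) ((X0 - X1 - H1) \<inter> {..<Suc v}) {}
        (X0 \<inter> (H1 - X1) \<inter> {..<Suc v}) (X0 \<inter> X1 \<inter> {..<Suc v}), e)"
      using True by (auto simp: lt r_def)
    finally have i: "ini X0 (Suc v) c = (Cfg ({..<Suc v} - X0) ((X0 - X1 - H1) \<inter> {..<Suc v}) {}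
        (X0 \<inter> (H1 - X1) \<inter> {..<Suc v}) (X0 \<inter> X1 \<inter> {..<Suc v}), e)" .
    have "3 * e + r + 1 \<le> 3 * (e + 1)" using r by simp
    then have "3 ^ card (X0 \<inter> {..<v}) * (3 * e + r + 1) \<le> 3 ^ card (X0 \<inter> {..<v}) * (3 * (e + 1))"
      by (rule mult_le_mono2)
    also have "\<dots> = 3 ^ card (X0 \<inter> {..<Suc v}) * (e + 1)" by (simp only: cd power_Suc mult_ac)
    finally have "c < 3 ^ card (X0 \<inter> {..<Suc v}) * (e + 1)" using c(1) by linarith
    with i show ?thesis by blast
  qed
qed

end

text \<open>\<open>X0\<close> is the old deletion set together with the new vertex, hence
  \<open>k + 1\<close>, and \<open>V - X0\<close> is what the old solution leaves of the previous
  graph. \<open>Xs\<close> and \<open>Hs\<close> form an unknown solution that guides the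
  analysis.\<close>

locale compression = sgraph +
  fixes V X0 oH Xs Hs :: "nat set" and k d :: nat
  assumes V: "V \<subseteq> {..<n}" and X0: "X0 \<subseteq> V" "card X0 \<le> k + 1" and oH: "oH \<subseteq> V - X0"
    and old: "acyc (V - X0 - oH)" "hb d (V - X0) oH" and sol: "sol k d V Xs Hs"
begin

definition "X1 = X0 \<inter> Xs"
definition "W = X0 - Xs"
definition "R = {v. \<exists>w \<in> W. conn (V - X1) w v}"
text \<open>Only these vertices of \<open>oH\<close> can occur in a leafless remainder
  (\<open>R_stuck\<close>), and unlike \<open>oH\<close> they are bounded in number by
  \<open>k\<close> and \<open>d\<close> (\<open>card_Q\<close>).\<close>

definition "Q = {h \<in> oH \<inter> R. \<not> acyc (cpt (V - X0) h)}"

lemma solD: "Xs \<subseteq> V" "Hs \<subseteq> V - Xs" "card Xs \<le> k" "acyc (V - Xs - Hs)" "hb d (V - Xs) Hs"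
  using sol unfolding sol_def by blast+

lemma fin: "A \<subseteq> V \<Longrightarrow> finite A"
  using finite_subset[OF subset_trans[OF _ V] finite_lessThan] .

lemma W_sub: "W \<subseteq> R" "W \<subseteq> V - X1" "W \<subseteq> V - Xs" "X0 = W \<union> X1" "W \<inter> X1 = {}"
proof -
  show "W \<subseteq> R" unfolding R_def using conn_refl by blast
qed (use X0(1) in \<open>auto simp: W_def X1_def\<close>)

lemma R_sub: "R \<subseteq> V - X1"
proof
  fix v assume "v \<in> R"
  then obtain w where "w \<in> W" "conn (V - X1) w v" by (auto simp: R_def)
  with conn_in[of "V - X1" w v] W_sub(2) show "v \<in> V - X1" by blast
qed

lemma R_closed: "v \<in> R \<Longrightarrow> u \<in> V - X1 \<Longrightarrow> E v u \<Longrightarrow> u \<in> R"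
proof -
  assume v: "v \<in> R" and u: "u \<in> V - X1" and e: "E v u"
  obtain w where w: "w \<in> W" "conn (V - X1) w v" using v by (auto simp: R_def)
  have "conn (V - X1) v u" using R_sub v u e by (intro conn_step) auto
  with w(2) have "conn (V - X1) w u" by (rule conn_trans)
  with w(1) show "u \<in> R" by (auto simp: R_def)
qed

text \<open>If \<open>F\<close> met an acyclic component of \<open>V - X0\<close>, the intersection
  would have a vertex of degree at most one. A component contains all neighbours in \<open>F\<close>
  of its vertices, so this vertex would be a leaf of \<open>F\<close>.\<close>

lemma R_stuck:
  assumes F: "F \<subseteq> R - X0" "leaves F = {}" "F \<noteq> {}"
  shows "F \<inter> oH \<noteq> {} \<and> F \<inter> oH \<subseteq> Q"
proof
  have FV: "F \<subseteq> V - X0" using F(1) R_sub by blast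
  show "F \<inter> oH \<noteq> {}"
  proof
    assume "F \<inter> oH = {}"
    with FV have "F \<subseteq> V - X0 - oH" by blast
    with old(1) F(3) obtain v where "v \<in> F" "card (nb v F) \<le> 1" unfolding acyc_def by blast
    with F(2) show False by (auto simp: leaves_def)
  qed
  show "F \<inter> oH \<subseteq> Q"
  proof
    fix h assume h: "h \<in> F \<inter> oH"
    let ?K = "cpt (V - X0) h"
    have "\<not> acyc ?K"
    proof
      assume ac: "acyc ?K"
      have "h \<in> F \<inter> ?K" using h by (simp add: cpt_def)
      with ac obtain v where v: "v \<in> F \<inter> ?K" "card (nb v (F \<inter> ?K)) \<le> 1"
        unfolding acyc_def by (metis empty_iff inf_le2)
      have "u \<in> ?K" if "u \<in> F" "E v u" for u
      proof -
        have "conn (V - X0) v u" using FV v that by (intro conn_step) auto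
        moreover have "conn (V - X0) h v" using v by (simp add: cpt_def)
        ultimately show ?thesis unfolding cpt_def using conn_trans by blast
      qed
      then have "nb v F = nb v (F \<inter> ?K)" unfolding nb_def by blast
      with v F(2) show False by (auto simp: leaves_def)
    qed
    with h F(1) show "h \<in> Q" by (auto simp: Q_def)
  qed
qed

sublocale run E n V X0 X1 R Q oH k d
  using V R_sub R_closed R_stuck by unfold_locales

text \<open>Every cyclic component next to \<open>w\<close> is hit by \<open>Xs\<close> or contributes a vertex of \<open>Hs\<close> to the
  component of \<open>w\<close>.\<close>

lemma card_cyclic_components:
  assumes w: "w \<in> W"
  shows "card {K. \<exists>x \<in> V - X0. E w x \<and> K = cpt (V - X0) x \<and> \<not> acyc K} \<le> k + d" (is "card ?KK \<le> _")
proof -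
  let ?T = "{h \<in> Hs. h \<in> V - Xs \<and> conn (V - Xs) w h}"
  have "\<exists>y \<in> K. y \<in> Xs \<union> ?T" if K: "K \<in> ?KK" for K
  proof (cases "K \<inter> Xs = {}")
    case False
    then show ?thesis by blast
  next
    case True
    obtain x where x: "x \<in> V - X0" "E w x" "K = cpt (V - X0) x" "\<not> acyc K" using K by blast
    have KV: "K \<subseteq> V - Xs" using True x cpt_subset[of x "V - X0"] by blast
    have "\<not> K \<subseteq> V - Xs - Hs" using x(4) acyc_subset[OF solD(4)] by blast
    then obtain h where h: "h \<in> K" "h \<in> Hs" using KV by blast
    have "conn (V - X0) x h" using h x(3) by (simp add: cpt_def)
    then have "h \<in> K \<and> conn ((V - X0) \<inter> K) x h"
    proof (rule conn_closed)
      show "x \<in> K" by (simp add: x(3) cpt_def)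
      fix a b assume ab: "a \<in> K" "b \<in> V - X0" "E a b"
      then have "a \<in> V - X0" using cpt_subset[OF x(1)] x(3) by blast
      with ab have "conn (V - X0) a b" by (intro conn_step)
      moreover have "conn (V - X0) x a" using ab(1) x(3) by (simp add: cpt_def)
      ultimately have "conn (V - X0) x b" by (rule conn_trans[rotated])
      then show "b \<in> K" by (simp add: x(3) cpt_def)
    qed
    then have "conn ((V - X0) \<inter> K) x h" by (rule conjunct2)
    then have "conn (V - Xs) x h" by (rule conn_mono) (use KV in blast)
    moreover have "conn (V - Xs) w x"
      using x KV W_sub(3) w by (intro conn_step) (auto simp: cpt_def)
    ultimately have "conn (V - Xs) w h" by (rule conn_trans[rotated])
    with h KV show ?thesis by blast
  qed
  then have "\<forall>K \<in> ?KK. \<exists>y. y \<in> K \<and> y \<in> Xs \<union> ?T" by blast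
  from bchoice[OF this] obtain g where g': "\<forall>K \<in> ?KK. g K \<in> K \<and> g K \<in> Xs \<union> ?T" by (rule exE)
  have g: "g K \<in> K \<and> g K \<in> Xs \<union> ?T" if "K \<in> ?KK" for K using g' that by (rule bspec)
  \<comment> \<open>Distinct components are disjoint, so their representatives differ.\<close>
  have "inj_on g ?KK"
  proof
    fix K K' assume K: "K \<in> ?KK" "K' \<in> ?KK" "g K = g K'"
    obtain x x' where x: "K = cpt (V - X0) x" "K' = cpt (V - X0) x'" using K by blast
    have "g K \<in> K" using g[OF K(1)] by (rule conjunct1)
    moreover have "g K \<in> K'" unfolding K(3) using g[OF K(2)] by (rule conjunct1)
    ultimately have "g K \<in> cpt (V - X0) x" "g K \<in> cpt (V - X0) x'" unfolding x .
    then have "conn (V - X0) x (g K)" "conn (V - X0) x' (g K)" unfolding cpt_def by simp_all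
    then have "conn (V - X0) x x'" by (rule conn_trans[OF _ conn_sym])
    then show "K = K'" unfolding x cpt_eq_iff .
  qed
  moreover have "g ` ?KK \<subseteq> Xs \<union> ?T" using g by blast
  moreover have "finite (Xs \<union> ?T)" using fin[OF solD(1)] finite_hubs by blast
  ultimately have "card ?KK \<le> card (Xs \<union> ?T)" by (rule card_inj_on_le)
  also have "\<dots> \<le> card Xs + card ?T" by (rule card_Un_le)
  also have "card ?T \<le> d" using solD(5) W_sub(3) w unfolding hb_def by blast
  finally show ?thesis using solD(3) by linarith
qed

text \<open>A vertex of \<open>Q\<close> is reached from \<open>W\<close>, so its component of
  \<open>V - X0\<close> is adjacent to some vertex of \<open>W\<close>. The factors count the
  vertices of \<open>W\<close>, the cyclic components next to one of them, and the vertices of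
  \<open>oH\<close> in one component.\<close>

lemma card_Q: "card Q \<le> (k + 1) * ((k + d) * d)"
proof -
  let ?KK = "\<lambda>w. {K. \<exists>x \<in> V - X0. E w x \<and> K = cpt (V - X0) x \<and> \<not> acyc K}"
  have finV: "finite (V - X0)" by (intro fin) blast
  have finKK: "finite (?KK w)" for w
    by (rule finite_subset[of _ "cpt (V - X0) ` (V - X0)"]) (use finV in auto)
  have finW: "finite W" using W_sub(2) by (intro fin) blast
  have cW: "card W \<le> k + 1" using card_mono[of X0 W] fin[OF X0(1)] X0(2) by (auto simp: W_def)
  have "Q \<subseteq> (\<Union>w \<in> W. \<Union>K \<in> ?KK w. oH \<inter> K)"
  proof
    fix h assume h: "h \<in> Q"
    let ?K = "cpt (V - X0) h"
    have hV: "h \<in> V - X0" "h \<in> oH" "\<not> acyc ?K" using h oH by (auto simp: Q_def)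
    obtain w where w: "w \<in> W" "conn (V - X1) w h" using h by (auto simp: Q_def R_def)
    have "\<exists>x \<in> ?K. \<exists>w' \<in> W. E x w'"
    proof (rule ccontr)
      \<comment> \<open>Without an edge to \<open>W\<close> the component would be closed in
        \<open>V - X1\<close>, so \<open>w\<close> would have to belong to it.\<close>
      assume no: "\<not> (\<exists>x \<in> ?K. \<exists>w' \<in> W. E x w')"
      have "w \<in> ?K \<and> conn ((V - X1) \<inter> ?K) h w"
      proof (rule conn_closed)
        show "conn (V - X1) h w" using w(2) by (rule conn_sym)
        show "h \<in> ?K" by (simp add: cpt_def)
        fix a b assume ab: "a \<in> ?K" "b \<in> V - X1" "E a b"
        have "a \<in> V - X0" using ab(1) cpt_subset[OF hV(1)] by blast
        moreover have "b \<in> V - X0" using ab no W_sub(4) by blast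
        ultimately have "conn (V - X0) a b" using ab(3) by (intro conn_step)
        moreover have "conn (V - X0) h a" using ab(1) by (simp add: cpt_def)
        ultimately have "conn (V - X0) h b" by (rule conn_trans[rotated])
        then show "b \<in> ?K" by (simp add: cpt_def)
      qed
      with cpt_subset[OF hV(1)] w(1) W_sub(4) show False by blast
    qed
    then obtain x w' where x: "x \<in> ?K" "w' \<in> W" "E w' x" using E_sym by blast
    have "?K = cpt (V - X0) x" unfolding cpt_eq_iff using x(1) by (simp add: cpt_def)
    moreover have "x \<in> V - X0" using x(1) cpt_subset[OF hV(1)] by blast
    ultimately have "?K \<in> ?KK w'" using x(3) hV(3) by blast
    moreover have "h \<in> oH \<inter> ?K" using hV(2) by (simp add: cpt_def)
    ultimately show "h \<in> (\<Union>w \<in> W. \<Union>K \<in> ?KK w. oH \<inter> K)" using x(2) by blast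
  qed
  moreover have "finite (\<Union>w \<in> W. \<Union>K \<in> ?KK w. oH \<inter> K)"
    by (rule fin) (use oH in blast)
  ultimately have "card Q \<le> card (\<Union>w \<in> W. \<Union>K \<in> ?KK w. oH \<inter> K)" by (rule card_mono[rotated])
  also have "\<dots> \<le> (\<Sum>w \<in> W. card (\<Union>K \<in> ?KK w. oH \<inter> K))" by (rule card_UN_le[OF finW])
  also have "\<dots> \<le> (\<Sum>w \<in> W. (k + d) * d)"
  proof (rule sum_mono)
    fix w assume w: "w \<in> W"
    have "card (\<Union>K \<in> ?KK w. oH \<inter> K) \<le> (\<Sum>K \<in> ?KK w. card (oH \<inter> K))" by (rule card_UN_le[OF finKK])
    also have "\<dots> \<le> (\<Sum>K \<in> ?KK w. d)"
    proof (rule sum_mono)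
      fix K assume "K \<in> ?KK w"
      then obtain x where x: "x \<in> V - X0" "K = cpt (V - X0) x" by blast
      have "oH \<inter> K \<subseteq> {h \<in> oH. h \<in> V - X0 \<and> conn (V - X0) x h}"
        using cpt_subset[OF x(1)] unfolding x(2) by (auto simp: cpt_def)
      then have "card (oH \<inter> K) \<le> card {h \<in> oH. h \<in> V - X0 \<and> conn (V - X0) x h}"
        by (rule card_mono[OF finite_hubs])
      also have "\<dots> \<le> d" using old(2) x(1) unfolding hb_def by (rule bspec)
      finally show "card (oH \<inter> K) \<le> d" .
    qed
    also have "\<dots> = card (?KK w) * d" by simp
    also have "\<dots> \<le> (k + d) * d" by (rule mult_le_mono1[OF card_cyclic_components[OF w]])
    finally show "card (\<Union>K \<in> ?KK w. oH \<inter> K) \<le> (k + d) * d" .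
  qed
  also have "\<dots> = card W * ((k + d) * d)" by simp
  also have "\<dots> \<le> (k + 1) * ((k + d) * d)" by (rule mult_le_mono1[OF cW])
  finally show ?thesis .
qed

text \<open>The outcome of \<open>ini\<close> and \<open>settle\<close> if the roles guessed for
  \<open>X0\<close> agree with \<open>Xs\<close> and \<open>Hs\<close>.\<close>

definition "cfg0 = Cfg (R - X0) (W - Hs) (V - X1 - R - oH) (W \<inter> Hs \<union> (V - X1 - R) \<inter> oH) X1"

lemma cfg0_cover: "R - X0 \<union> (W - Hs) \<union> (V - X1 - R - oH) \<union> (W \<inter> Hs \<union> (V - X1 - R) \<inter> oH) = V - X1"
  using W_sub R_sub by blast

lemma rest_separated: "u \<in> R \<Longrightarrow> v \<in> V - X1 - R \<Longrightarrow> \<not> E u v"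
  using R_closed by blast

lemma shape_cfg0: "shape cfg0"
  unfolding cfg0_def shape.simps
proof (intro conjI)
  show "R - X0 \<union> (W - Hs) \<union> (V - X1 - R - oH) \<union> (W \<inter> Hs \<union> (V - X1 - R) \<inter> oH) \<subseteq> V - X1"
    by (simp only: cfg0_cover order_refl)
  show "X1 \<subseteq> V" using X0(1) W_sub(4) by blast
qed (use W_sub in blast)+

text \<open>\<open>N\<close> consists of the vertices outside \<open>R\<close> and
  \<open>oH\<close>. By the old solution they induce a forest, and no edge joins them to
  \<open>R\<close>, so they close no cycle although the completion does not test them.\<close>

lemma lift_cfg0: "lift cfg0"
  unfolding cfg0_def lift.simps
proof (intro allI impI)
  fix Y S
  let ?H = "W \<inter> Hs \<union> (V - X1 - R) \<inter> oH"
  assume Y: "Y \<subseteq> R - X0" "S \<subseteq> R - X0 - Y" and ac: "acyc (R - X0 \<union> (W - Hs) - Y - S)"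
    and h: "hb d (R - X0 \<union> (W - Hs) \<union> (V - X1 - R - oH) \<union> ?H - Y) (?H \<union> S)"
  have "V - X1 - R - oH \<subseteq> V - X0 - oH" using W_sub by blast
  with old(1) have "acyc (V - X1 - R - oH)" by (rule acyc_subset)
  with ac have "acyc ((R - X0 \<union> (W - Hs) - Y - S) \<union> (V - X1 - R - oH))"
  proof (rule acyc_Un)
    fix u v assume "u \<in> R - X0 \<union> (W - Hs) - Y - S" "v \<in> V - X1 - R - oH"
    then show "\<not> E u v" using W_sub(1) by (intro rest_separated) auto
  qed
  then have "acyc (V - (X1 \<union> Y) - (?H \<union> S))"
    by (rule acyc_subset) (use W_sub R_sub Y in blast)
  moreover have "V - X1 - Y = V - (X1 \<union> Y)" by blast
  ultimately show "acyc (V - (X1 \<union> Y) - (?H \<union> S)) \<and> hb d (V - (X1 \<union> Y)) (?H \<union> S)"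
    using h unfolding cfg0_cover by simp
qed

text \<open>The completion follows \<open>Xs\<close> and \<open>Hs\<close> inside \<open>R\<close>
  and the old solution outside. The two can be combined because no edge joins \<open>R\<close> to
  the rest of \<open>V - X1\<close>, and only part of \<open>Xs\<close> is deleted, so the budget
  suffices.\<close>

lemma ext_cfg0: "ext cfg0 (Xs \<inter> (R - X0)) (Hs \<inter> (R - X0))"
  unfolding cfg0_def ext.simps cfg0_cover
proof (intro conjI)
  let ?Y = "Xs \<inter> (R - X0)" and ?S = "Hs \<inter> (R - X0)" and ?H = "W \<inter> Hs \<union> (V - X1 - R) \<inter> oH"
  show "?Y \<subseteq> R - X0" "?S \<subseteq> R - X0 - ?Y" using solD(2) by blast+
  have "card ?Y + card X1 = card (?Y \<union> X1)"
    using fin[OF solD(1)] by (intro card_Un_disjoint[symmetric]) (auto simp: X1_def)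
  also have "\<dots> \<le> card Xs" using fin[OF solD(1)] by (intro card_mono) (auto simp: X1_def)
  finally show "card ?Y + card X1 \<le> k" using solD(3) by linarith
  show "acyc (R - X0 \<union> (W - Hs) - ?Y - ?S)"
    by (rule acyc_subset[OF solD(4)]) (use R_sub W_sub in blast)
  have "hb d ((R - ?Y) \<union> (V - X1 - R)) (?H \<union> ?S)"
  proof (rule hb_Un)
    have "hb d (R - ?Y) Hs"
      by (rule hb_mono[OF solD(5)]) (use R_sub W_sub in \<open>auto simp: X1_def\<close>)
    then have "hb d (R - ?Y) ((?H \<union> ?S) \<inter> (R - ?Y))" by (rule hb_mono) auto
    then show "hb d (R - ?Y) (?H \<union> ?S)" by (simp only: hb_Int)
    have "hb d (V - X1 - R) oH" by (rule hb_mono[OF old(2)]) (use W_sub in auto)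
    then have "hb d (V - X1 - R) ((?H \<union> ?S) \<inter> (V - X1 - R))"
      by (rule hb_mono) (use W_sub(1) in auto)
    then show "hb d (V - X1 - R) (?H \<union> ?S)" by (simp only: hb_Int)
    fix u v assume "u \<in> R - ?Y" "v \<in> V - X1 - R"
    then show "\<not> E u v" by (intro rest_separated) auto
  qed
  moreover have "(R - ?Y) \<union> (V - X1 - R) = V - X1 - ?Y" using R_sub by blast
  ultimately show "hb d (V - X1 - ?Y) (?H \<union> ?S)" by simp
qed

text \<open>The summands estimate those of \<open>mu cfg0\<close>: the budget, the components of
  \<open>W\<close>, the vertices of \<open>O\<close>, and \<open>card_Q\<close> with its
  weight.\<close>

definition "bound = k + (d + 1) * (k + 1) + 2 * (k + 1) + (d + 4) * ((k + 1) * ((k + d) * d))"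

lemma mu_arith:
  fixes p q r x y z :: nat
  assumes "p \<le> p'" "r \<le> r'" "q \<le> q'"
  shows "int k - int x + int p - int y + 2 * int r - int z + int q \<le> int (k + p' + 2 * r' + q')"
  using assms by linarith

lemma mu_cfg0: "mu cfg0 \<le> int bound"
proof -
  have cW: "card W \<le> k + 1" using card_mono[of X0 W] fin[OF X0(1)] X0(2) by (auto simp: W_def)
  have finW: "finite W" using W_sub(2) by (intro fin) blast
  have e: "((W - Hs) \<union> (V - X1 - R - oH) \<union> (W \<inter> Hs \<union> (V - X1 - R) \<inter> oH)) \<inter> R = W" using W_sub(1) by blast
  have "ncomp W \<le> k + 1" using ncomp_le_card[OF finW] cW by linarith
  then have 1: "(d + 1) * ncomp W \<le> (d + 1) * (k + 1)" by (rule mult_le_mono2)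
  have 2: "card (W - Hs) \<le> k + 1" using card_mono[OF finW, of "W - Hs"] cW by auto
  have "finite Q" using oH by (intro fin) (auto simp: Q_def)
  then have "card ((R - X0) \<inter> Q) \<le> card Q" by (intro card_mono) auto
  with card_Q have "card ((R - X0) \<inter> Q) \<le> (k + 1) * ((k + d) * d)" by linarith
  then have "(d + 4) * card ((R - X0) \<inter> Q) \<le> (d + 4) * ((k + 1) * ((k + d) * d))" by (rule mult_le_mono2)
  from mu_arith[OF 1 2 this] show ?thesis unfolding cfg0_def mu.simps e bound_def .
qed

text \<open>At most \<open>k + 1\<close> digits distribute \<open>X0\<close>, and
  \<open>bound\<close> digits are enough for the elimination.\<close>

lemma attempt_succeeds:
  assumes m: "V = {..<m}" and l: "k + 1 + bound \<le> l"
  shows "\<exists>c < 3 ^ l. cF (attempt X0 oH m c) = {} \<and> sol k d V (cX (attempt X0 oH m c)) (cH (attempt X0 oH m c))"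
proof -
  have "card (cF cfg0) \<le> n"
  proof -
    have "R - X0 \<subseteq> {..<n}" using R_sub V by blast
    from card_mono[OF finite_lessThan this] show ?thesis by (simp add: cfg0_def)
  qed
  from steps_reach_solution[OF shape_cfg0 lift_cfg0 ext_cfg0 mu_cfg0 this]
  obtain e st' c' where e: "e < 3 ^ bound" "(step oH ^^ n) (cfg0, e) = (st', c')" "cF st' = {}"
    "sol k d V (cX st') (cH st')" by blast
  obtain c where c: "c < 3 ^ card (X0 \<inter> {..<m}) * (e + 1)" "ini X0 m c =
    (Cfg ({..<m} - X0) ((X0 - Xs - Hs) \<inter> {..<m}) {} (X0 \<inter> (Hs - Xs) \<inter> {..<m}) (X0 \<inter> Xs \<inter> {..<m}), e)"
    using ini_guess[of X0 m e Xs Hs] by blast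
  have sets: "{..<m} - X0 = V - X0" "(X0 - Xs - Hs) \<inter> {..<m} = W - Hs"
    "X0 \<inter> (Hs - Xs) \<inter> {..<m} = W \<inter> Hs" "X0 \<inter> Xs \<inter> {..<m} = X1"
    using X0(1) unfolding m[symmetric] W_def X1_def by blast+
  have A: "(V - X0) \<union> (W - Hs) \<union> (W \<inter> Hs) = V - X1" using W_sub by blast
  have Re: "{v. \<exists>w \<in> X0. w \<in> V - X1 \<and> conn (V - X1) w v} = R"
    using W_sub unfolding R_def by blast
  have "settle X0 oH (Cfg (V - X0) (W - Hs) {} (W \<inter> Hs) X1) = cfg0"
    unfolding settle.simps Let_def A Re cfg0_def cfg.inject using W_sub R_sub by blast
  then have at: "attempt X0 oH m c = st'"
    unfolding attempt_def c(2) sets prod.case by (simp only: e(2) fst_conv)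
  have "X0 \<inter> {..<m} = X0" using X0(1) m by blast
  then have "c < 3 ^ card X0 * (e + 1)" using c(1) by simp
  also have "\<dots> \<le> 3 ^ (k + 1) * 3 ^ bound"
    using e(1) X0(2) by (intro mult_le_mono power_increasing) simp_all
  also have "\<dots> = 3 ^ (k + 1 + bound)" by (simp only: power_add)
  also have "\<dots> \<le> 3 ^ l" using l by (intro power_increasing) simp_all
  finally show ?thesis using e(3,4) unfolding at[symmetric] by blast
qed

end

section \<open>The program\<close>

declare sem.simps(5) [simp del]

text \<open>
  Variables are arrays; a scalar variable uses the cell with index \<open>0\<close>. A vertex set is an array that is
  positive exactly on its elements, and \<open>vROW\<close> holds the addresses of the rows of the adjacency matrix,
  which cannot be computed by multiplication.
\<close>

abbreviation (input) "vROW \<equiv> 0 :: nat"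
abbreviation (input) "vOX \<equiv> 1 :: nat"
abbreviation (input) "vOH \<equiv> 2 :: nat"
abbreviation (input) "vF \<equiv> 3 :: nat"
abbreviation (input) "vO \<equiv> 4 :: nat"
abbreviation (input) "vN \<equiv> 5 :: nat"
abbreviation (input) "vH \<equiv> 6 :: nat"
abbreviation (input) "vX \<equiv> 7 :: nat"
abbreviation (input) "vL \<equiv> 8 :: nat"
abbreviation (input) "vA \<equiv> 9 :: nat"
abbreviation (input) "vZ \<equiv> 10 :: nat"
abbreviation (input) "vcur \<equiv> 11 :: nat"
abbreviation (input) "vr \<equiv> 12 :: nat"
abbreviation (input) "vq \<equiv> 13 :: nat"
abbreviation (input) "vt \<equiv> 14 :: nat"
abbreviation (input) "vu \<equiv> 15 :: nat"
abbreviation (input) "vv \<equiv> 16 :: nat"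
abbreviation (input) "vw \<equiv> 17 :: nat"
abbreviation (input) "vl \<equiv> 18 :: nat"
abbreviation (input) "vm \<equiv> 19 :: nat"
abbreviation (input) "vsel \<equiv> 20 :: nat"
abbreviation (input) "vfnd \<equiv> 21 :: nat"
abbreviation (input) "vcnt \<equiv> 22 :: nat"
abbreviation (input) "va \<equiv> 23 :: nat"
abbreviation (input) "vb \<equiv> 24 :: nat"
abbreviation (input) "vstep \<equiv> 25 :: nat"
abbreviation (input) "vok \<equiv> 26 :: nat"
abbreviation (input) "vi \<equiv> 27 :: nat"
abbreviation (input) "vg \<equiv> 28 :: nat"
abbreviation (input) "vfound \<equiv> 29 :: nat"
abbreviation (input) "vyes \<equiv> 30 :: nat"
abbreviation (input) "vM \<equiv> 31 :: nat"
abbreviation (input) "vT \<equiv> 32 :: nat"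

abbreviation (input) "Var j \<equiv> Ar j (Cst 0)"
abbreviation (input) "Asg j e \<equiv> Put j (Cst 0) e"
abbreviation (input) "Inc j \<equiv> Put j (Cst 0) (Pl (Ar j (Cst 0)) (Cst 1))"
abbreviation (input) "At j x \<equiv> Ar j (Ar x (Cst 0))"
abbreviation (input) "PutAt j x e \<equiv> Put j (Ar x (Cst 0)) e"
abbreviation (input) "When e c \<equiv> Lt (Cst 0) e c Nop"
abbreviation (input) "adj x y \<equiv> In (Pl (Ar 0 (Ar x (Cst 0))) (Ar y (Cst 0)))"
abbreviation (input) "Loop x c \<equiv> For x (In (Cst 0)) c"

definition "relabel =
  Loop vw (Lt (At vL vw) (Var vm) Nop (Lt (Var vm) (At vL vw) Nop (PutAt vL vw (Var vl))))"

text \<open>Components by merging label classes along every edge inside \<open>vA\<close>; one pass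
  over all pairs suffices, since \<open>relabel\<close> renames a whole class.\<close>

definition "labels =
  Sq (Loop vu (PutAt vL vu (Var vu)))
     (Loop vu (Loop vv (When (At vA vu) (When (At vA vv) (When (adj vu vv)
        (Sq (Asg vl (At vL vu)) (Sq (Asg vm (At vL vv)) relabel)))))))"

text \<open>Division by three by counting. The loop is bounded by \<open>vM\<close> rather than
  \<open>vcur\<close>, because \<open>bdd_static\<close> asks for bounds that the program does not
  change; the test against \<open>vcur\<close> makes the surplus rounds idle.\<close>

definition "digit =
  Sq (Asg vq (Cst 0)) (Sq (Asg vr (Cst 0))
    (Sq (For vt (Var vM) (Lt (Var vt) (Var vcur) (Lt (Var vr) (Cst 2) (Inc vr) (Sq (Asg vr (Cst 0)) (Inc vq))) Nop))
        (Asg vcur (Var vq))))"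

definition "put = Sq (PutAt vF vsel (Cst 0))
  (Lt (Var vr) (Cst 1) (PutAt vX vsel (Cst 1)) (Lt (Var vr) (Cst 2) (PutAt vH vsel (Cst 1))
    (Lt (Var va) (Cst 1) (PutAt vN vsel (Cst 1)) (PutAt vO vsel (Cst 1)))))"

definition "degree x Y =
  Sq (Asg vcnt (Cst 0)) (Loop vu (When (At Y vu) (When (adj x vu) (Inc vcnt))))"

definition "find_leaf =
  Loop vv (When (At vF vv) (Sq (degree vv vF) (Lt (Var vcnt) (Cst 2) (Sq (Asg vsel (Var vv)) (Asg vfnd (Cst 1))) Nop)))"

definition "find_hub =
  Loop vv (When (At vF vv) (When (At vOH vv) (Sq (Asg vsel (Var vv)) (Asg vfnd (Cst 2)))))"

text \<open>\<open>vb\<close> is a saturating count of the components in \<open>vA\<close> next to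
  \<open>vsel\<close>: none, one or several. \<open>vl\<close> holds the label of the first one
  found.\<close>

definition "inspect =
  Sq (Asg va (Cst 0)) (Sq (Asg vb (Cst 0))
    (Loop vu (When (adj vsel vu) (Sq (When (At vO vu) (Inc va))
      (When (At vA vu) (Lt (Var vb) (Cst 1) (Sq (Asg vb (Cst 1)) (Asg vl (At vL vu)))
        (Lt (Var vl) (At vL vu) (Asg vb (Cst 2)) (Lt (At vL vu) (Var vl) (Asg vb (Cst 2)) Nop))))))))"

definition "treat_leaf =
  Sq (Loop vv (PutAt vA vv (Pl (At vO vv) (Pl (At vN vv) (At vH vv))))) (Sq labels (Sq inspect
    (Lt (Var vb) (Cst 1) (PutAt vF vsel (Cst 0))
      (Lt (Var va) (Cst 2) (Lt (Var vb) (Cst 2) (Sq (Asg vr (Cst 2)) put) (Sq digit put)) (Sq digit put)))))"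

definition "eliminate =
  Sq (Asg vfnd (Cst 0)) (Sq find_leaf (Lt (Var vfnd) (Cst 1)
    (Sq find_hub (Lt (Cst 0) (Var vfnd) (Sq (Asg va (Cst 1)) (Sq digit put)) Nop))
    treat_leaf))"

definition "settling =
  Sq (Loop vv (PutAt vA vv (Pl (At vF vv) (Pl (At vO vv) (At vH vv))))) (Sq labels
    (Loop vv (When (At vF vv) (Sq (Sq (Asg vcnt (Cst 0))
        (Loop vu (When (At vOX vu) (When (At vA vu)
           (Lt (At vL vu) (At vL vv) Nop (Lt (At vL vv) (At vL vu) Nop (Asg vcnt (Cst 1))))))))
      (Lt (Var vcnt) (Cst 1) (Sq (PutAt vF vv (Cst 0)) (Lt (Cst 0) (At vOH vv) (PutAt vH vv (Cst 1)) (PutAt vN vv (Cst 1)))) Nop)))))"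

definition "clear = Loop vv (Sq (PutAt vF vv (Cst 0)) (Sq (PutAt vO vv (Cst 0)) (Sq (PutAt vN vv (Cst 0))
  (Sq (PutAt vH vv (Cst 0)) (PutAt vX vv (Cst 0))))))"

definition "distribute =
  Loop vv (Lt (Var vv) (Pl (Var vi) (Cst 1))
    (Lt (Cst 0) (At vOX vv) (Sq (Asg vsel (Var vv)) (Sq (Asg va (Cst 1)) (Sq digit put))) (PutAt vF vv (Cst 1))) Nop)"

definition "guess_run = Sq (Asg vcur (Var vg)) (Sq clear (Sq distribute (Sq settling (Loop vstep eliminate))))"

definition "active =
  Loop vv (Sq (PutAt vA vv (Cst 0)) (Sq (PutAt vZ vv (Cst 0)) (Lt (Var vv) (Pl (Var vi) (Cst 1))
    (Lt (Cst 0) (At vX vv) Nop (Sq (PutAt vA vv (Cst 1)) (Lt (Cst 0) (At vH vv) Nop (PutAt vZ vv (Cst 1))))) Nop)))"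

definition "count_deleted =
  Sq (Asg vcnt (Cst 0)) (Loop vu (Lt (Var vu) (Pl (Var vi) (Cst 1)) (When (At vX vu) (Inc vcnt)) Nop))"

definition "peel = Loop vstep (Loop vv (When (At vZ vv)
  (Sq (degree vv vZ) (Lt (Var vcnt) (Cst 2) (PutAt vZ vv (Cst 0)) Nop))))"

definition "count_hubs =
  Sq (Asg vcnt (Cst 0)) (Loop vu (When (At vA vu) (When (At vH vu)
     (Lt (At vL vu) (At vL vv) Nop (Lt (At vL vv) (At vL vu) Nop (Inc vcnt))))))"

definition "check_hubs = Loop vv (When (At vA vv) (Sq count_hubs (Lt (In (Cst 2)) (Var vcnt) (Asg vok (Cst 0)) Nop)))"

definition "check_forest = Loop vv (When (At vZ vv) (Asg vok (Cst 0)))"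

text \<open>Tests \<open>sol\<close> directly, so that wrong guesses are rejected and soundness does
  not rest on the elimination.\<close>

definition "check = Sq (Asg vok (Cst 1)) (Sq active (Sq count_deleted (Sq (Lt (In (Cst 1)) (Var vcnt) (Asg vok (Cst 0)) Nop)
  (Sq peel (Sq check_forest (Sq labels check_hubs))))))"

definition "search =
  Sq (Asg vfound (Cst 0)) (For vg (Var vM) (Lt (Var vfound) (Cst 1)
    (Sq guess_run (Sq check (When (Var vok) (Asg vfound (Cst 1))))) Nop))"

text \<open>The candidate accepted by \<open>check\<close> has left its remaining vertices in
  \<open>vA\<close>; everything else among the first vertices counts as deleted.\<close>

definition "keep = Loop vv (Sq (PutAt vOX vv (Cst 0)) (Sq (PutAt vOH vv (Cst 0)) (Lt (Var vv) (Pl (Var vi) (Cst 1))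
  (Lt (Cst 0) (At vA vv) (PutAt vOH vv (At vH vv)) (PutAt vOX vv (Cst 1))) Nop)))"

definition "compress_all = Loop vi (When (Var vyes)
  (Sq (PutAt vOX vi (Cst 1)) (Sq search (Lt (Cst 0) (Var vfound) keep (Asg vyes (Cst 0))))))"

text \<open>Four doublings multiply by 16, and a tripling is a sum of three terms: \<open>vT\<close>
  becomes a power of 16, and \<open>vM\<close> is 3 to the power \<open>vT\<close>.\<close>

definition "power_setup e1 e2 = Sq (Asg vT (Cst 16)) (Sq
  (For vt e1 (Sq (Asg vT (Pl (Var vT) (Var vT))) (Sq (Asg vT (Pl (Var vT) (Var vT))) (Sq (Asg vT (Pl (Var vT) (Var vT))) (Asg vT (Pl (Var vT) (Var vT)))))))
  (Sq (For vt e2 (Sq (Asg vT (Pl (Var vT) (Var vT))) (Sq (Asg vT (Pl (Var vT) (Var vT))) (Sq (Asg vT (Pl (Var vT) (Var vT))) (Asg vT (Pl (Var vT) (Var vT)))))))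
  (Sq (Asg vM (Cst 1)) (For vt (Var vT) (Asg vM (Pl (Var vM) (Pl (Var vM) (Var vM))))))))"

definition "rows = Sq (Asg vr (Cst 3)) (Loop vu (Sq (PutAt vROW vu (Var vr)) (Asg vr (Pl (Var vr) (In (Cst 0))))))"

definition "main = Sq (power_setup (In (Cst 1)) (In (Cst 2))) (Sq rows (Sq (Asg vyes (Cst 1)) compress_all))"

lemmas prog_defs = relabel_def labels_def digit_def put_def degree_def find_leaf_def find_hub_def
  inspect_def treat_leaf_def eliminate_def settling_def clear_def distribute_def guess_run_def
  active_def count_deleted_def peel_def count_hubs_def check_hubs_def check_forest_def check_def
  search_def keep_def compress_all_def power_setup_def rows_def main_def

lemma wfc_main: "wfc main"
  by (simp add: prog_defs)

lemma writes_relabel [simp]: "writes relabel = {vw, vL}" by (simp add: relabel_def)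
lemma writes_labels [simp]: "writes labels = {vL, vu, vv, vw, vl, vm}" by (auto simp: labels_def)
lemma writes_digit [simp]: "writes digit = {vq, vr, vt, vcur}" by (auto simp: digit_def)
lemma writes_put [simp]: "writes put = {vF, vX, vH, vN, vO}" by (auto simp: put_def)
lemma writes_degree [simp]: "writes (degree x Y) = {vcnt, vu}" by (auto simp: degree_def)
lemma writes_find_leaf [simp]: "writes find_leaf = {vv, vcnt, vu, vsel, vfnd}" by (auto simp: find_leaf_def)
lemma writes_find_hub [simp]: "writes find_hub = {vv, vsel, vfnd}" by (auto simp: find_hub_def)
lemma writes_inspect [simp]: "writes inspect = {va, vb, vu, vl}" by (auto simp: inspect_def)
lemma writes_treat_leaf [simp]: "writes treat_leaf = {vA, vL, vu, vv, vw, vl, vm, va, vb, vF, vX, vH, vN, vO, vq, vr, vt, vcur}"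
  by (auto simp: treat_leaf_def)
lemma writes_eliminate [simp]: "writes eliminate = {vA, vL, vu, vv, vw, vl, vm, va, vb, vF, vX, vH, vN, vO, vq, vr, vt, vcur, vcnt, vsel, vfnd}"
  by (auto simp: eliminate_def)
lemma writes_settling [simp]: "writes settling = {vA, vL, vu, vv, vw, vl, vm, vcnt, vF, vH, vN}"
  by (auto simp: settling_def)
lemma writes_clear [simp]: "writes clear = {vv, vF, vO, vN, vH, vX}" by (auto simp: clear_def)
lemma writes_distribute [simp]: "writes distribute = {vv, vsel, va, vF, vX, vH, vN, vO, vq, vr, vt, vcur}"
  by (auto simp: distribute_def)
lemma writes_guess_run [simp]: "writes guess_run = {vA, vL, vu, vv, vw, vl, vm, va, vb, vF, vX, vH, vN, vO, vq, vr, vt, vcur, vcnt, vsel, vfnd, vstep}"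
  by (auto simp: guess_run_def)
lemma writes_active [simp]: "writes active = {vv, vA, vZ}" by (auto simp: active_def)
lemma writes_count_deleted [simp]: "writes count_deleted = {vcnt, vu}" by (auto simp: count_deleted_def)
lemma writes_peel [simp]: "writes peel = {vstep, vv, vcnt, vu, vZ}" by (auto simp: peel_def)
lemma writes_count_hubs [simp]: "writes count_hubs = {vcnt, vu}" by (auto simp: count_hubs_def)
lemma writes_check_hubs [simp]: "writes check_hubs = {vv, vcnt, vu, vok}" by (auto simp: check_hubs_def)
lemma writes_check_forest [simp]: "writes check_forest = {vv, vok}" by (auto simp: check_forest_def)
lemma writes_check [simp]: "writes check = {vok, vv, vA, vZ, vcnt, vu, vstep, vL, vw, vl, vm}"
  by (auto simp: check_def)
lemma writes_search [simp]: "writes search = {vfound, vg, vA, vL, vu, vv, vw, vl, vm, va, vb, vF, vX, vH, vN, vO, vq, vr, vt, vcur, vcnt, vsel, vfnd, vstep, vok, vZ}"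
  by (auto simp: search_def)
lemma writes_keep [simp]: "writes keep = {vv, vOX, vOH}" by (auto simp: keep_def)

section \<open>Correctness of the program: loop rules and component labels\<close>

locale program = sgraph +
  fixes inp :: "nat \<Rightarrow> nat"
  assumes inp_n: "inp 0 = n"
    and inp_adj: "u < n \<Longrightarrow> v < n \<Longrightarrow> inp (3 + n * u + v) = (if E u v then 1 else 0)"
begin

definition rowed :: "arrs \<Rightarrow> bool" where
  "rowed \<sigma> \<longleftrightarrow> (\<forall>u<n. \<sigma> vROW u = 3 + n * u)"

definition els :: "arrs \<Rightarrow> nat \<Rightarrow> nat set" where
  "els \<sigma> j = {v. v < n \<and> 0 < \<sigma> j v}"

lemma els_bound: "els \<sigma> j \<subseteq> {..<n}" "v \<in> els \<sigma> j \<Longrightarrow> v < n" "finite (els \<sigma> j)"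
  by (auto simp: els_def)

lemma els_upd: "v < n \<Longrightarrow> els (upd \<sigma> j v x) j = (if 0 < x then insert v (els \<sigma> j) else els \<sigma> j - {v})"
  by (auto simp: els_def)

lemma els_upd_other: "j' \<noteq> j \<Longrightarrow> els (upd \<sigma> j v x) j' = els \<sigma> j'"
  by (simp add: els_def)

lemma rowed_cong: "\<tau> vROW = \<sigma> vROW \<Longrightarrow> rowed \<sigma> \<Longrightarrow> rowed \<tau>"
  by (simp add: rowed_def)

lemma adj_val: "rowed \<sigma> \<Longrightarrow> u < n \<Longrightarrow> v < n \<Longrightarrow> inp (\<sigma> vROW u + v) = (if E u v then 1 else 0)"
  by (simp add: rowed_def inp_adj)

text \<open>\<open>sem_For\<close> for loops over all vertices, with the frame condition for arrays
  that the body does not write built into the invariant.\<close>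

lemma sem_Loop:
  assumes "x \<notin> writes c"
    and "I 0 (upd \<sigma> x 0 0)"
    and "\<And>i \<tau>. i < n \<Longrightarrow> I i \<tau> \<Longrightarrow> \<tau> x 0 = i \<Longrightarrow> (\<And>j. j \<noteq> x \<Longrightarrow> j \<notin> writes c \<Longrightarrow> \<tau> j = \<sigma> j) \<Longrightarrow>
      I (Suc i) (upd (sem c inp \<tau>) x 0 (Suc i))"
  shows "I n (sem (Loop x c) inp \<sigma>)"
proof -
  let ?J = "\<lambda>i \<tau>. I i \<tau> \<and> (\<forall>j. j \<noteq> x \<longrightarrow> j \<notin> writes c \<longrightarrow> \<tau> j = \<sigma> j)"
  have "?J (val (In (Cst 0)) inp \<sigma>) (sem (Loop x c) inp \<sigma>)"
  proof (rule sem_For[where I = ?J])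
    show "x \<notin> writes c" by fact
    show "?J 0 (upd \<sigma> x 0 0)" using assms(2) by simp
    fix i \<tau> assume i: "i < val (In (Cst 0)) inp \<sigma>" "?J i \<tau>" "\<tau> x 0 = i"
    then show "?J (Suc i) (upd (sem c inp \<tau>) x 0 (Suc i))"
      using assms(3)[of i \<tau>] by (simp add: inp_n sem_frame)
  qed
  then show ?thesis by (simp add: inp_n)
qed

lemma sem_Loop_count:
  assumes x: "x \<noteq> c" and b: "\<And>\<tau>. (\<And>j. j \<noteq> x \<Longrightarrow> j \<noteq> c \<Longrightarrow> \<tau> j = \<sigma> j) \<Longrightarrow> \<tau> x 0 < n \<Longrightarrow>
      sem body inp \<tau> = (if P (\<tau> x 0) then upd \<tau> c 0 (Suc (\<tau> c 0)) else \<tau>)"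
    and w: "writes body = {c}"
  shows "sem (Loop x body) inp \<sigma> c 0 = \<sigma> c 0 + card {i. i < n \<and> P i}"
proof -
  let ?I = "\<lambda>i \<tau>. \<tau> c 0 = \<sigma> c 0 + card {y. y < i \<and> P y}"
  show ?thesis
  proof (rule sem_Loop[where I = ?I])
    fix i \<tau> assume i: "i < n" "?I i \<tau>" "\<tau> x 0 = i" "\<And>j. j \<noteq> x \<Longrightarrow> j \<notin> writes body \<Longrightarrow> \<tau> j = \<sigma> j"
    have "{y. y < Suc i \<and> P y} = (if P i then insert i {y. y < i \<and> P y} else {y. y < i \<and> P y})"
      by (auto simp: less_Suc_eq)
    then have "card {y. y < Suc i \<and> P y} = card {y. y < i \<and> P y} + (if P i then 1 else 0)" by simp
    then show "?I (Suc i) (upd (sem body inp \<tau>) x 0 (Suc i))"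
      using i x b[of \<tau>] by (simp add: w)
  qed (use x w in auto)
qed

lemma sem_Loop_flag:
  assumes x: "x \<noteq> c" and b: "\<And>\<tau>. (\<And>j. j \<noteq> x \<Longrightarrow> j \<noteq> c \<Longrightarrow> \<tau> j = \<sigma> j) \<Longrightarrow> \<tau> x 0 < n \<Longrightarrow>
      sem body inp \<tau> = (if P (\<tau> x 0) then upd \<tau> c 0 m else \<tau>)"
    and w: "writes body = {c}"
  shows "sem (Loop x body) inp \<sigma> c 0 = (if \<exists>i<n. P i then m else \<sigma> c 0)"
proof -
  let ?I = "\<lambda>i \<tau>. \<tau> c 0 = (if \<exists>y<i. P y then m else \<sigma> c 0)"
  show ?thesis
  proof (rule sem_Loop[where I = ?I])
    fix i \<tau> assume i: "i < n" "?I i \<tau>" "\<tau> x 0 = i" "\<And>j. j \<noteq> x \<Longrightarrow> j \<notin> writes body \<Longrightarrow> \<tau> j = \<sigma> j"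
    then show "?I (Suc i) (upd (sem body inp \<tau>) x 0 (Suc i))"
      using x b[of \<tau>] by (auto simp: w less_Suc_eq)
  qed (use x w in auto)
qed

lemma sem_relabel:
  "x < n \<Longrightarrow> sem relabel inp \<sigma> vL x = (if \<sigma> vL x = \<sigma> vm 0 then \<sigma> vl 0 else \<sigma> vL x)"
proof -
  let ?I = "\<lambda>i \<tau>. \<forall>x. \<tau> vL x = (if x < i \<and> \<sigma> vL x = \<sigma> vm 0 then \<sigma> vl 0 else \<sigma> vL x)"
  have "?I n (sem relabel inp \<sigma>)"
    unfolding relabel_def
  proof (rule sem_Loop)
    fix i and \<tau> :: arrs assume i: "i < n" "?I i \<tau>" "\<tau> vw 0 = i"
      and fr: "\<And>j. j \<noteq> vw \<Longrightarrow> j \<notin> writes (Lt (At vL vw) (Var vm) Nop (Lt (Var vm) (At vL vw) Nop (PutAt vL vw (Var vl))))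
        \<Longrightarrow> \<tau> j = \<sigma> j"
    have "\<tau> vm = \<sigma> vm" "\<tau> vl = \<sigma> vl" by (auto intro!: fr)
    with i show "?I (Suc i) (upd (sem (Lt (At vL vw) (Var vm) Nop (Lt (Var vm) (At vL vw) Nop (PutAt vL vw (Var vl)))) inp \<tau>) vw 0 (Suc i))"
      by (auto simp: less_Suc_eq)
  qed auto
  then show "x < n \<Longrightarrow> ?thesis" by simp
qed

text \<open>Invariant \<open>?G\<close>: equal labels imply connectedness, and the ends of every
  edge treated so far have equal labels. Renaming whole classes preserves equalities once they are
  reached.\<close>

lemma sem_labels:
  assumes "rowed \<sigma>"
  shows "x \<in> els \<sigma> vA \<Longrightarrow> y \<in> els \<sigma> vA \<Longrightarrow>
    sem labels inp \<sigma> vL x = sem labels inp \<sigma> vL y \<longleftrightarrow> conn (els \<sigma> vA) x y"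
proof -
  let ?A = "els \<sigma> vA"
  let ?c1 = "PutAt vL vu (Var vu)"
  let ?step = "Sq (Asg vl (At vL vu)) (Sq (Asg vm (At vL vv)) relabel)"
  let ?c3 = "When (At vA vu) (When (At vA vv) (When (adj vu vv) ?step))"
  define \<sigma>1 where "\<sigma>1 = sem (Loop vu ?c1) inp \<sigma>"
  have L1: "\<sigma>1 vL x = x" if "x < n" for x
  proof -
    have "\<forall>x<n. \<sigma>1 vL x = x" unfolding \<sigma>1_def
      by (rule sem_Loop[where I = "\<lambda>i \<tau>. \<forall>x<i. \<tau> vL x = x"]) (auto simp: less_Suc_eq)
    with that show ?thesis by simp
  qed
  have fr1: "\<sigma>1 j = \<sigma> j" if "j \<noteq> vu" "j \<noteq> vL" for j
    unfolding \<sigma>1_def using that by (intro sem_frame) auto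
  let ?G = "\<lambda>P (\<tau> :: arrs). (\<forall>x \<in> ?A. \<forall>y \<in> ?A. \<tau> vL x = \<tau> vL y \<longrightarrow> conn ?A x y) \<and>
      (\<forall>x \<in> ?A. \<forall>y \<in> ?A. E x y \<longrightarrow> P x y \<longrightarrow> \<tau> vL x = \<tau> vL y)"
  have "?G (\<lambda>x y. x < n) (sem (Loop vu (Loop vv ?c3)) inp \<sigma>1)"
  proof (rule sem_Loop[where I = "\<lambda>i. ?G (\<lambda>x y. x < i)"])
    show "?G (\<lambda>x y. x < 0) (upd \<sigma>1 vu 0 0)" using L1 els_bound(2) by auto
    fix i and \<tau> :: arrs assume i: "i < n" "?G (\<lambda>x y. x < i) \<tau>" "\<tau> vu 0 = i"
      and fr: "\<And>j. j \<noteq> vu \<Longrightarrow> j \<notin> writes (Loop vv ?c3) \<Longrightarrow> \<tau> j = \<sigma>1 j"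
    have "?G (\<lambda>x y. x < i \<or> x = i \<and> y < n) (sem (Loop vv ?c3) inp \<tau>)"
    proof (rule sem_Loop[where I = "\<lambda>j. ?G (\<lambda>x y. x < i \<or> x = i \<and> y < j)"])
      show "?G (\<lambda>x y. x < i \<or> x = i \<and> y < 0) (upd \<tau> vv 0 0)" using i(2) by simp
      fix j and \<rho> :: arrs assume j: "j < n" "?G (\<lambda>x y. x < i \<or> x = i \<and> y < j) \<rho>" "\<rho> vv 0 = j"
        and fr2: "\<And>j. j \<noteq> vv \<Longrightarrow> j \<notin> writes ?c3 \<Longrightarrow> \<rho> j = \<tau> j"
      have \<rho>: "\<rho> vu 0 = i" "\<rho> vA = \<sigma> vA" "\<rho> vROW = \<sigma> vROW"
        using fr2[of vu] fr2[of vA] fr2[of vROW] fr[of vA] fr[of vROW] fr1[of vA] fr1[of vROW] i(3) by simp_all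
      then have adj: "inp (\<rho> vROW i + j) = (if E i j then 1 else 0)"
        using assms i(1) j(1) by (intro adj_val) (auto simp: rowed_def)
      have A: "0 < \<rho> vA i \<longleftrightarrow> i \<in> ?A" "0 < \<rho> vA j \<longleftrightarrow> j \<in> ?A" using i(1) j(1) \<rho> by (auto simp: els_def)
      show "?G (\<lambda>x y. x < i \<or> x = i \<and> y < Suc j) (upd (sem ?c3 inp \<rho>) vv 0 (Suc j))"
      proof (cases "i \<in> ?A \<and> j \<in> ?A \<and> E i j")
        case False
        then have "sem ?c3 inp \<rho> = \<rho>" using A \<rho>(1) j(3) adj by auto
        then show ?thesis using j(2) False by (auto simp: less_Suc_eq)
      next
        case True
        define \<rho>' where "\<rho>' = sem ?c3 inp \<rho>"
        have "\<rho>' = sem relabel inp (upd (upd \<rho> vl 0 (\<rho> vL i)) vm 0 (\<rho> vL j))"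
          unfolding \<rho>'_def using True A \<rho>(1) j(3) adj by simp
        then have L: "\<rho>' vL x = (if \<rho> vL x = \<rho> vL j then \<rho> vL i else \<rho> vL x)" if "x \<in> ?A" for x
          using that els_bound(2) by (simp add: sem_relabel)
        have ij: "conn ?A i j" "conn ?A j i" using True E_sym by (auto intro: conn_step)
        have G: "\<And>x y. x \<in> ?A \<Longrightarrow> y \<in> ?A \<Longrightarrow> \<rho> vL x = \<rho> vL y \<Longrightarrow> conn ?A x y"
          "\<And>x y. x \<in> ?A \<Longrightarrow> y \<in> ?A \<Longrightarrow> E x y \<Longrightarrow> x < i \<or> x = i \<and> y < j \<Longrightarrow> \<rho> vL x = \<rho> vL y"
          using j(2) by blast+
        have "conn ?A x y" if xy: "x \<in> ?A" "y \<in> ?A" "\<rho>' vL x = \<rho>' vL y" for x y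
        proof -
          consider "\<rho> vL x = \<rho> vL y" | "\<rho> vL x = \<rho> vL j" "\<rho> vL i = \<rho> vL y"
            | "\<rho> vL y = \<rho> vL j" "\<rho> vL x = \<rho> vL i"
            using xy(3) unfolding L[OF xy(1)] L[OF xy(2)] by (auto split: if_splits)
          then show ?thesis
          proof cases
            case 1
            then show ?thesis by (rule G(1)[OF xy(1,2)])
          next
            case 2
            from conn_trans[OF G(1)[OF xy(1) _ 2(1)] conn_trans[OF ij(2) G(1)[OF _ xy(2) 2(2)]]]
            show ?thesis using True by blast
          next
            case 3
            from conn_trans[OF G(1)[OF xy(1) _ 3(2)] conn_trans[OF ij(1) G(1)[OF _ xy(2) 3(1)[symmetric]]]]
            show ?thesis using True by blast
          qed
        qed
        moreover have "\<rho>' vL x = \<rho>' vL y"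
          if xy: "x \<in> ?A" "y \<in> ?A" "E x y" "x < i \<or> x = i \<and> y < Suc j" for x y
        proof (cases "x = i \<and> y = j")
          case True
          then show ?thesis using L[OF xy(1)] L[OF xy(2)] by simp
        next
          case False
          then have "\<rho> vL x = \<rho> vL y" using xy by (intro G(2)) auto
          then show ?thesis using L[OF xy(1)] L[OF xy(2)] by simp
        qed
        ultimately show ?thesis unfolding \<rho>'_def[symmetric] by simp
      qed
    qed (simp_all)
    then show "?G (\<lambda>x y. x < Suc i) (upd (sem (Loop vv ?c3) inp \<tau>) vu 0 (Suc i))"
      using els_bound(2) by (auto simp: less_Suc_eq)
  qed simp
  then have G: "?G (\<lambda>x y. x < n) (sem labels inp \<sigma>)" unfolding labels_def \<sigma>1_def by simp
  assume xy: "x \<in> ?A" "y \<in> ?A"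
  show ?thesis
  proof
    assume "sem labels inp \<sigma> vL x = sem labels inp \<sigma> vL y"
    with G xy show "conn ?A x y" by blast
  next
    assume "conn ?A x y"
    then show "sem labels inp \<sigma> vL x = sem labels inp \<sigma> vL y"
      unfolding conn_def
    proof (induction rule: rtranclp_induct)
      case (step y z)
      then have "sem labels inp \<sigma> vL y = sem labels inp \<sigma> vL z" using G els_bound(2) by blast
      with step.IH show ?case by simp
    qed simp
  qed
qed

end

context program
begin

section \<open>The program simulates the elimination\<close>

definition cfg_of :: "arrs \<Rightarrow> cfg" where
  "cfg_of \<sigma> = Cfg (els \<sigma> vF) (els \<sigma> vO) (els \<sigma> vN) (els \<sigma> vH) (els \<sigma> vX)"

lemma cfg_of_cong: "\<tau> vF = \<sigma> vF \<Longrightarrow> \<tau> vO = \<sigma> vO \<Longrightarrow> \<tau> vN = \<sigma> vN \<Longrightarrow> \<tau> vH = \<sigma> vH \<Longrightarrow> \<tau> vX = \<sigma> vX \<Longrightarrow>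
    cfg_of \<tau> = cfg_of \<sigma>"
  by (simp add: cfg_of_def els_def)

lemma sem_digit:
  assumes "\<sigma> vcur 0 \<le> \<sigma> vM 0"
  shows "sem digit inp \<sigma> vr 0 = \<sigma> vcur 0 mod 3" "sem digit inp \<sigma> vcur 0 = \<sigma> vcur 0 div 3"
proof -
  let ?body = "Lt (Var vt) (Var vcur) (Lt (Var vr) (Cst 2) (Inc vr) (Sq (Asg vr (Cst 0)) (Inc vq))) Nop"
  let ?\<sigma> = "upd (upd \<sigma> vq 0 0) vr 0 0"
  \<comment> \<open>Once the counter has passed \<open>vcur\<close> nothing changes any more, hence
    the minimum.\<close>
  let ?I = "\<lambda>i (\<tau> :: arrs). \<tau> vcur 0 = \<sigma> vcur 0 \<and> \<tau> vr 0 = min i (\<sigma> vcur 0) mod 3 \<and> \<tau> vq 0 = min i (\<sigma> vcur 0) div 3"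
  have "?I (val (Var vM) inp ?\<sigma>) (sem (For vt (Var vM) ?body) inp ?\<sigma>)"
  proof (rule sem_For)
    fix i and \<tau> :: arrs assume i: "?I i \<tau>" "\<tau> vt 0 = i"
    then show "?I (Suc i) (upd (sem ?body inp \<tau>) vt 0 (Suc i))"
      by (cases "i < \<sigma> vcur 0") (auto simp: mod_Suc div_Suc)
  qed auto
  then have "?I (\<sigma> vM 0) (sem (For vt (Var vM) ?body) inp ?\<sigma>)" by simp
  with assms show "sem digit inp \<sigma> vr 0 = \<sigma> vcur 0 mod 3" "sem digit inp \<sigma> vcur 0 = \<sigma> vcur 0 div 3"
    by (simp_all add: digit_def)
qed

lemma sem_put:
  assumes "\<sigma> vsel 0 < n"
  shows "cfg_of (sem put inp \<sigma>) = place (\<sigma> vr 0) (\<sigma> va 0) (\<sigma> vsel 0) (cfg_of \<sigma>)"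
  using assms by (auto simp: put_def cfg_of_def els_upd els_upd_other)

lemma sem_digit_put:
  assumes "\<sigma> vsel 0 < n" "\<sigma> vcur 0 \<le> \<sigma> vM 0"
  shows "cfg_of (sem (Sq digit put) inp \<sigma>) = place (\<sigma> vcur 0 mod 3) (\<sigma> va 0) (\<sigma> vsel 0) (cfg_of \<sigma>)"
    "sem (Sq digit put) inp \<sigma> vcur 0 = \<sigma> vcur 0 div 3"
proof -
  have fr: "sem digit inp \<sigma> j = \<sigma> j" if "j \<notin> {vq, vr, vt, vcur}" for j
    using that by (intro sem_frame) simp
  have "cfg_of (sem digit inp \<sigma>) = cfg_of \<sigma>" by (intro cfg_of_cong fr) simp_all
  then show "cfg_of (sem (Sq digit put) inp \<sigma>) = place (\<sigma> vcur 0 mod 3) (\<sigma> va 0) (\<sigma> vsel 0) (cfg_of \<sigma>)"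
    using assms by (simp add: sem_put fr sem_digit)
  show "sem (Sq digit put) inp \<sigma> vcur 0 = \<sigma> vcur 0 div 3"
    using assms(2) by (simp add: sem_digit sem_frame)
qed

lemma sem_degree:
  assumes "rowed \<sigma>" "\<sigma> x 0 < n" "x \<noteq> vu" "x \<noteq> vcnt" "Y \<noteq> vu" "Y \<noteq> vcnt"
  shows "sem (degree x Y) inp \<sigma> vcnt 0 = card (nb (\<sigma> x 0) (els \<sigma> Y))"
proof -
  let ?body = "When (At Y vu) (When (adj x vu) (Inc vcnt))" and ?\<sigma> = "upd \<sigma> vcnt 0 0"
  have "sem (Loop vu ?body) inp ?\<sigma> vcnt 0 = ?\<sigma> vcnt 0 + card {u. u < n \<and> (u \<in> els \<sigma> Y \<and> E (\<sigma> x 0) u)}"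
  proof (rule sem_Loop_count)
    fix \<tau> :: arrs assume fr: "\<And>j. j \<noteq> vu \<Longrightarrow> j \<noteq> vcnt \<Longrightarrow> \<tau> j = ?\<sigma> j" and u: "\<tau> vu 0 < n"
    have "\<tau> vROW = \<sigma> vROW" "\<tau> x = \<sigma> x" "\<tau> Y = \<sigma> Y" using assms fr[of x] fr[of Y] fr[of vROW] by auto
    moreover have "inp (\<sigma> vROW (\<sigma> x 0) + \<tau> vu 0) = (if E (\<sigma> x 0) (\<tau> vu 0) then 1 else 0)"
      by (rule adj_val[OF assms(1,2) u])
    ultimately show "sem ?body inp \<tau> =
        (if \<tau> vu 0 \<in> els \<sigma> Y \<and> E (\<sigma> x 0) (\<tau> vu 0) then upd \<tau> vcnt 0 (Suc (\<tau> vcnt 0)) else \<tau>)"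
      using u by (auto simp: els_def)
  qed auto
  moreover have "{u. u < n \<and> (u \<in> els \<sigma> Y \<and> E (\<sigma> x 0) u)} = nb (\<sigma> x 0) (els \<sigma> Y)"
    by (auto simp: nb_def els_def)
  ultimately show ?thesis by (simp add: degree_def)
qed

text \<open>A later hit overwrites an earlier one, so the loop returns the greatest candidate, in
  accordance with the \<open>Max\<close> in \<open>step\<close>.\<close>

lemma sem_Loop_last:
  assumes x: "x \<notin> writes body" "x \<noteq> vsel" "x \<noteq> vfnd"
    and b: "\<And>\<tau>. (\<And>j. j \<noteq> x \<Longrightarrow> j \<notin> writes body \<Longrightarrow> \<tau> j = \<sigma> j) \<Longrightarrow> \<tau> x 0 < n \<Longrightarrow>
      sem body inp \<tau> vsel 0 = (if P (\<tau> x 0) then \<tau> x 0 else \<tau> vsel 0) \<and>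
      sem body inp \<tau> vfnd 0 = (if P (\<tau> x 0) then m else \<tau> vfnd 0)"
  shows "{v. v < n \<and> P v} = {} \<Longrightarrow> sem (Loop x body) inp \<sigma> vfnd 0 = \<sigma> vfnd 0"
    "{v. v < n \<and> P v} \<noteq> {} \<Longrightarrow> sem (Loop x body) inp \<sigma> vfnd 0 = m \<and>
      sem (Loop x body) inp \<sigma> vsel 0 = Max {v. v < n \<and> P v}"
proof -
  let ?I = "\<lambda>i (\<tau> :: arrs). ({v. v < i \<and> P v} = {} \<longrightarrow> \<tau> vfnd 0 = \<sigma> vfnd 0) \<and>
    ({v. v < i \<and> P v} \<noteq> {} \<longrightarrow> \<tau> vfnd 0 = m \<and> \<tau> vsel 0 = Max {v. v < i \<and> P v})"
  have "?I n (sem (Loop x body) inp \<sigma>)"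
  proof (rule sem_Loop[where I = ?I])
    fix i \<tau> assume i: "i < n" "?I i \<tau>" "\<tau> x 0 = i" "\<And>j. j \<noteq> x \<Longrightarrow> j \<notin> writes body \<Longrightarrow> \<tau> j = \<sigma> j"
    have b': "sem body inp \<tau> vsel 0 = (if P i then i else \<tau> vsel 0)"
      "sem body inp \<tau> vfnd 0 = (if P i then m else \<tau> vfnd 0)" using b[of \<tau>] i by auto
    have eq: "{v. v < Suc i \<and> P v} = (if P i then insert i {v. v < i \<and> P v} else {v. v < i \<and> P v})"
      by (auto simp: less_Suc_eq)
    show "?I (Suc i) (upd (sem body inp \<tau>) x 0 (Suc i))"
    proof (cases "P i")
      case True
      have "Max (insert i {v. v < i \<and> P v}) = i" by (rule Max_eqI) auto
      with True show ?thesis unfolding eq using b' x by simp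
    next
      case False
      with i(2) show ?thesis unfolding eq using b' x by simp
    qed
  qed (use x in auto)
  then show "{v. v < n \<and> P v} = {} \<Longrightarrow> sem (Loop x body) inp \<sigma> vfnd 0 = \<sigma> vfnd 0"
    "{v. v < n \<and> P v} \<noteq> {} \<Longrightarrow> sem (Loop x body) inp \<sigma> vfnd 0 = m \<and>
      sem (Loop x body) inp \<sigma> vsel 0 = Max {v. v < n \<and> P v}" by blast+
qed

lemma sem_find_leaf:
  assumes "rowed \<sigma>"
  shows "leaves (els \<sigma> vF) = {} \<Longrightarrow> sem find_leaf inp \<sigma> vfnd 0 = \<sigma> vfnd 0"
    "leaves (els \<sigma> vF) \<noteq> {} \<Longrightarrow> sem find_leaf inp \<sigma> vfnd 0 = 1 \<and>
      sem find_leaf inp \<sigma> vsel 0 = Max (leaves (els \<sigma> vF))"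
proof -
  let ?body = "When (At vF vv) (Sq (degree vv vF) (Lt (Var vcnt) (Cst 2) (Sq (Asg vsel (Var vv)) (Asg vfnd (Cst 1))) Nop))"
  have eq: "{v. v < n \<and> v \<in> leaves (els \<sigma> vF)} = leaves (els \<sigma> vF)" by (auto simp: leaves_def els_def)
  have b: "sem ?body inp \<tau> vsel 0 = (if \<tau> vv 0 \<in> leaves (els \<sigma> vF) then \<tau> vv 0 else \<tau> vsel 0) \<and>
      sem ?body inp \<tau> vfnd 0 = (if \<tau> vv 0 \<in> leaves (els \<sigma> vF) then 1 else \<tau> vfnd 0)"
    if fr: "\<And>j. j \<noteq> vv \<Longrightarrow> j \<notin> writes ?body \<Longrightarrow> \<tau> j = \<sigma> j" and v: "\<tau> vv 0 < n" for \<tau>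
  proof -
    have e: "els \<tau> vF = els \<sigma> vF" "rowed \<tau>"
    proof -
      have "\<tau> vF = \<sigma> vF" "\<tau> vROW = \<sigma> vROW" by (auto intro!: fr)
      then show "els \<tau> vF = els \<sigma> vF" "rowed \<tau>" by (simp add: els_def, simp add: rowed_cong[OF _ assms])
    qed
    have "sem (degree vv vF) inp \<tau> vcnt 0 = card (nb (\<tau> vv 0) (els \<sigma> vF))"
      using sem_degree[OF e(2) v] e(1) by simp
    moreover have "0 < \<tau> vF (\<tau> vv 0) \<longleftrightarrow> \<tau> vv 0 \<in> els \<sigma> vF" using v e(1) by (auto simp: els_def)
    ultimately show ?thesis by (auto simp: leaves_def sem_frame)
  qed
  note last = sem_Loop_last[where x = vv and body = ?body and P = "\<lambda>v. v \<in> leaves (els \<sigma> vF)" and m = 1 and \<sigma> = \<sigma>, unfolded eq]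
  show "leaves (els \<sigma> vF) = {} \<Longrightarrow> sem find_leaf inp \<sigma> vfnd 0 = \<sigma> vfnd 0"
    unfolding find_leaf_def by (rule last(1)) (use b in simp_all)
  show "leaves (els \<sigma> vF) \<noteq> {} \<Longrightarrow> sem find_leaf inp \<sigma> vfnd 0 = 1 \<and>
      sem find_leaf inp \<sigma> vsel 0 = Max (leaves (els \<sigma> vF))"
    unfolding find_leaf_def by (rule last(2)) (use b in simp_all)
qed

lemma sem_find_hub:
  shows "els \<sigma> vF \<inter> els \<sigma> vOH = {} \<Longrightarrow> sem find_hub inp \<sigma> vfnd 0 = \<sigma> vfnd 0"
    "els \<sigma> vF \<inter> els \<sigma> vOH \<noteq> {} \<Longrightarrow> sem find_hub inp \<sigma> vfnd 0 = 2 \<and>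
      sem find_hub inp \<sigma> vsel 0 = Max (els \<sigma> vF \<inter> els \<sigma> vOH)"
proof -
  let ?body = "When (At vF vv) (When (At vOH vv) (Sq (Asg vsel (Var vv)) (Asg vfnd (Cst 2))))"
  have eq: "{v. v < n \<and> v \<in> els \<sigma> vF \<inter> els \<sigma> vOH} = els \<sigma> vF \<inter> els \<sigma> vOH" by (auto simp: els_def)
  have b: "sem ?body inp \<tau> vsel 0 = (if \<tau> vv 0 \<in> els \<sigma> vF \<inter> els \<sigma> vOH then \<tau> vv 0 else \<tau> vsel 0) \<and>
      sem ?body inp \<tau> vfnd 0 = (if \<tau> vv 0 \<in> els \<sigma> vF \<inter> els \<sigma> vOH then 2 else \<tau> vfnd 0)"
    if fr: "\<And>j. j \<noteq> vv \<Longrightarrow> j \<notin> writes ?body \<Longrightarrow> \<tau> j = \<sigma> j" and v: "\<tau> vv 0 < n" for \<tau>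
    using fr[of vF] fr[of vOH] v by (auto simp: els_def)
  note last = sem_Loop_last[where x = vv and body = ?body and P = "\<lambda>v. v \<in> els \<sigma> vF \<inter> els \<sigma> vOH" and m = 2 and \<sigma> = \<sigma>, unfolded eq]
  show "els \<sigma> vF \<inter> els \<sigma> vOH = {} \<Longrightarrow> sem find_hub inp \<sigma> vfnd 0 = \<sigma> vfnd 0"
    unfolding find_hub_def by (rule last(1)) (use b in simp_all)
  show "els \<sigma> vF \<inter> els \<sigma> vOH \<noteq> {} \<Longrightarrow> sem find_hub inp \<sigma> vfnd 0 = 2 \<and>
      sem find_hub inp \<sigma> vsel 0 = Max (els \<sigma> vF \<inter> els \<sigma> vOH)"
    unfolding find_hub_def by (rule last(2)) (use b in simp_all)
qed

lemma sem_inspect: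
  assumes "rowed \<sigma>" "\<sigma> vsel 0 < n"
  shows "sem inspect inp \<sigma> va 0 = card (nb (\<sigma> vsel 0) (els \<sigma> vO))"
    "sem inspect inp \<sigma> vb 0 < 1 \<longleftrightarrow> nb (\<sigma> vsel 0) (els \<sigma> vA) = {}"
    "sem inspect inp \<sigma> vb 0 < 2 \<longleftrightarrow>
      (\<forall>x \<in> nb (\<sigma> vsel 0) (els \<sigma> vA). \<forall>y \<in> nb (\<sigma> vsel 0) (els \<sigma> vA). \<sigma> vL x = \<sigma> vL y)"
proof -
  let ?s = "\<sigma> vsel 0"
  let ?cb = "Lt (Var vb) (Cst 1) (Sq (Asg vb (Cst 1)) (Asg vl (At vL vu)))
        (Lt (Var vl) (At vL vu) (Asg vb (Cst 2)) (Lt (At vL vu) (Var vl) (Asg vb (Cst 2)) Nop))"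
  let ?body = "When (adj vsel vu) (Sq (When (At vO vu) (Inc va)) (When (At vA vu) ?cb))"
  let ?\<sigma> = "upd (upd \<sigma> va 0 0) vb 0 0"
  let ?NO = "\<lambda>i. {u \<in> nb ?s (els \<sigma> vO). u < i}"
  let ?NA = "\<lambda>i. {u \<in> nb ?s (els \<sigma> vA). u < i}"
  let ?I = "\<lambda>i (\<tau> :: arrs). \<tau> va 0 = card (?NO i) \<and>
    (\<tau> vb 0 = 0 \<and> ?NA i = {} \<or> \<tau> vb 0 = 1 \<and> ?NA i \<noteq> {} \<and> (\<forall>x \<in> ?NA i. \<sigma> vL x = \<tau> vl 0)
     \<or> \<tau> vb 0 = 2 \<and> (\<exists>x \<in> ?NA i. \<exists>y \<in> ?NA i. \<sigma> vL x \<noteq> \<sigma> vL y))"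
  have I: "?I n (sem (Loop vu ?body) inp ?\<sigma>)"
  proof (rule sem_Loop[where I = ?I])
    fix i and \<tau> :: arrs assume i: "i < n" "?I i \<tau>" "\<tau> vu 0 = i"
      and fr: "\<And>j. j \<noteq> vu \<Longrightarrow> j \<notin> writes ?body \<Longrightarrow> \<tau> j = ?\<sigma> j"
    have e: "\<tau> vROW = \<sigma> vROW" "\<tau> vsel = \<sigma> vsel" "\<tau> vO = \<sigma> vO" "\<tau> vA = \<sigma> vA" "\<tau> vL = \<sigma> vL"
      using fr[of vROW] fr[of vsel] fr[of vO] fr[of vA] fr[of vL] by simp_all
    have adj: "inp (\<sigma> vROW ?s + i) = (if E ?s i then 1 else 0)" by (rule adj_val[OF assms i(1)])
    have mO: "0 < \<sigma> vO i \<longleftrightarrow> i \<in> els \<sigma> vO" and mA: "0 < \<sigma> vA i \<longleftrightarrow> i \<in> els \<sigma> vA"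
      using i(1) by (auto simp: els_def)
    define \<tau>' where "\<tau>' = sem ?body inp \<tau>"
    have NO: "?NO (Suc i) = (if E ?s i \<and> i \<in> els \<sigma> vO then insert i (?NO i) else ?NO i)"
      and NA: "?NA (Suc i) = (if E ?s i \<and> i \<in> els \<sigma> vA then insert i (?NA i) else ?NA i)"
      by (auto simp: nb_def less_Suc_eq)
    have a: "\<tau>' va 0 = (if E ?s i \<and> i \<in> els \<sigma> vO then Suc (\<tau> va 0) else \<tau> va 0)"
      unfolding \<tau>'_def using adj mO e i(3) by (auto)
    have b: "\<tau>' vb 0 = (if E ?s i \<and> i \<in> els \<sigma> vA then (if \<tau> vb 0 = 0 then 1
        else if \<tau> vl 0 = \<sigma> vL i then \<tau> vb 0 else 2) else \<tau> vb 0)"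
      unfolding \<tau>'_def using adj mA e i(3) by (auto)
    have l: "\<tau>' vl 0 = (if E ?s i \<and> i \<in> els \<sigma> vA \<and> \<tau> vb 0 = 0 then \<sigma> vL i else \<tau> vl 0)"
      unfolding \<tau>'_def using adj mA e i(3) by (auto)
    note i2 = i(2)[THEN conjunct1] i(2)[THEN conjunct2]
    have "finite (?NO i)" "i \<notin> ?NO i" by simp_all
    then have "\<tau>' va 0 = card (?NO (Suc i))" unfolding NO a i2(1) by (simp only: card_insert_disjoint split: if_split) simp
    moreover have "\<tau>' vb 0 = 0 \<and> ?NA (Suc i) = {} \<or> \<tau>' vb 0 = 1 \<and> ?NA (Suc i) \<noteq> {} \<and> (\<forall>x \<in> ?NA (Suc i). \<sigma> vL x = \<tau>' vl 0)
     \<or> \<tau>' vb 0 = 2 \<and> (\<exists>x \<in> ?NA (Suc i). \<exists>y \<in> ?NA (Suc i). \<sigma> vL x \<noteq> \<sigma> vL y)"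
    proof (cases "E ?s i \<and> i \<in> els \<sigma> vA")
      case False
      then have "\<not> (E ?s i \<and> i \<in> els \<sigma> vA \<and> \<tau> vb 0 = 0)" by blast
      then have "?NA (Suc i) = ?NA i" "\<tau>' vb 0 = \<tau> vb 0" "\<tau>' vl 0 = \<tau> vl 0"
        unfolding NA b l using False by (simp_all only: if_False)
      then show ?thesis using i2(2) by (simp only:)
    next
      case True
      have NA': "?NA (Suc i) = insert i (?NA i)" using NA True by simp
      from i2(2) show ?thesis
      proof (elim disjE)
        assume 1: "\<tau> vb 0 = 0 \<and> ?NA i = {}"
        have "?NA (Suc i) = {i}" unfolding NA' 1[THEN conjunct2] ..
        moreover have "\<tau>' vb 0 = 1" "\<tau>' vl 0 = \<sigma> vL i" unfolding b l using 1 True by simp_all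
        ultimately show ?thesis by simp
      next
        assume 2: "\<tau> vb 0 = 1 \<and> ?NA i \<noteq> {} \<and> (\<forall>x \<in> ?NA i. \<sigma> vL x = \<tau> vl 0)"
        then obtain x where x: "x \<in> ?NA i" "\<sigma> vL x = \<tau> vl 0" by blast
        have l2: "\<tau>' vl 0 = \<tau> vl 0" unfolding l using 2 by simp
        show ?thesis
        proof (cases "\<tau> vl 0 = \<sigma> vL i")
          case eq: True
          then have "\<tau>' vb 0 = 1" unfolding b using 2 True by simp
          moreover have "\<forall>x \<in> ?NA (Suc i). \<sigma> vL x = \<tau>' vl 0" unfolding NA' l2 using 2 eq by simp
          moreover have "?NA (Suc i) \<noteq> {}" unfolding NA' by (rule insert_not_empty)
          ultimately show ?thesis by (intro disjI2 disjI1 conjI)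
        next
          case False
          then have "\<tau>' vb 0 = 2" unfolding b using 2 True by simp
          moreover have "\<sigma> vL x \<noteq> \<sigma> vL i" using x(2) False by simp
          then have "\<exists>x \<in> ?NA (Suc i). \<exists>y \<in> ?NA (Suc i). \<sigma> vL x \<noteq> \<sigma> vL y"
            unfolding NA' by (intro bexI[of _ x] bexI[of _ i]) (use x(1) in simp_all)
          ultimately show ?thesis by (intro disjI2 conjI)
        qed
      next
        assume 3: "\<tau> vb 0 = 2 \<and> (\<exists>x \<in> ?NA i. \<exists>y \<in> ?NA i. \<sigma> vL x \<noteq> \<sigma> vL y)"
        then have "\<tau>' vb 0 = 2" unfolding b by simp
        moreover obtain x y where xy: "x \<in> ?NA i" "y \<in> ?NA i" "\<sigma> vL x \<noteq> \<sigma> vL y" using 3 by blast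
        then have "\<exists>x \<in> ?NA (Suc i). \<exists>y \<in> ?NA (Suc i). \<sigma> vL x \<noteq> \<sigma> vL y"
          unfolding NA' by (intro bexI[of _ x] bexI[of _ y] insertI2)
        ultimately show ?thesis by (intro disjI2 conjI)
      qed
    qed
    ultimately show "?I (Suc i) (upd (sem ?body inp \<tau>) vu 0 (Suc i))"
      unfolding \<tau>'_def[symmetric] by simp
  qed simp_all
  note Ia = I[THEN conjunct1] and Ib = I[THEN conjunct2]
  have full: "?NO n = nb ?s (els \<sigma> vO)" "?NA n = nb ?s (els \<sigma> vA)" by (auto simp: nb_def els_def)
  have sem: "sem inspect inp \<sigma> = sem (Loop vu ?body) inp ?\<sigma>" by (simp add: inspect_def)
  show "sem inspect inp \<sigma> va 0 = card (nb ?s (els \<sigma> vO))" using Ia unfolding sem full .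
  let ?N = "nb ?s (els \<sigma> vA)"
  have Ib': "sem inspect inp \<sigma> vb 0 = 0 \<and> ?N = {} \<or>
    sem inspect inp \<sigma> vb 0 = 1 \<and> ?N \<noteq> {} \<and> (\<forall>x \<in> ?N. \<sigma> vL x = sem inspect inp \<sigma> vl 0) \<or>
    sem inspect inp \<sigma> vb 0 = 2 \<and> (\<exists>x \<in> ?N. \<exists>y \<in> ?N. \<sigma> vL x \<noteq> \<sigma> vL y)"
    using Ib unfolding sem full .
  from Ib' show "sem inspect inp \<sigma> vb 0 < 1 \<longleftrightarrow> ?N = {}"
  proof (elim disjE)
    assume "sem inspect inp \<sigma> vb 0 = 2 \<and> (\<exists>x \<in> ?N. \<exists>y \<in> ?N. \<sigma> vL x \<noteq> \<sigma> vL y)"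
    then show ?thesis by (metis empty_iff less_one zero_neq_numeral)
  qed simp_all
  from Ib' show "sem inspect inp \<sigma> vb 0 < 2 \<longleftrightarrow> (\<forall>x \<in> ?N. \<forall>y \<in> ?N. \<sigma> vL x = \<sigma> vL y)"
  proof (elim disjE)
    assume "sem inspect inp \<sigma> vb 0 = 2 \<and> (\<exists>x \<in> ?N. \<exists>y \<in> ?N. \<sigma> vL x \<noteq> \<sigma> vL y)"
    then show ?thesis by (metis less_irrefl)
  qed simp_all
qed

lemma sem_Loop_fill:
  assumes x: "x \<noteq> j" "j \<notin> reads e" and e: "\<And>\<tau> v. (\<And>j'. j' \<in> reads e \<Longrightarrow> j' \<noteq> x \<Longrightarrow> \<tau> j' = \<sigma> j') \<Longrightarrow> \<tau> x 0 = v \<Longrightarrow> v < n \<Longrightarrow>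
      val e inp \<tau> = f v" and v: "v < n"
  shows "sem (Loop x (PutAt j x e)) inp \<sigma> j v = f v"
proof -
  have "\<forall>v<n. sem (Loop x (PutAt j x e)) inp \<sigma> j v = f v"
  proof (rule sem_Loop[where I = "\<lambda>i \<tau>. \<forall>v<i. \<tau> j v = f v"])
    fix i \<tau> assume i: "i < n" "\<forall>v<i. \<tau> j v = f v" "\<tau> x 0 = i"
      and fr: "\<And>j'. j' \<noteq> x \<Longrightarrow> j' \<notin> writes (PutAt j x e) \<Longrightarrow> \<tau> j' = \<sigma> j'"
    have "val e inp \<tau> = f i" using x fr i by (intro e) auto
    then show "\<forall>v<Suc i. upd (sem (PutAt j x e) inp \<tau>) x 0 (Suc i) j v = f v"
      using i x by (auto simp: less_Suc_eq)
  qed (use x in auto)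
  with v show ?thesis by simp
qed

lemma sem_fill_sum:
  assumes "distinct [vv, vA, j1, j2, j3]"
  shows "els (sem (Loop vv (PutAt vA vv (Pl (At j1 vv) (Pl (At j2 vv) (At j3 vv))))) inp \<sigma>) vA = els \<sigma> j1 \<union> els \<sigma> j2 \<union> els \<sigma> j3"
proof -
  have "sem (Loop vv (PutAt vA vv (Pl (At j1 vv) (Pl (At j2 vv) (At j3 vv))))) inp \<sigma> vA v = \<sigma> j1 v + (\<sigma> j2 v + \<sigma> j3 v)"
    if "v < n" for v
    using assms that by (intro sem_Loop_fill) auto
  then show ?thesis by (auto simp: els_def)
qed

lemma sem_treat_leaf:
  assumes r: "rowed \<sigma>" and s: "\<sigma> vsel 0 < n" and c: "\<sigma> vcur 0 \<le> \<sigma> vM 0"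
    and st: "cfg_of \<sigma> = Cfg F O' N H X" and v: "\<sigma> vsel 0 = v"
  shows "(cfg_of (sem treat_leaf inp \<sigma>), sem treat_leaf inp \<sigma> vcur 0) =
     (let a = card (nb v O'); U = O' \<union> N \<union> H in
        if nb v U = {} then (Cfg (F - {v}) O' N H X, \<sigma> vcur 0)
        else if a \<le> 1 \<and> \<not> multi U v then (place 2 a v (Cfg F O' N H X), \<sigma> vcur 0)
        else (place (\<sigma> vcur 0 mod 3) a v (Cfg F O' N H X), \<sigma> vcur 0 div 3))"
proof -
  define \<sigma>1 where "\<sigma>1 = sem (Loop vv (PutAt vA vv (Pl (At vO vv) (Pl (At vN vv) (At vH vv))))) inp \<sigma>"
  define \<sigma>2 where "\<sigma>2 = sem labels inp \<sigma>1"
  define \<sigma>3 where "\<sigma>3 = sem inspect inp \<sigma>2"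
  let ?U = "O' \<union> N \<union> H" and ?a = "card (nb v O')"
  have sets: "els \<sigma> vF = F" "els \<sigma> vO = O'" "els \<sigma> vN = N" "els \<sigma> vH = H" "els \<sigma> vX = X"
    using st by (simp_all add: cfg_of_def)
  have fr1: "\<sigma>1 j = \<sigma> j" if "j \<notin> {vv, vA}" for j using that unfolding \<sigma>1_def by (intro sem_frame) auto
  have fr2: "\<sigma>2 j = \<sigma>1 j" if "j \<notin> {vL, vu, vv, vw, vl, vm}" for j using that unfolding \<sigma>2_def by (intro sem_frame) auto
  have fr3: "\<sigma>3 j = \<sigma>2 j" if "j \<notin> {va, vb, vu, vl}" for j using that unfolding \<sigma>3_def by (intro sem_frame) auto
  have A: "els \<sigma>1 vA = ?U" unfolding \<sigma>1_def by (subst sem_fill_sum) (simp_all add: sets)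
  have r1: "rowed \<sigma>1" and r2: "rowed \<sigma>2" using r by (auto intro!: rowed_cong[of _ \<sigma>] simp: fr1 fr2)
  have L: "\<sigma>2 vL x = \<sigma>2 vL y \<longleftrightarrow> conn ?U x y" if "x \<in> ?U" "y \<in> ?U" for x y
    using sem_labels[OF r1, of x y] that unfolding A \<sigma>2_def by simp
  have A2: "els \<sigma>2 vA = ?U" "els \<sigma>2 vO = O'" using A sets(2) by (auto simp: els_def fr1 fr2)
  have v2: "\<sigma>2 vsel 0 = v" using v by (simp add: fr1 fr2)
  note ins = sem_inspect[OF r2, unfolded v2 A2, folded \<sigma>3_def]
  have vn: "v < n" using s v by simp
  have a: "\<sigma>3 va 0 = ?a" and b1: "\<sigma>3 vb 0 < 1 \<longleftrightarrow> nb v ?U = {}" using ins(1,2)[OF vn] .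
  have "\<sigma>3 vb 0 < 2 \<longleftrightarrow> (\<forall>x \<in> nb v ?U. \<forall>y \<in> nb v ?U. \<sigma>2 vL x = \<sigma>2 vL y)" by (rule ins(3)[OF vn])
  also have "\<dots> \<longleftrightarrow> \<not> multi ?U v" unfolding multi_def using L by (auto simp: nb_def)
  finally have b2: "\<sigma>3 vb 0 < 2 \<longleftrightarrow> \<not> multi ?U v" .
  have c3: "cfg_of \<sigma>3 = Cfg F O' N H X"
    unfolding st[symmetric] by (intro cfg_of_cong) (simp_all add: fr1 fr2 fr3)
  have s3: "\<sigma>3 vsel 0 = v" "\<sigma>3 vcur 0 = \<sigma> vcur 0" "\<sigma>3 vM 0 = \<sigma> vM 0" using v by (simp_all add: fr1 fr2 fr3)
  let ?fin = "Lt (Var vb) (Cst 1) (PutAt vF vsel (Cst 0))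
      (Lt (Var va) (Cst 2) (Lt (Var vb) (Cst 2) (Sq (Asg vr (Cst 2)) put) (Sq digit put)) (Sq digit put))"
  have sem: "sem treat_leaf inp \<sigma> = sem ?fin inp \<sigma>3"
    unfolding treat_leaf_def \<sigma>3_def \<sigma>2_def \<sigma>1_def by (simp only: sem.simps)
  have dp: "cfg_of (sem (Sq digit put) inp \<sigma>3) = place (\<sigma> vcur 0 mod 3) ?a v (Cfg F O' N H X)"
    "sem (Sq digit put) inp \<sigma>3 vcur 0 = \<sigma> vcur 0 div 3"
    using sem_digit_put[of \<sigma>3] s3 vn c a c3 by simp_all
  consider "nb v ?U = {}" | "nb v ?U \<noteq> {}" "?a \<le> 1" "\<not> multi ?U v" | "nb v ?U \<noteq> {}" "?a \<ge> 2 \<or> multi ?U v"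
    by linarith
  then show ?thesis
  proof cases
    case 1
    then have e: "sem treat_leaf inp \<sigma> = upd \<sigma>3 vF v 0" unfolding sem using b1 s3 by simp
    have "cfg_of (upd \<sigma>3 vF v 0) = Cfg (F - {v}) O' N H X"
      using c3 vn by (simp add: cfg_of_def els_upd els_upd_other)
    then show ?thesis unfolding e using 1 s3 by (simp add: Let_def)
  next
    case 2
    then have "\<sigma>3 va 0 < 2" using a by simp
    then have e: "sem treat_leaf inp \<sigma> = sem put inp (upd \<sigma>3 vr 0 2)"
      unfolding sem using 2 b1 b2 by simp
    have "cfg_of (upd \<sigma>3 vr 0 2) = Cfg F O' N H X" unfolding c3[symmetric] by (intro cfg_of_cong) simp_all
    then have "cfg_of (sem put inp (upd \<sigma>3 vr 0 2)) = place 2 ?a v (Cfg F O' N H X)"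
      using sem_put[of "upd \<sigma>3 vr 0 2"] s3 vn a by simp
    moreover have "sem put inp (upd \<sigma>3 vr 0 2) vcur 0 = \<sigma> vcur 0" using s3 by (simp add: sem_frame)
    ultimately show ?thesis unfolding e using 2 by (simp add: Let_def del: place.simps)
  next
    case 3
    then have ng: "\<not> (?a \<le> 1 \<and> \<not> multi ?U v)" by auto
    have e: "sem treat_leaf inp \<sigma> = sem (Sq digit put) inp \<sigma>3"
    proof -
      have "\<not> (\<sigma>3 va 0 < 2 \<and> \<sigma>3 vb 0 < 2)" using ng a b2 by auto
      then show ?thesis unfolding sem using 3(1) b1 by auto
    qed
    show ?thesis unfolding e dp Let_def using 3(1) ng by (simp only: if_False)
  qed
qed

lemma sem_eliminate:
  assumes r: "rowed \<sigma>" and c: "\<sigma> vcur 0 \<le> \<sigma> vM 0"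
  shows "(cfg_of (sem eliminate inp \<sigma>), sem eliminate inp \<sigma> vcur 0) = step (els \<sigma> vOH) (cfg_of \<sigma>, \<sigma> vcur 0)"
proof -
  obtain F O' N H X where st: "cfg_of \<sigma> = Cfg F O' N H X" by (cases "cfg_of \<sigma>")
  then have F: "els \<sigma> vF = F" by (simp add: cfg_of_def)
  let ?oH = "els \<sigma> vOH"
  define \<sigma>1 where "\<sigma>1 = sem find_leaf inp (upd \<sigma> vfnd 0 0)"
  have fr1: "\<sigma>1 j = \<sigma> j" if "j \<notin> {vv, vcnt, vu, vsel, vfnd}" for j
    using that unfolding \<sigma>1_def by (simp add: sem_frame)
  have r0: "rowed (upd \<sigma> vfnd 0 0)" by (rule rowed_cong[OF _ r]) simp
  have F0: "els (upd \<sigma> vfnd 0 0) vF = F" using F by (simp add: els_upd_other)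
  have r1: "rowed \<sigma>1" by (rule rowed_cong[OF _ r]) (simp add: fr1)
  have st1: "cfg_of \<sigma>1 = Cfg F O' N H X" unfolding st[symmetric] by (intro cfg_of_cong) (simp_all add: fr1)
  have c1: "\<sigma>1 vcur 0 = \<sigma> vcur 0" "\<sigma>1 vM 0 = \<sigma> vM 0" by (simp_all add: fr1)
  have Fn: "F \<subseteq> {..<n}" "finite F" using F els_bound by blast+
  have sem: "sem eliminate inp \<sigma> = sem (Lt (Var vfnd) (Cst 1)
    (Sq find_hub (Lt (Cst 0) (Var vfnd) (Sq (Asg va (Cst 1)) (Sq digit put)) Nop)) treat_leaf) inp \<sigma>1"
    unfolding eliminate_def \<sigma>1_def by simp
  show ?thesis
  proof (cases "leaves F = {}")
    case False
    define v where "v = Max (leaves F)"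
    have fnd: "\<sigma>1 vfnd 0 = 1" "\<sigma>1 vsel 0 = v"
      using sem_find_leaf(2)[OF r0] False unfolding F0 \<sigma>1_def v_def by simp_all
    have "finite (leaves F)" using Fn(2) by (simp add: leaves_def)
    then have "v \<in> leaves F" unfolding v_def using False by (rule Max_in)
    then have vn: "v < n" using Fn(1) by (auto simp: leaves_def)
    have e: "sem eliminate inp \<sigma> = sem treat_leaf inp \<sigma>1" unfolding sem using fnd by simp
    have "(cfg_of (sem treat_leaf inp \<sigma>1), sem treat_leaf inp \<sigma>1 vcur 0) =
     (let a = card (nb v O'); U = O' \<union> N \<union> H in
        if nb v U = {} then (Cfg (F - {v}) O' N H X, \<sigma>1 vcur 0)
        else if a \<le> 1 \<and> \<not> multi U v then (place 2 a v (Cfg F O' N H X), \<sigma>1 vcur 0)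
        else (place (\<sigma>1 vcur 0 mod 3) a v (Cfg F O' N H X), \<sigma>1 vcur 0 div 3))"
      by (rule sem_treat_leaf[OF r1 _ _ st1 fnd(2)]) (use fnd vn c c1 in simp_all)
    then show ?thesis unfolding e st step.simps c1
      using False by (simp only: Let_def v_def[symmetric] if_True not_False_eq_True)
  next
    case True
    then have fnd: "\<sigma>1 vfnd 0 = 0" using sem_find_leaf(1)[OF r0] unfolding F0 \<sigma>1_def by simp
    define \<sigma>2 where "\<sigma>2 = sem find_hub inp \<sigma>1"
    have fr2: "\<sigma>2 j = \<sigma>1 j" if "j \<notin> {vv, vsel, vfnd}" for j
      using that unfolding \<sigma>2_def by (simp add: sem_frame)
    have e: "sem eliminate inp \<sigma> = sem (Lt (Cst 0) (Var vfnd) (Sq (Asg va (Cst 1)) (Sq digit put)) Nop) inp \<sigma>2"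
      unfolding sem \<sigma>2_def using fnd by simp
    have F1: "els \<sigma>1 vF = F" "els \<sigma>1 vOH = ?oH" using F by (auto simp: els_def fr1)
    have st2: "cfg_of \<sigma>2 = Cfg F O' N H X" unfolding st1[symmetric] by (intro cfg_of_cong) (simp_all add: fr2)
    show ?thesis
    proof (cases "F \<inter> ?oH = {}")
      case t: True
      then have "\<sigma>2 vfnd 0 = 0" using sem_find_hub(1)[of \<sigma>1] fnd unfolding F1 \<sigma>2_def by simp
      then have "sem eliminate inp \<sigma> = \<sigma>2" unfolding e by simp
      then show ?thesis using True t st st2 by (simp add: fr2 c1)
    next
      case f: False
      define v where "v = Max (F \<inter> ?oH)"
      have fnd2: "\<sigma>2 vfnd 0 = 2" "\<sigma>2 vsel 0 = v"
        using sem_find_hub(2)[of \<sigma>1] f unfolding F1 \<sigma>2_def v_def by simp_all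
      have "v \<in> F \<inter> ?oH" unfolding v_def using Fn(2) f by (intro Max_in) simp_all
      then have vn: "v < n" using Fn(1) by auto
      let ?\<sigma>3 = "upd \<sigma>2 va 0 1"
      have st3: "cfg_of ?\<sigma>3 = Cfg F O' N H X" unfolding st2[symmetric] by (intro cfg_of_cong) simp_all
      have e3: "sem eliminate inp \<sigma> = sem (Sq digit put) inp ?\<sigma>3" unfolding e using fnd2 by simp
      have "cfg_of (sem (Sq digit put) inp ?\<sigma>3) = place (\<sigma> vcur 0 mod 3) 1 v (Cfg F O' N H X)"
        "sem (Sq digit put) inp ?\<sigma>3 vcur 0 = \<sigma> vcur 0 div 3"
        using sem_digit_put[of ?\<sigma>3] vn fnd2 c c1 st3 by (simp_all add: fr2 del: sem.simps place.simps)
      then show ?thesis unfolding e3 st step.simps using True f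
        by (simp only: v_def if_False if_True simp_thms)
    qed
  qed
qed

end

context sgraph
begin

text \<open>Keeps the rest of the guess below \<open>vM\<close>, as \<open>sem_digit\<close>
  requires.\<close>

lemma snd_step_le: "snd (step oH (st, c)) \<le> c"
  by (cases st) (simp add: Let_def del: place.simps)

text \<open>Solvability is hereditary; hence failure on the first vertices settles the whole
  instance.\<close>

lemma sol_restrict:
  assumes "sol k d V X H" "V' \<subseteq> V" "finite V"
  shows "sol k d V' (X \<inter> V') (H \<inter> V')"
proof -
  have s: "X \<subseteq> V" "H \<subseteq> V - X" "card X \<le> k" "acyc (V - X - H)" "hb d (V - X) H"
    using assms(1) unfolding sol_def by blast+
  have "card (X \<inter> V') \<le> card X" using finite_subset[OF s(1) assms(3)] by (intro card_mono) auto
  moreover have "acyc (V' - X \<inter> V' - H \<inter> V')" by (rule acyc_subset[OF s(4)]) (use assms(2) in blast)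
  moreover have "hb d (V' - X \<inter> V') (H \<inter> V')" by (rule hb_mono[OF s(5)]) (use assms(2) in blast)+
  ultimately show ?thesis using s(2,3) unfolding sol_def by auto
qed

end

context program
begin

lemma sem_settling:
  assumes r: "rowed \<sigma>" and st: "cfg_of \<sigma> = Cfg F O' N H X"
  shows "cfg_of (sem settling inp \<sigma>) = settle (els \<sigma> vOX) (els \<sigma> vOH) (Cfg F O' N H X)"
proof -
  define \<sigma>1 where "\<sigma>1 = sem (Loop vv (PutAt vA vv (Pl (At vF vv) (Pl (At vO vv) (At vH vv))))) inp \<sigma>"
  define \<sigma>2 where "\<sigma>2 = sem labels inp \<sigma>1"
  let ?X0 = "els \<sigma> vOX" and ?oH = "els \<sigma> vOH" and ?A = "F \<union> O' \<union> H"
  define R where "R = {v. \<exists>w \<in> ?X0. w \<in> ?A \<and> conn ?A w v}"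
  have sets: "els \<sigma> vF = F" "els \<sigma> vO = O'" "els \<sigma> vN = N" "els \<sigma> vH = H" "els \<sigma> vX = X"
    using st by (simp_all add: cfg_of_def)
  have fr1: "\<sigma>1 j = \<sigma> j" if "j \<notin> {vv, vA}" for j using that unfolding \<sigma>1_def by (intro sem_frame) auto
  have fr2: "\<sigma>2 j = \<sigma>1 j" if "j \<notin> {vL, vu, vv, vw, vl, vm}" for j using that unfolding \<sigma>2_def by (intro sem_frame) auto
  have A: "els \<sigma>1 vA = ?A" unfolding \<sigma>1_def by (subst sem_fill_sum) (simp_all add: sets)
  have r1: "rowed \<sigma>1" by (rule rowed_cong[OF _ r]) (simp add: fr1)
  have L: "\<sigma>2 vL x = \<sigma>2 vL y \<longleftrightarrow> conn ?A x y" if "x \<in> ?A" "y \<in> ?A" for x y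
    using sem_labels[OF r1, of x y] that unfolding A \<sigma>2_def by simp
  have s2: "els \<sigma>2 vA = ?A" "els \<sigma>2 vOX = ?X0" "els \<sigma>2 vOH = ?oH" "els \<sigma>2 vF = F" "els \<sigma>2 vO = O'"
      "els \<sigma>2 vN = N" "els \<sigma>2 vH = H" "els \<sigma>2 vX = X"
    using A sets by (simp_all add: els_def fr1 fr2)
  let ?fb = "When (At vOX vu) (When (At vA vu)
           (Lt (At vL vu) (At vL vv) Nop (Lt (At vL vv) (At vL vu) Nop (Asg vcnt (Cst 1)))))"
  let ?flag = "Sq (Asg vcnt (Cst 0)) (Loop vu ?fb)"
  let ?body = "When (At vF vv) (Sq ?flag
      (Lt (Var vcnt) (Cst 1) (Sq (PutAt vF vv (Cst 0)) (Lt (Cst 0) (At vOH vv) (PutAt vH vv (Cst 1)) (PutAt vN vv (Cst 1)))) Nop))"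
  let ?I = "\<lambda>i \<tau>. els \<tau> vF = F - (F - R) \<inter> {..<i} \<and> els \<tau> vN = N \<union> (F - R - ?oH) \<inter> {..<i}
      \<and> els \<tau> vH = H \<union> ((F - R) \<inter> ?oH) \<inter> {..<i}"
  have "?I n (sem (Loop vv ?body) inp \<sigma>2)"
  proof (rule sem_Loop[where I = ?I])
    show "?I 0 (upd \<sigma>2 vv 0 0)" using s2 by (simp add: els_upd_other)
    fix i and \<tau> :: arrs assume i: "i < n" "?I i \<tau>" "\<tau> vv 0 = i"
      and fr: "\<And>j. j \<noteq> vv \<Longrightarrow> j \<notin> writes ?body \<Longrightarrow> \<tau> j = \<sigma>2 j"
    have e: "\<tau> vOX = \<sigma>2 vOX" "\<tau> vOH = \<sigma>2 vOH" "\<tau> vA = \<sigma>2 vA" "\<tau> vL = \<sigma>2 vL" by (auto intro!: fr)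
    have iF: "0 < \<tau> vF i \<longleftrightarrow> i \<in> F"
    proof -
      have "0 < \<tau> vF i \<longleftrightarrow> i \<in> els \<tau> vF" using i(1) by (simp add: els_def)
      then show ?thesis using i(2) by simp
    qed
    have ioH: "0 < \<tau> vOH i \<longleftrightarrow> i \<in> ?oH" using i(1) e(2) s2(3) by (auto simp: els_def)
    have S: "{..<Suc i} = insert i {..<i}" by (simp add: lessThan_Suc)
    show "?I (Suc i) (upd (sem ?body inp \<tau>) vv 0 (Suc i))"
    proof (cases "i \<in> F")
      case False
      then have "sem ?body inp \<tau> = \<tau>" using iF i(3) by simp
      moreover have "(F - R) \<inter> {..<Suc i} = (F - R) \<inter> {..<i}" "(F - R - ?oH) \<inter> {..<Suc i} = (F - R - ?oH) \<inter> {..<i}"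
        "((F - R) \<inter> ?oH) \<inter> {..<Suc i} = ((F - R) \<inter> ?oH) \<inter> {..<i}" using False unfolding S by blast+
      ultimately show ?thesis using i(2) by (simp only: els_upd_other)
    next
      case True
      let ?\<tau>0 = "upd \<tau> vcnt 0 0"
      define \<tau>1 where "\<tau>1 = sem ?flag inp \<tau>"
      have fr3: "\<tau>1 j = \<tau> j" if "j \<notin> {vcnt, vu}" for j using that unfolding \<tau>1_def by (intro sem_frame) auto
      have "sem (Loop vu ?fb) inp ?\<tau>0 vcnt 0 =
          (if \<exists>u<n. u \<in> ?X0 \<and> u \<in> ?A \<and> \<sigma>2 vL u = \<sigma>2 vL i then 1 else ?\<tau>0 vcnt 0)"
      proof (rule sem_Loop_flag)
        fix \<rho> :: arrs assume f: "\<And>j. j \<noteq> vu \<Longrightarrow> j \<noteq> vcnt \<Longrightarrow> \<rho> j = ?\<tau>0 j" and u: "\<rho> vu 0 < n"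
        have "\<rho> vOX = \<sigma>2 vOX" "\<rho> vA = \<sigma>2 vA" "\<rho> vL = \<sigma>2 vL" "\<rho> vv 0 = i"
          using f[of vOX] f[of vA] f[of vL] f[of vv] e i(3) by simp_all
        moreover have "0 < \<sigma>2 vOX (\<rho> vu 0) \<longleftrightarrow> \<rho> vu 0 \<in> ?X0" "0 < \<sigma>2 vA (\<rho> vu 0) \<longleftrightarrow> \<rho> vu 0 \<in> ?A"
          using u s2(1,2) by (auto simp: els_def)
        ultimately show "sem ?fb inp \<rho> = (if \<rho> vu 0 \<in> ?X0 \<and> \<rho> vu 0 \<in> ?A \<and> \<sigma>2 vL (\<rho> vu 0) = \<sigma>2 vL i then upd \<rho> vcnt 0 1 else \<rho>)"
          by (simp del: Un_iff)
      qed auto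
      moreover have "(\<exists>u<n. u \<in> ?X0 \<and> u \<in> ?A \<and> \<sigma>2 vL u = \<sigma>2 vL i) \<longleftrightarrow> i \<in> R"
      proof -
        have iA: "i \<in> ?A" using True by blast
        have "(\<exists>u<n. u \<in> ?X0 \<and> u \<in> ?A \<and> \<sigma>2 vL u = \<sigma>2 vL i) \<longleftrightarrow> (\<exists>u \<in> ?X0. u \<in> ?A \<and> \<sigma>2 vL u = \<sigma>2 vL i)"
          using els_bound(2)[of _ \<sigma> vOX] by blast
        also have "\<dots> \<longleftrightarrow> (\<exists>u \<in> ?X0. u \<in> ?A \<and> conn ?A u i)" using L[OF _ iA] by blast
        finally show ?thesis unfolding R_def by blast
      qed
      ultimately have cnt: "\<tau>1 vcnt 0 = (if i \<in> R then 1 else 0)" by (simp add: \<tau>1_def)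
      have semb: "sem ?body inp \<tau> = (if i \<in> R then \<tau>1 else if i \<in> ?oH then upd (upd \<tau>1 vF i 0) vH i 1
          else upd (upd \<tau>1 vF i 0) vN i 1)"
      proof -
        have "sem ?body inp \<tau> = sem (Lt (Var vcnt) (Cst 1) (Sq (PutAt vF vv (Cst 0)) (Lt (Cst 0) (At vOH vv) (PutAt vH vv (Cst 1)) (PutAt vN vv (Cst 1)))) Nop) inp \<tau>1"
          using True iF i(3) by (simp add: \<tau>1_def)
        also have "\<dots> = (if i \<in> R then \<tau>1 else if i \<in> ?oH then upd (upd \<tau>1 vF i 0) vH i 1
          else upd (upd \<tau>1 vF i 0) vN i 1)"
          using cnt ioH i(3) by (simp add: fr3)
        finally show ?thesis .
      qed
      have e3: "els \<tau>1 vF = els \<tau> vF" "els \<tau>1 vN = els \<tau> vN" "els \<tau>1 vH = els \<tau> vH" by (simp_all add: els_def fr3)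
      show ?thesis unfolding semb using i(1,2) True by (auto simp: els_upd els_upd_other e3 S)
    qed
  qed simp
  moreover have "F - (F - R) \<inter> {..<n} = F \<inter> R" "(F - R - ?oH) \<inter> {..<n} = F - R - ?oH"
    "((F - R) \<inter> ?oH) \<inter> {..<n} = (F - R) \<inter> ?oH"
    using els_bound(1)[of \<sigma> vF] unfolding sets by blast+
  ultimately have fin: "els (sem (Loop vv ?body) inp \<sigma>2) vF = F \<inter> R" "els (sem (Loop vv ?body) inp \<sigma>2) vN = N \<union> (F - R - ?oH)"
    "els (sem (Loop vv ?body) inp \<sigma>2) vH = H \<union> ((F - R) \<inter> ?oH)" by simp_all
  have "sem (Loop vv ?body) inp \<sigma>2 vO = \<sigma>2 vO" "sem (Loop vv ?body) inp \<sigma>2 vX = \<sigma>2 vX"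
    by (rule sem_frame, simp)+
  then have "els (sem (Loop vv ?body) inp \<sigma>2) vO = O'" "els (sem (Loop vv ?body) inp \<sigma>2) vX = X"
    using s2(5,8) by (simp_all add: els_def)
  moreover have "sem settling inp \<sigma> = sem (Loop vv ?body) inp \<sigma>2"
    unfolding settling_def \<sigma>1_def \<sigma>2_def by (simp only: sem.simps)
  ultimately show ?thesis using fin unfolding cfg_of_def settle.simps Let_def R_def by simp
qed

lemma sem_clear: "cfg_of (sem clear inp \<sigma>) = Cfg {} {} {} {} {}"
proof -
  let ?I = "\<lambda>i (\<tau> :: arrs). \<forall>v<i. \<tau> vF v = 0 \<and> \<tau> vO v = 0 \<and> \<tau> vN v = 0 \<and> \<tau> vH v = 0 \<and> \<tau> vX v = 0"
  have "?I n (sem clear inp \<sigma>)"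
    unfolding clear_def by (rule sem_Loop[where I = ?I]) (auto simp: less_Suc_eq)
  then show ?thesis by (auto simp: cfg_of_def els_def)
qed

lemma sem_distribute:
  assumes c: "\<sigma> vcur 0 \<le> \<sigma> vM 0" and st: "cfg_of \<sigma> = Cfg {} {} {} {} {}" and m: "\<sigma> vi 0 < n"
  shows "(cfg_of (sem distribute inp \<sigma>), sem distribute inp \<sigma> vcur 0) = ini (els \<sigma> vOX) (Suc (\<sigma> vi 0)) (\<sigma> vcur 0)
    \<and> sem distribute inp \<sigma> vcur 0 \<le> \<sigma> vM 0"
proof -
  let ?m = "Suc (\<sigma> vi 0)" and ?X0 = "els \<sigma> vOX"
  let ?body = "Lt (Var vv) (Pl (Var vi) (Cst 1))
    (Lt (Cst 0) (At vOX vv) (Sq (Asg vsel (Var vv)) (Sq (Asg va (Cst 1)) (Sq digit put))) (PutAt vF vv (Cst 1))) Nop"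
  let ?I = "\<lambda>i \<tau>. (cfg_of \<tau>, \<tau> vcur 0) = ini ?X0 (min i ?m) (\<sigma> vcur 0) \<and> \<tau> vcur 0 \<le> \<sigma> vM 0"
  have "?I n (sem distribute inp \<sigma>)"
    unfolding distribute_def
  proof (rule sem_Loop[where I = ?I])
    have "cfg_of (upd \<sigma> vv 0 0) = cfg_of \<sigma>" by (intro cfg_of_cong) simp_all
    then show "?I 0 (upd \<sigma> vv 0 0)" using st c by simp
    fix i and \<tau> :: arrs assume i: "i < n" "?I i \<tau>" "\<tau> vv 0 = i"
      and fr: "\<And>j. j \<noteq> vv \<Longrightarrow> j \<notin> writes ?body \<Longrightarrow> \<tau> j = \<sigma> j"
    have e: "\<tau> vi = \<sigma> vi" "\<tau> vOX = \<sigma> vOX" "\<tau> vM = \<sigma> vM" by (auto intro!: fr)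
    define \<tau>' where "\<tau>' = sem ?body inp \<tau>"
    have g: "?I (Suc i) \<tau>'"
    proof (cases "i < ?m")
      case False
      then have "\<tau>' = \<tau>" "min (Suc i) ?m = min i ?m" unfolding \<tau>'_def using i(3) e by auto
      then show ?thesis using i(2) by (simp only:)
    next
      case True
      then have mi: "min i ?m = i" "min (Suc i) ?m = Suc i" by auto
      obtain F O' N H X where st': "cfg_of \<tau> = Cfg F O' N H X" by (cases "cfg_of \<tau>")
      have old: "ini ?X0 i (\<sigma> vcur 0) = (Cfg F O' N H X, \<tau> vcur 0)" "\<tau> vcur 0 \<le> \<sigma> vM 0"
        using i(2) unfolding mi st' by simp_all
      have mem: "0 < \<tau> vOX i \<longleftrightarrow> i \<in> ?X0" using i(1) e by (auto simp: els_def)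
      show ?thesis
      proof (cases "i \<in> ?X0")
        case X: True
        let ?\<tau>2 = "upd (upd \<tau> vsel 0 i) va 0 1"
        have st2: "cfg_of ?\<tau>2 = Cfg F O' N H X" unfolding st'[symmetric] by (intro cfg_of_cong) simp_all
        have "\<tau>' = sem (Sq digit put) inp ?\<tau>2" unfolding \<tau>'_def using True X mem i(3) e by simp
        moreover have "cfg_of (sem (Sq digit put) inp ?\<tau>2) = place (\<tau> vcur 0 mod 3) 1 i (Cfg F O' N H X)"
          "sem (Sq digit put) inp ?\<tau>2 vcur 0 = \<tau> vcur 0 div 3"
          using sem_digit_put[of ?\<tau>2] i(1) old(2) e(3) st2 by (simp_all del: sem.simps place.simps)
        ultimately have "(cfg_of \<tau>', \<tau>' vcur 0) = ini ?X0 (Suc i) (\<sigma> vcur 0)" "\<tau>' vcur 0 \<le> \<sigma> vM 0"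
          using X old by (simp_all del: place.simps sem.simps)
        then show ?thesis unfolding mi by simp
      next
        case X: False
        then have "\<tau>' = upd \<tau> vF i 1" unfolding \<tau>'_def using True mem i(3) e by simp
        moreover have "cfg_of (upd \<tau> vF i 1) = Cfg (insert i F) O' N H X"
          using st' i(1) by (simp add: cfg_of_def els_upd els_upd_other)
        ultimately show ?thesis unfolding mi using X old by simp
      qed
    qed
    have "cfg_of (upd \<tau>' vv 0 (Suc i)) = cfg_of \<tau>'" by (intro cfg_of_cong) simp_all
    then show "?I (Suc i) (upd (sem ?body inp \<tau>) vv 0 (Suc i))" using g unfolding \<tau>'_def[symmetric] by simp
  qed simp
  moreover have "min n ?m = ?m" using m by simp
  ultimately show ?thesis by (simp only:)
qed

lemma sem_eliminate_steps:
  assumes r: "rowed \<sigma>" and c: "\<sigma> vcur 0 \<le> \<sigma> vM 0"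
  shows "cfg_of (sem (Loop vstep eliminate) inp \<sigma>) = fst ((step (els \<sigma> vOH) ^^ n) (cfg_of \<sigma>, \<sigma> vcur 0))"
proof -
  let ?I = "\<lambda>i \<tau>. (cfg_of \<tau>, \<tau> vcur 0) = (step (els \<sigma> vOH) ^^ i) (cfg_of \<sigma>, \<sigma> vcur 0) \<and> \<tau> vcur 0 \<le> \<sigma> vM 0"
  have "?I n (sem (Loop vstep eliminate) inp \<sigma>)"
  proof (rule sem_Loop[where I = ?I])
    have "cfg_of (upd \<sigma> vstep 0 0) = cfg_of \<sigma>" by (intro cfg_of_cong) simp_all
    then show "?I 0 (upd \<sigma> vstep 0 0)" using c by simp
    fix i and \<tau> :: arrs assume i: "i < n" "?I i \<tau>" "\<tau> vstep 0 = i"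
      and fr: "\<And>j. j \<noteq> vstep \<Longrightarrow> j \<notin> writes eliminate \<Longrightarrow> \<tau> j = \<sigma> j"
    have e: "\<tau> vROW = \<sigma> vROW" "\<tau> vOH = \<sigma> vOH" "\<tau> vM = \<sigma> vM" by (auto intro!: fr)
    define \<tau>' where "\<tau>' = sem eliminate inp \<tau>"
    have "(cfg_of \<tau>', \<tau>' vcur 0) = step (els \<tau> vOH) (cfg_of \<tau>, \<tau> vcur 0)"
      unfolding \<tau>'_def by (rule sem_eliminate) (use i(2) e in \<open>auto intro: rowed_cong[OF _ r]\<close>)
    moreover have "els \<tau> vOH = els \<sigma> vOH" using e(2) by (simp add: els_def)
    ultimately have s: "(cfg_of \<tau>', \<tau>' vcur 0) = step (els \<sigma> vOH) (cfg_of \<tau>, \<tau> vcur 0)" by simp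
    then have "\<tau>' vcur 0 \<le> \<tau> vcur 0" using snd_step_le[of "els \<sigma> vOH" "cfg_of \<tau>" "\<tau> vcur 0"] by (metis snd_conv)
    moreover have "cfg_of (upd \<tau>' vstep 0 (Suc i)) = cfg_of \<tau>'" by (intro cfg_of_cong) simp_all
    ultimately show "?I (Suc i) (upd (sem eliminate inp \<tau>) vstep 0 (Suc i))"
      using i(2) s unfolding \<tau>'_def[symmetric] by (simp del: step.simps)
  qed simp
  then show ?thesis by (metis fst_conv)
qed

lemma sem_guess_run:
  assumes r: "rowed \<sigma>" and g: "\<sigma> vg 0 \<le> \<sigma> vM 0" and m: "\<sigma> vi 0 < n"
  shows "cfg_of (sem guess_run inp \<sigma>) = attempt (els \<sigma> vOX) (els \<sigma> vOH) (Suc (\<sigma> vi 0)) (\<sigma> vg 0)"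
proof -
  define \<sigma>1 where "\<sigma>1 = sem clear inp (upd \<sigma> vcur 0 (\<sigma> vg 0))"
  define \<sigma>2 where "\<sigma>2 = sem distribute inp \<sigma>1"
  define \<sigma>3 where "\<sigma>3 = sem settling inp \<sigma>2"
  have fr1: "\<sigma>1 j = \<sigma> j" if "j \<notin> {vv, vF, vO, vN, vH, vX, vcur}" for j
    using that unfolding \<sigma>1_def by (simp add: sem_frame)
  have cur1: "\<sigma>1 vcur 0 = \<sigma> vg 0" unfolding \<sigma>1_def by (simp add: sem_frame)
  have fr2: "\<sigma>2 j = \<sigma>1 j" if "j \<notin> {vv, vsel, va, vF, vX, vH, vN, vO, vq, vr, vt, vcur}" for j
    using that unfolding \<sigma>2_def by (intro sem_frame) simp
  have fr3: "\<sigma>3 j = \<sigma>2 j" if "j \<notin> {vA, vL, vu, vv, vw, vl, vm, vcnt, vF, vH, vN}" for j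
    using that unfolding \<sigma>3_def by (intro sem_frame) simp
  have els1: "els \<sigma>1 vOX = els \<sigma> vOX" "els \<sigma>2 vOX = els \<sigma> vOX" "els \<sigma>2 vOH = els \<sigma> vOH" "els \<sigma>3 vOH = els \<sigma> vOH"
    by (simp_all add: els_def fr1 fr2 fr3)
  have "cfg_of \<sigma>1 = Cfg {} {} {} {} {}" unfolding \<sigma>1_def by (rule sem_clear)
  from sem_distribute[OF _ this] have d: "(cfg_of \<sigma>2, \<sigma>2 vcur 0) = ini (els \<sigma> vOX) (Suc (\<sigma> vi 0)) (\<sigma> vg 0)"
      "\<sigma>2 vcur 0 \<le> \<sigma> vM 0"
    using g m by (simp_all add: cur1 fr1 els1 \<sigma>2_def[symmetric] del: ini.simps One_nat_def)
  have r2: "rowed \<sigma>2" and r3: "rowed \<sigma>3" by (rule rowed_cong[OF _ r], simp add: fr1 fr2 fr3)+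
  have s: "cfg_of \<sigma>3 = settle (els \<sigma> vOX) (els \<sigma> vOH) (cfg_of \<sigma>2)"
    using sem_settling[OF r2] unfolding \<sigma>3_def[symmetric] els1 by (cases "cfg_of \<sigma>2") simp
  have sem: "sem guess_run inp \<sigma> = sem (Loop vstep eliminate) inp \<sigma>3"
    unfolding guess_run_def \<sigma>3_def \<sigma>2_def \<sigma>1_def by simp
  have "cfg_of (sem guess_run inp \<sigma>) = fst ((step (els \<sigma> vOH) ^^ n) (cfg_of \<sigma>3, \<sigma>2 vcur 0))"
    unfolding sem using sem_eliminate_steps[OF r3] d(2) by (simp add: fr1 fr2 fr3 els1)
  also have "\<dots> = attempt (els \<sigma> vOX) (els \<sigma> vOH) (Suc (\<sigma> vi 0)) (\<sigma> vg 0)"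
    unfolding attempt_def d(1)[symmetric] s by simp
  finally show ?thesis .
qed

section \<open>Verification of a candidate solution\<close>

lemma sem_active:
  defines "V \<equiv> \<lambda>\<sigma> :: arrs. {..<Suc (\<sigma> vi 0)}"
  assumes m: "\<sigma> vi 0 < n"
  shows "els (sem active inp \<sigma>) vA = V \<sigma> - els \<sigma> vX" "els (sem active inp \<sigma>) vZ = V \<sigma> - els \<sigma> vX - els \<sigma> vH"
proof -
  let ?body = "Sq (PutAt vA vv (Cst 0)) (Sq (PutAt vZ vv (Cst 0)) (Lt (Var vv) (Pl (Var vi) (Cst 1))
    (Lt (Cst 0) (At vX vv) Nop (Sq (PutAt vA vv (Cst 1)) (Lt (Cst 0) (At vH vv) Nop (PutAt vZ vv (Cst 1))))) Nop))"
  let ?I = "\<lambda>i (\<tau> :: arrs). \<forall>v<i. (0 < \<tau> vA v \<longleftrightarrow> v \<in> V \<sigma> - els \<sigma> vX) \<and> (0 < \<tau> vZ v \<longleftrightarrow> v \<in> V \<sigma> - els \<sigma> vX - els \<sigma> vH)"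
  have "?I n (sem active inp \<sigma>)"
    unfolding active_def
  proof (rule sem_Loop[where I = ?I])
    fix i and \<tau> :: arrs assume i: "i < n" "?I i \<tau>" "\<tau> vv 0 = i"
      and fr: "\<And>j. j \<noteq> vv \<Longrightarrow> j \<notin> writes ?body \<Longrightarrow> \<tau> j = \<sigma> j"
    have e: "\<tau> vi = \<sigma> vi" "\<tau> vX = \<sigma> vX" "\<tau> vH = \<sigma> vH" by (auto intro!: fr)
    have mem: "i \<in> els \<sigma> vX \<longleftrightarrow> 0 < \<sigma> vX i" "i \<in> els \<sigma> vH \<longleftrightarrow> 0 < \<sigma> vH i" using i(1) by (auto simp: els_def)
    show "?I (Suc i) (upd (sem ?body inp \<tau>) vv 0 (Suc i))"
      using i e mem by (auto simp: less_Suc_eq V_def)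
  qed auto
  moreover have "V \<sigma> \<subseteq> {..<n}" using m by (auto simp: V_def)
  ultimately show "els (sem active inp \<sigma>) vA = V \<sigma> - els \<sigma> vX" "els (sem active inp \<sigma>) vZ = V \<sigma> - els \<sigma> vX - els \<sigma> vH"
    by (auto simp: els_def)
qed

lemma sem_count_deleted: "sem count_deleted inp \<sigma> vcnt 0 = card (els \<sigma> vX \<inter> {..<Suc (\<sigma> vi 0)})"
proof -
  let ?body = "Lt (Var vu) (Pl (Var vi) (Cst 1)) (When (At vX vu) (Inc vcnt)) Nop" and ?\<sigma> = "upd \<sigma> vcnt 0 0"
  have "sem (Loop vu ?body) inp ?\<sigma> vcnt 0 = ?\<sigma> vcnt 0 + card {u. u < n \<and> u \<in> els \<sigma> vX \<inter> {..<Suc (\<sigma> vi 0)}}"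
  proof (rule sem_Loop_count)
    fix \<tau> :: arrs assume fr: "\<And>j. j \<noteq> vu \<Longrightarrow> j \<noteq> vcnt \<Longrightarrow> \<tau> j = ?\<sigma> j" and u: "\<tau> vu 0 < n"
    have "\<tau> vi = \<sigma> vi" "\<tau> vX = \<sigma> vX" using fr[of vi] fr[of vX] by simp_all
    then show "sem ?body inp \<tau> = (if \<tau> vu 0 \<in> els \<sigma> vX \<inter> {..<Suc (\<sigma> vi 0)} then upd \<tau> vcnt 0 (Suc (\<tau> vcnt 0)) else \<tau>)"
      using u by (auto simp: els_def)
  qed auto
  moreover have "{u. u < n \<and> u \<in> els \<sigma> vX \<inter> {..<Suc (\<sigma> vi 0)}} = els \<sigma> vX \<inter> {..<Suc (\<sigma> vi 0)}"
    using els_bound(2) by auto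
  ultimately show ?thesis by (simp add: count_deleted_def)
qed

text \<open>Removing a vertex with at most one remaining neighbour changes acyclicity in neither
  direction. Degrees only drop during a pass, so whatever was a leaf at its start is gone at its
  end.\<close>

lemma sem_peel_pass:
  defines "c \<equiv> When (At vZ vv) (Sq (degree vv vZ) (Lt (Var vcnt) (Cst 2) (PutAt vZ vv (Cst 0)) Nop))"
  assumes r: "rowed \<sigma>"
  shows "els (sem (Loop vv c) inp \<sigma>) vZ \<subseteq> els \<sigma> vZ - leaves (els \<sigma> vZ)"
    "acyc (els (sem (Loop vv c) inp \<sigma>) vZ) \<longleftrightarrow> acyc (els \<sigma> vZ)"
proof -
  let ?Z = "els \<sigma> vZ"
  let ?I = "\<lambda>i \<tau>. els \<tau> vZ \<subseteq> ?Z - (leaves ?Z \<inter> {..<i}) \<and> (acyc (els \<tau> vZ) \<longleftrightarrow> acyc ?Z)"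
  have "?I n (sem (Loop vv c) inp \<sigma>)"
  proof (rule sem_Loop[where I = ?I])
    show "vv \<notin> writes c" by (simp add: c_def)
    show "?I 0 (upd \<sigma> vv 0 0)" by (simp add: els_upd_other)
    fix i and \<tau> :: arrs assume i: "i < n" "?I i \<tau>" "\<tau> vv 0 = i"
      and fr: "\<And>j. j \<noteq> vv \<Longrightarrow> j \<notin> writes c \<Longrightarrow> \<tau> j = \<sigma> j"
    have "\<tau> vROW = \<sigma> vROW" by (rule fr) (simp_all add: c_def)
    then have r': "rowed \<tau>" by (rule rowed_cong[OF _ r])
    define T where "T = els \<tau> vZ"
    define \<tau>1 where "\<tau>1 = sem (degree vv vZ) inp \<tau>"
    have fr1: "\<tau>1 j = \<tau> j" if "j \<notin> {vcnt, vu}" for j using that unfolding \<tau>1_def by (intro sem_frame) simp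
    have cnt: "\<tau>1 vcnt 0 = card (nb i T)"
      using sem_degree[OF r', of vv vZ] i(1,3) unfolding \<tau>1_def T_def by simp
    have mem: "0 < \<tau> vZ i \<longleftrightarrow> i \<in> T" using i(1) by (auto simp: T_def els_def)
    have semc: "sem c inp \<tau> = (if i \<in> T then if card (nb i T) \<le> 1 then upd \<tau>1 vZ i 0 else \<tau>1 else \<tau>)"
    proof -
      have "sem c inp \<tau> = (if i \<in> T then sem (Lt (Var vcnt) (Cst 2) (PutAt vZ vv (Cst 0)) Nop) inp \<tau>1 else \<tau>)"
        using mem i(3) by (simp add: c_def \<tau>1_def)
      then show ?thesis using cnt i(3) by (auto simp: fr1)
    qed
    have T1: "els \<tau>1 vZ = T" by (simp add: T_def els_def fr1)
    have eT: "els (sem c inp \<tau>) vZ = (if i \<in> T \<and> card (nb i T) \<le> 1 then T - {i} else T)"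
      unfolding semc using i(1) T1 by (auto simp: els_upd T_def)
    have sub: "els (sem c inp \<tau>) vZ \<subseteq> ?Z - (leaves ?Z \<inter> {..<Suc i})"
    proof (cases "i \<in> T \<and> card (nb i T) \<le> 1")
      case True
      then show ?thesis unfolding eT using i(2) by (auto simp: T_def less_Suc_eq)
    next
      case False
      have "i \<notin> T \<inter> leaves ?Z"
      proof
        assume "i \<in> T \<inter> leaves ?Z"
        moreover have "card (nb i T) \<le> card (nb i ?Z)" using i(2) by (intro card_nb_mono) (auto simp: T_def)
        ultimately show False using False by (auto simp: leaves_def)
      qed
      then show ?thesis unfolding eT using False i(2) by (auto simp: T_def less_Suc_eq)
    qed
    have ac: "acyc (els (sem c inp \<tau>) vZ) \<longleftrightarrow> acyc ?Z"
    proof (cases "i \<in> T \<and> card (nb i T) \<le> 1")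
      case True
      have "acyc T" if "acyc (T - {i})"
      proof -
        have "card (nb i (T - {i})) \<le> card (nb i T)" by (intro card_nb_mono) auto
        then have "acyc (insert i (T - {i}))" using that True by (intro acyc_insert) auto
        then show ?thesis using True by (simp add: insert_absorb)
      qed
      then have "acyc (T - {i}) \<longleftrightarrow> acyc T" by (auto intro: acyc_subset)
      then show ?thesis unfolding eT using True i(2) by (simp add: T_def)
    next
      case False
      then show ?thesis unfolding eT using i(2) by (simp only: if_False T_def)
    qed
    show "?I (Suc i) (upd (sem c inp \<tau>) vv 0 (Suc i))" using sub ac by (simp add: els_upd_other)
  qed
  moreover have "leaves ?Z \<inter> {..<n} = leaves ?Z" using els_bound(2) by (auto simp: leaves_def)
  ultimately show "els (sem (Loop vv c) inp \<sigma>) vZ \<subseteq> ?Z - leaves ?Z"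
    "acyc (els (sem (Loop vv c) inp \<sigma>) vZ) \<longleftrightarrow> acyc ?Z" by simp_all
qed

text \<open>A nonempty forest has a leaf, so \<open>n\<close> passes exhaust a forest; a graph that
  is no forest stays one that is no forest and hence nonempty.\<close>

lemma sem_peel:
  assumes r: "rowed \<sigma>"
  shows "els (sem peel inp \<sigma>) vZ = {} \<longleftrightarrow> acyc (els \<sigma> vZ)"
proof -
  let ?Z = "els \<sigma> vZ"
  let ?c = "Loop vv (When (At vZ vv) (Sq (degree vv vZ) (Lt (Var vcnt) (Cst 2) (PutAt vZ vv (Cst 0)) Nop)))"
  let ?I = "\<lambda>i \<tau>. (acyc (els \<tau> vZ) \<longleftrightarrow> acyc ?Z) \<and> (acyc ?Z \<longrightarrow> card (els \<tau> vZ) \<le> n - i)"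
  have "?I n (sem peel inp \<sigma>)"
    unfolding peel_def
  proof (rule sem_Loop[where I = ?I])
    have "card ?Z \<le> card {..<n}" using els_bound(1) by (intro card_mono) auto
    then show "?I 0 (upd \<sigma> vstep 0 0)" by (simp add: els_upd_other)
    fix i and \<tau> :: arrs assume i: "i < n" "?I i \<tau>" "\<tau> vstep 0 = i"
      and fr: "\<And>j. j \<noteq> vstep \<Longrightarrow> j \<notin> writes ?c \<Longrightarrow> \<tau> j = \<sigma> j"
    have "\<tau> vROW = \<sigma> vROW" by (rule fr) simp_all
    then have r': "rowed \<tau>" by (rule rowed_cong[OF _ r])
    note p = sem_peel_pass[OF r']
    have "card (els (sem ?c inp \<tau>) vZ) \<le> n - Suc i" if ac: "acyc ?Z"
    proof (cases "els \<tau> vZ = {}")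
      case True
      then have e: "els (sem ?c inp \<tau>) vZ = {}" using p(1) by simp
      show ?thesis unfolding e by simp
    next
      case False
      have "acyc (els \<tau> vZ)" using i(2) ac by simp
      with False obtain v where "v \<in> els \<tau> vZ" "card (nb v (els \<tau> vZ)) \<le> 1" unfolding acyc_def by blast
      then have "v \<in> leaves (els \<tau> vZ)" by (simp add: leaves_def)
      with p(1) \<open>v \<in> els \<tau> vZ\<close> have "els (sem ?c inp \<tau>) vZ \<subset> els \<tau> vZ" by blast
      then have "card (els (sem ?c inp \<tau>) vZ) < card (els \<tau> vZ)" by (intro psubset_card_mono els_bound(3))
      with i(2) ac show ?thesis by auto
    qed
    then show "?I (Suc i) (upd (sem ?c inp \<tau>) vstep 0 (Suc i))"
      using i(2) p(2) by (simp add: els_upd_other)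
  qed simp
  then have I: "acyc (els (sem peel inp \<sigma>) vZ) \<longleftrightarrow> acyc ?Z" "acyc ?Z \<Longrightarrow> card (els (sem peel inp \<sigma>) vZ) = 0" by auto
  show ?thesis
  proof
    assume "els (sem peel inp \<sigma>) vZ = {}"
    then have "acyc (els (sem peel inp \<sigma>) vZ)" by (simp add: acyc_def)
    with I(1) show "acyc ?Z" by simp
  next
    assume "acyc ?Z"
    from I(2)[OF this] show "els (sem peel inp \<sigma>) vZ = {}" using els_bound(3) by (simp add: card_eq_0_iff)
  qed
qed

lemma sem_check_hubs:
  "sem check_hubs inp \<sigma> vok 0 = (if \<exists>v \<in> els \<sigma> vA. inp 2 < card {h \<in> els \<sigma> vH. h \<in> els \<sigma> vA \<and> \<sigma> vL h = \<sigma> vL v}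
    then 0 else \<sigma> vok 0)"
proof -
  let ?A = "els \<sigma> vA" and ?H = "els \<sigma> vH"
  let ?T = "\<lambda>v. {h \<in> ?H. h \<in> ?A \<and> \<sigma> vL h = \<sigma> vL v}"
  let ?body = "When (At vA vv) (Sq count_hubs (Lt (In (Cst 2)) (Var vcnt) (Asg vok (Cst 0)) Nop))"
  let ?I = "\<lambda>i (\<tau> :: arrs). \<tau> vok 0 = (if \<exists>v<i. v \<in> ?A \<and> inp 2 < card (?T v) then 0 else \<sigma> vok 0)"
  have "?I n (sem check_hubs inp \<sigma>)"
    unfolding check_hubs_def
  proof (rule sem_Loop[where I = ?I])
    fix i and \<tau> :: arrs assume i: "i < n" "?I i \<tau>" "\<tau> vv 0 = i"
      and fr: "\<And>j. j \<noteq> vv \<Longrightarrow> j \<notin> writes ?body \<Longrightarrow> \<tau> j = \<sigma> j"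
    have e: "\<tau> vA = \<sigma> vA" "\<tau> vH = \<sigma> vH" "\<tau> vL = \<sigma> vL" by (auto intro!: fr)
    define \<tau>1 where "\<tau>1 = sem count_hubs inp \<tau>"
    have ok1: "\<tau>1 vok = \<tau> vok" unfolding \<tau>1_def by (rule sem_frame) simp
    have cnt: "\<tau>1 vcnt 0 = card (?T i)"
    proof -
      let ?b = "When (At vA vu) (When (At vH vu)
        (Lt (At vL vu) (At vL vv) Nop (Lt (At vL vv) (At vL vu) Nop (Inc vcnt))))"
      let ?\<tau>0 = "upd \<tau> vcnt 0 0"
      have "sem (Loop vu ?b) inp ?\<tau>0 vcnt 0 = ?\<tau>0 vcnt 0 + card {u. u < n \<and> u \<in> ?T i}"
      proof (rule sem_Loop_count)
        fix \<rho> :: arrs assume f: "\<And>j. j \<noteq> vu \<Longrightarrow> j \<noteq> vcnt \<Longrightarrow> \<rho> j = ?\<tau>0 j" and u: "\<rho> vu 0 < n"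
        have "\<rho> vA = \<sigma> vA" "\<rho> vH = \<sigma> vH" "\<rho> vL = \<sigma> vL" "\<rho> vv 0 = i"
          using f[of vA] f[of vH] f[of vL] f[of vv] e i(3) by simp_all
        then show "sem ?b inp \<rho> = (if \<rho> vu 0 \<in> ?T i then upd \<rho> vcnt 0 (Suc (\<rho> vcnt 0)) else \<rho>)"
          using u by (auto simp: els_def)
      qed auto
      moreover have "{u. u < n \<and> u \<in> ?T i} = ?T i" using els_bound(2) by auto
      ultimately show ?thesis by (simp add: \<tau>1_def count_hubs_def)
    qed
    have mem: "0 < \<tau> vA i \<longleftrightarrow> i \<in> ?A" using i(1) e by (auto simp: els_def)
    have "sem ?body inp \<tau> = (if i \<in> ?A then if inp 2 < card (?T i) then upd \<tau>1 vok 0 0 else \<tau>1 else \<tau>)"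
      using mem cnt i(3) by (simp add: \<tau>1_def)
    then have "sem ?body inp \<tau> vok 0 = (if i \<in> ?A \<and> inp 2 < card (?T i) then 0 else \<tau> vok 0)" using ok1 by simp
    then show "?I (Suc i) (upd (sem ?body inp \<tau>) vv 0 (Suc i))" using i(2) by (auto simp: less_Suc_eq)
  qed auto
  then show ?thesis using els_bound(2) by (metis (no_types, lifting))
qed

lemma sem_check_forest: "sem check_forest inp \<sigma> vok 0 = (if els \<sigma> vZ \<noteq> {} then 0 else \<sigma> vok 0)"
proof -
  have "sem check_forest inp \<sigma> vok 0 = (if \<exists>v<n. v \<in> els \<sigma> vZ then 0 else \<sigma> vok 0)"
    unfolding check_forest_def
  proof (rule sem_Loop_flag)
    fix \<tau> :: arrs assume fr: "\<And>j. j \<noteq> vv \<Longrightarrow> j \<noteq> vok \<Longrightarrow> \<tau> j = \<sigma> j" and v: "\<tau> vv 0 < n"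
    have "\<tau> vZ = \<sigma> vZ" by (rule fr) simp_all
    then show "sem (When (At vZ vv) (Asg vok (Cst 0))) inp \<tau> = (if \<tau> vv 0 \<in> els \<sigma> vZ then upd \<tau> vok 0 0 else \<tau>)"
      using v by (auto simp: els_def)
  qed auto
  then show ?thesis using els_bound(2) by auto
qed

text \<open>The candidate is cut down to \<open>V\<close>, so that the equivalence holds for
  whatever an unsuccessful attempt leaves in the arrays.\<close>

lemma sem_check:
  fixes \<sigma> :: arrs
  defines "V \<equiv> {..<Suc (\<sigma> vi 0)}"
  assumes r: "rowed \<sigma>" and m: "\<sigma> vi 0 < n"
  shows "0 < sem check inp \<sigma> vok 0 \<longleftrightarrow> sol (inp 1) (inp 2) V (els \<sigma> vX \<inter> V) (els \<sigma> vH \<inter> (V - els \<sigma> vX))"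
    "els (sem check inp \<sigma>) vA = V - els \<sigma> vX"
proof -
  let ?X = "els \<sigma> vX" and ?H = "els \<sigma> vH"
  let ?A = "V - ?X"
  define \<sigma>1 where "\<sigma>1 = sem active inp (upd \<sigma> vok 0 1)"
  define \<sigma>2 where "\<sigma>2 = sem count_deleted inp \<sigma>1"
  define \<sigma>3 where "\<sigma>3 = sem (Lt (In (Cst 1)) (Var vcnt) (Asg vok (Cst 0)) Nop) inp \<sigma>2"
  define \<sigma>4 where "\<sigma>4 = sem peel inp \<sigma>3"
  define \<sigma>5 where "\<sigma>5 = sem check_forest inp \<sigma>4"
  define \<sigma>6 where "\<sigma>6 = sem labels inp \<sigma>5"
  define \<sigma>7 where "\<sigma>7 = sem check_hubs inp \<sigma>6"
  have fr1: "\<sigma>1 j = \<sigma> j" if "j \<notin> {vv, vA, vZ, vok}" for j using that unfolding \<sigma>1_def by (simp add: sem_frame)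
  have ok1: "\<sigma>1 vok 0 = 1" unfolding \<sigma>1_def by (simp add: sem_frame)
  have fr2: "\<sigma>2 j = \<sigma>1 j" if "j \<notin> {vcnt, vu}" for j using that unfolding \<sigma>2_def by (intro sem_frame) simp
  have fr3: "\<sigma>3 j = \<sigma>2 j" if "j \<noteq> vok" for j using that unfolding \<sigma>3_def by simp
  have fr4: "\<sigma>4 j = \<sigma>3 j" if "j \<notin> {vstep, vv, vcnt, vu, vZ}" for j using that unfolding \<sigma>4_def by (intro sem_frame) simp
  have fr5: "\<sigma>5 j = \<sigma>4 j" if "j \<notin> {vv, vok}" for j using that unfolding \<sigma>5_def by (intro sem_frame) simp
  have fr6: "\<sigma>6 j = \<sigma>5 j" if "j \<notin> {vL, vu, vv, vw, vl, vm}" for j using that unfolding \<sigma>6_def by (intro sem_frame) simp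
  have fr7: "\<sigma>7 j = \<sigma>6 j" if "j \<notin> {vv, vcnt, vu, vok}" for j using that unfolding \<sigma>7_def by (intro sem_frame) simp
  have A1: "els \<sigma>1 vA = ?A" "els \<sigma>1 vZ = ?A - ?H"
    using sem_active[of "upd \<sigma> vok 0 1"] m unfolding \<sigma>1_def V_def by (simp_all add: els_upd_other)
  have cnt: "\<sigma>2 vcnt 0 = card (?X \<inter> V)"
    unfolding \<sigma>2_def sem_count_deleted by (simp add: fr1 els_def V_def)
  have ok3: "\<sigma>3 vok 0 = (if card (?X \<inter> V) \<le> inp 1 then 1 else 0)"
    using cnt ok1 unfolding \<sigma>3_def by (simp add: fr2)
  have r3: "rowed \<sigma>3" and r5: "rowed \<sigma>5" by (rule rowed_cong[OF _ r], simp add: fr1 fr2 fr3 fr4 fr5)+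
  have "els \<sigma>3 vZ = ?A - ?H" using A1 by (simp add: els_def fr2 fr3)
  then have Z: "els \<sigma>4 vZ = {} \<longleftrightarrow> acyc (?A - ?H)" using sem_peel[OF r3] by (simp add: \<sigma>4_def)
  have ok5: "\<sigma>5 vok 0 = (if acyc (?A - ?H) \<and> card (?X \<inter> V) \<le> inp 1 then 1 else 0)"
    unfolding \<sigma>5_def sem_check_forest Z using ok3 by (simp add: fr4)
  have e6: "els \<sigma>6 vA = ?A" "els \<sigma>5 vA = ?A" "els \<sigma>6 vH = ?H"
    using A1(1) by (simp_all add: els_def fr1 fr2 fr3 fr4 fr5 fr6)
  have L: "\<sigma>6 vL x = \<sigma>6 vL y \<longleftrightarrow> conn ?A x y" if "x \<in> ?A" "y \<in> ?A" for x y
    using sem_labels[OF r5, of x y] that unfolding e6 \<sigma>6_def[symmetric] by simp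
  have T: "{h \<in> ?H. h \<in> ?A \<and> \<sigma>6 vL h = \<sigma>6 vL v} = {h \<in> ?H \<inter> ?A. h \<in> ?A \<and> conn ?A v h}" if "v \<in> ?A" for v
  proof -
    have "\<sigma>6 vL h = \<sigma>6 vL v \<longleftrightarrow> conn ?A v h" if "h \<in> ?A" for h
      using L[OF \<open>v \<in> ?A\<close> that] by metis
    then show ?thesis by blast
  qed
  have hubs: "(\<exists>v \<in> ?A. inp 2 < card {h \<in> ?H. h \<in> ?A \<and> \<sigma>6 vL h = \<sigma>6 vL v}) \<longleftrightarrow> \<not> hb (inp 2) ?A (?H \<inter> ?A)"
    unfolding hb_def using T by (simp add: not_le)
  have ok7: "\<sigma>7 vok 0 = (if \<not> hb (inp 2) ?A (?H \<inter> ?A) then 0 else \<sigma>6 vok 0)"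
    unfolding \<sigma>7_def sem_check_hubs e6 hubs by simp
  have sem: "sem check inp \<sigma> = \<sigma>7"
    unfolding check_def \<sigma>7_def \<sigma>6_def \<sigma>5_def \<sigma>4_def \<sigma>3_def \<sigma>2_def \<sigma>1_def by simp
  have sets: "V - ?X \<inter> V = ?A" "?A - ?H \<inter> ?A = ?A - ?H" by blast+
  show "0 < sem check inp \<sigma> vok 0 \<longleftrightarrow> sol (inp 1) (inp 2) V (?X \<inter> V) (?H \<inter> ?A)"
    unfolding sem ok7 sol_def sets using ok5 by (auto simp: fr6)
  show "els (sem check inp \<sigma>) vA = ?A" unfolding sem using e6 by (simp add: els_def fr7)
qed

end

section \<open>Search through the guesses and compression over all vertices\<close>

context program
begin

text \<open>Success rests on \<open>check\<close> alone. Failure says that no number below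
  \<open>vM\<close> produces a solution, which \<open>attempt_succeeds\<close> refutes whenever a
  solution exists.\<close>

lemma sem_search:
  fixes \<sigma> :: arrs
  defines "V \<equiv> {..<Suc (\<sigma> vi 0)}"
  assumes r: "rowed \<sigma>" and m: "\<sigma> vi 0 < n"
  shows "0 < sem search inp \<sigma> vfound 0 \<Longrightarrow>
      sol (inp 1) (inp 2) V (els (sem search inp \<sigma>) vX \<inter> V) (els (sem search inp \<sigma>) vH \<inter> (V - els (sem search inp \<sigma>) vX)) \<and>
      els (sem search inp \<sigma>) vA = V - els (sem search inp \<sigma>) vX"
    "sem search inp \<sigma> vfound 0 = 0 \<Longrightarrow> c < \<sigma> vM 0 \<Longrightarrow>
      \<not> sol (inp 1) (inp 2) V (cX (attempt (els \<sigma> vOX) (els \<sigma> vOH) (Suc (\<sigma> vi 0)) c))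
        (cH (attempt (els \<sigma> vOX) (els \<sigma> vOH) (Suc (\<sigma> vi 0)) c))"
proof -
  let ?att = "attempt (els \<sigma> vOX) (els \<sigma> vOH) (Suc (\<sigma> vi 0))"
  let ?sol = "\<lambda>\<tau> :: arrs. sol (inp 1) (inp 2) V (els \<tau> vX \<inter> V) (els \<tau> vH \<inter> (V - els \<tau> vX)) \<and> els \<tau> vA = V - els \<tau> vX"
  let ?body = "Lt (Var vfound) (Cst 1) (Sq guess_run (Sq check (When (Var vok) (Asg vfound (Cst 1))))) Nop"
  let ?\<sigma> = "upd \<sigma> vfound 0 0"
  let ?I = "\<lambda>g (\<tau> :: arrs). (\<forall>j \<in> {vROW, vOX, vOH, vM, vi}. \<tau> j = \<sigma> j) \<and> (0 < \<tau> vfound 0 \<longrightarrow> ?sol \<tau>) \<and>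
    (\<tau> vfound 0 = 0 \<longrightarrow> (\<forall>c<g. \<not> sol (inp 1) (inp 2) V (cX (?att c)) (cH (?att c))))"
  have "?I (val (Var vM) inp ?\<sigma>) (sem (For vg (Var vM) ?body) inp ?\<sigma>)"
  proof (rule sem_For)
    show "?I 0 (upd ?\<sigma> vg 0 0)" by simp
    fix g and \<tau> :: arrs assume g: "g < val (Var vM) inp ?\<sigma>" "?I g \<tau>" "\<tau> vg 0 = g"
    have e: "\<tau> vROW = \<sigma> vROW" "\<tau> vOX = \<sigma> vOX" "\<tau> vOH = \<sigma> vOH" "\<tau> vM = \<sigma> vM" "\<tau> vi = \<sigma> vi"
      and fnd: "0 < \<tau> vfound 0 \<Longrightarrow> ?sol \<tau>"
      and nfnd: "\<And>c. \<tau> vfound 0 = 0 \<Longrightarrow> c < g \<Longrightarrow> \<not> sol (inp 1) (inp 2) V (cX (?att c)) (cH (?att c))"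
      using g(2) by blast+
    define \<tau>' where "\<tau>' = sem ?body inp \<tau>"
    have upd_sol: "?sol (upd \<tau>' vg 0 x) \<longleftrightarrow> ?sol \<tau>'" for x by (simp add: els_upd_other)
    have "?I (Suc g) \<tau>'"
    proof (cases "\<tau> vfound 0 = 0")
      case False
      then have "\<tau>' = \<tau>" by (simp add: \<tau>'_def)
      with e fnd False show ?thesis by simp
    next
      case True
      define \<tau>1 where "\<tau>1 = sem guess_run inp \<tau>"
      define \<tau>2 where "\<tau>2 = sem check inp \<tau>1"
      have fr1: "\<tau>1 j = \<tau> j" if "j \<in> {vROW, vOX, vOH, vM, vi, vfound}" for j
        using that unfolding \<tau>1_def by (intro sem_frame) auto
      have fr2: "\<tau>2 j = \<tau>1 j" if "j \<in> {vROW, vOX, vOH, vM, vi, vfound, vX, vH}" for j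
        using that unfolding \<tau>2_def by (intro sem_frame) auto
      have t': "\<tau>' = (if 0 < \<tau>2 vok 0 then upd \<tau>2 vfound 0 1 else \<tau>2)"
        unfolding \<tau>'_def \<tau>2_def \<tau>1_def using True by simp
      have rt: "rowed \<tau>" and r1: "rowed \<tau>1" by (rule rowed_cong[OF _ r], simp add: e fr1)+
      have oe: "els \<tau> vOX = els \<sigma> vOX" "els \<tau> vOH = els \<sigma> vOH" using e by (simp_all add: els_def)
      have "cfg_of \<tau>1 = ?att g"
        using sem_guess_run[OF rt] g(1,3) m unfolding \<tau>1_def e oe by simp
      then have att: "cX (?att g) = els \<tau>1 vX" "cH (?att g) = els \<tau>1 vH" by (metis cfg.sel cfg_of_def)+
      have vi1: "\<tau>1 vi = \<sigma> vi" using fr1 e by simp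
      note ch = sem_check[OF r1, unfolded vi1, folded \<tau>2_def, folded V_def, OF m]
      have xh: "els \<tau>2 vX = els \<tau>1 vX" "els \<tau>2 vH = els \<tau>1 vH" by (simp_all add: els_def fr2)
      show ?thesis
      proof (cases "0 < \<tau>2 vok 0")
        case ok: True
        have "?sol \<tau>2" using ch ok xh by simp
        then show ?thesis unfolding t' using ok e by (simp add: fr1 fr2 els_upd_other)
      next
        case nok: False
        have "\<not> sol (inp 1) (inp 2) V (cX (?att g)) (cH (?att g))"
        proof
          assume s: "sol (inp 1) (inp 2) V (cX (?att g)) (cH (?att g))"
          then have "els \<tau>1 vX \<inter> V = els \<tau>1 vX" "els \<tau>1 vH \<inter> (V - els \<tau>1 vX) = els \<tau>1 vH"
            unfolding att sol_def by blast+
          with s ch(1) nok show False unfolding att by simp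
        qed
        moreover have "\<tau>' = \<tau>2" unfolding t' using nok by simp
        ultimately show ?thesis using True e nfnd by (auto simp: fr1 fr2 less_Suc_eq)
      qed
    qed
    then show "?I (Suc g) (upd (sem ?body inp \<tau>) vg 0 (Suc g))"
      unfolding \<tau>'_def[symmetric] using upd_sol by simp
  qed simp
  moreover have "sem search inp \<sigma> = sem (For vg (Var vM) ?body) inp ?\<sigma>" by (simp add: search_def)
  ultimately have I: "?I (\<sigma> vM 0) (sem search inp \<sigma>)" by simp
  show "0 < sem search inp \<sigma> vfound 0 \<Longrightarrow> ?sol (sem search inp \<sigma>)" using I by blast
  show "sem search inp \<sigma> vfound 0 = 0 \<Longrightarrow> c < \<sigma> vM 0 \<Longrightarrow> \<not> sol (inp 1) (inp 2) V (cX (?att c)) (cH (?att c))"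
    using I by blast
qed

lemma sem_keep:
  fixes \<sigma> :: arrs
  defines "V \<equiv> {..<Suc (\<sigma> vi 0)}"
  assumes m: "\<sigma> vi 0 < n"
  shows "els (sem keep inp \<sigma>) vOX = V - els \<sigma> vA" "els (sem keep inp \<sigma>) vOH = V \<inter> els \<sigma> vA \<inter> els \<sigma> vH"
proof -
  let ?body = "Sq (PutAt vOX vv (Cst 0)) (Sq (PutAt vOH vv (Cst 0)) (Lt (Var vv) (Pl (Var vi) (Cst 1))
    (Lt (Cst 0) (At vA vv) (PutAt vOH vv (At vH vv)) (PutAt vOX vv (Cst 1))) Nop))"
  let ?I = "\<lambda>i (\<tau> :: arrs). \<forall>v<i. (0 < \<tau> vOX v \<longleftrightarrow> v \<in> V - els \<sigma> vA) \<and> (0 < \<tau> vOH v \<longleftrightarrow> v \<in> V \<inter> els \<sigma> vA \<inter> els \<sigma> vH)"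
  have "?I n (sem keep inp \<sigma>)"
    unfolding keep_def
  proof (rule sem_Loop[where I = ?I])
    fix i and \<tau> :: arrs assume i: "i < n" "?I i \<tau>" "\<tau> vv 0 = i"
      and fr: "\<And>j. j \<noteq> vv \<Longrightarrow> j \<notin> writes ?body \<Longrightarrow> \<tau> j = \<sigma> j"
    have e: "\<tau> vi = \<sigma> vi" "\<tau> vA = \<sigma> vA" "\<tau> vH = \<sigma> vH" by (auto intro!: fr)
    have mem: "i \<in> els \<sigma> vA \<longleftrightarrow> 0 < \<sigma> vA i" "i \<in> els \<sigma> vH \<longleftrightarrow> 0 < \<sigma> vH i" using i(1) by (auto simp: els_def)
    show "?I (Suc i) (upd (sem ?body inp \<tau>) vv 0 (Suc i))"
      using i e mem by (auto simp: less_Suc_eq V_def)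
  qed auto
  moreover have "V \<subseteq> {..<n}" using m by (auto simp: V_def)
  ultimately show "els (sem keep inp \<sigma>) vOX = V - els \<sigma> vA" "els (sem keep inp \<sigma>) vOH = V \<inter> els \<sigma> vA \<inter> els \<sigma> vH"
    unfolding els_def by blast+
qed

text \<open>The invariant carries a solution for the first \<open>i\<close> vertices or the
  knowledge that the whole graph has none; the empty graph starts it.\<close>

lemma sem_compress_all:
  assumes r: "rowed \<sigma>" and start: "els \<sigma> vOX = {}" "els \<sigma> vOH = {}" "\<sigma> vyes 0 = 1" and M: "\<sigma> vM 0 = 3 ^ l"
    and l: "\<And>k d. k = inp 1 \<Longrightarrow> d = inp 2 \<Longrightarrow>
      k + 1 + (k + (d + 1) * (k + 1) + 2 * (k + 1) + (d + 4) * ((k + 1) * ((k + d) * d))) \<le> l"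
  shows "sem compress_all inp \<sigma> vyes 0 = (if \<exists>X H. sol (inp 1) (inp 2) {..<n} X H then 1 else 0)"
proof -
  let ?k = "inp 1" and ?d = "inp 2"
  let ?body = "When (Var vyes) (Sq (PutAt vOX vi (Cst 1)) (Sq search (Lt (Cst 0) (Var vfound) keep (Asg vyes (Cst 0)))))"
  let ?I = "\<lambda>i (\<tau> :: arrs). (\<tau> vyes 0 = 1 \<and> sol ?k ?d {..<i} (els \<tau> vOX) (els \<tau> vOH)) \<or>
    (\<tau> vyes 0 = 0 \<and> (\<nexists>X H. sol ?k ?d {..<n} X H))"
  have "?I n (sem compress_all inp \<sigma>)"
    unfolding compress_all_def
  proof (rule sem_Loop[where I = ?I])
    have "sol ?k ?d {} {} {}" by (simp add: sol_def acyc_def hb_def)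
    then show "?I 0 (upd \<sigma> vi 0 0)" using start by (simp add: els_upd_other)
    fix i and \<tau> :: arrs assume i: "i < n" "?I i \<tau>" "\<tau> vi 0 = i"
      and fr: "\<And>j. j \<noteq> vi \<Longrightarrow> j \<notin> writes ?body \<Longrightarrow> \<tau> j = \<sigma> j"
    have e: "\<tau> vROW = \<sigma> vROW" "\<tau> vM = \<sigma> vM" by (auto intro!: fr)
    define \<tau>' where "\<tau>' = sem ?body inp \<tau>"
    have "?I (Suc i) \<tau>'"
    proof (cases "\<tau> vyes 0 = 0")
      case True
      then have "\<tau>' = \<tau>" by (simp add: \<tau>'_def)
      then show ?thesis using i(2) True by simp
    next
      case False
      then have old: "sol ?k ?d {..<i} (els \<tau> vOX) (els \<tau> vOH)" and yes: "\<tau> vyes 0 = 1" using i(2) by auto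
      define X0 where "X0 = insert i (els \<tau> vOX)"
      define oH where "oH = els \<tau> vOH"
      define \<tau>1 where "\<tau>1 = upd \<tau> vOX i 1"
      define \<tau>2 where "\<tau>2 = sem search inp \<tau>1"
      let ?V = "{..<Suc i}"
      have t': "\<tau>' = (if 0 < \<tau>2 vfound 0 then sem keep inp \<tau>2 else upd \<tau>2 vyes 0 0)"
        unfolding \<tau>'_def \<tau>2_def \<tau>1_def using yes i(3) by simp
      have r1: "rowed \<tau>1" by (rule rowed_cong[OF _ r]) (simp add: \<tau>1_def e)
      have els1: "els \<tau>1 vOX = X0" "els \<tau>1 vOH = oH" unfolding \<tau>1_def X0_def oH_def
        using i(1) by (simp_all add: els_upd els_upd_other)
      have e1: "\<tau>1 vi = \<tau> vi" "\<tau>1 vM 0 = 3 ^ l" using e M by (simp_all add: \<tau>1_def)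
      have fr2: "\<tau>2 j = \<tau> j" if "j \<in> {vi, vyes}" for j
      proof -
        have "\<tau>2 j = \<tau>1 j" using that unfolding \<tau>2_def by (intro sem_frame) auto
        then show ?thesis using that by (auto simp: \<tau>1_def)
      qed
      have m1: "\<tau>1 vi 0 < n" using e1 i by simp
      note se = sem_search[OF r1 m1, unfolded e1 i(3) els1, folded \<tau>2_def]
      show ?thesis
      proof (cases "0 < \<tau>2 vfound 0")
        case True
        note s = se(1)[OF True]
        have "els (sem keep inp \<tau>2) vOX = ?V - els \<tau>2 vA" "els (sem keep inp \<tau>2) vOH = ?V \<inter> els \<tau>2 vA \<inter> els \<tau>2 vH"
          using sem_keep[of \<tau>2] i(1,3) by (simp_all add: fr2)
        moreover have "?V - els \<tau>2 vA = els \<tau>2 vX \<inter> ?V"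
          "?V \<inter> els \<tau>2 vA \<inter> els \<tau>2 vH = els \<tau>2 vH \<inter> (?V - els \<tau>2 vX)" using s by blast+
        moreover have "sem keep inp \<tau>2 vyes = \<tau>2 vyes" by (rule sem_frame) simp
        ultimately show ?thesis unfolding t' using True s yes by (simp add: fr2)
      next
        case False
        have "\<nexists>X H. sol ?k ?d {..<n} X H"
        proof
          assume "\<exists>X H. sol ?k ?d {..<n} X H"
          then obtain X H where XH: "sol ?k ?d {..<n} X H" by blast
          have V: "?V \<subseteq> {..<n}" using i(1) by auto
          have o: "els \<tau> vOX \<subseteq> {..<i}" "oH \<subseteq> {..<i} - els \<tau> vOX" "card (els \<tau> vOX) \<le> ?k"
            "acyc ({..<i} - els \<tau> vOX - oH)" "hb ?d ({..<i} - els \<tau> vOX) oH"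
            using old unfolding sol_def oH_def by blast+
          have eq: "?V - X0 = {..<i} - els \<tau> vOX" unfolding X0_def by auto
          \<comment> \<open>The supposed solution of the whole graph, restricted to the current
            vertices, serves as the unknown solution.\<close>
          have "compression E n ?V X0 oH (X \<inter> ?V) (H \<inter> ?V) ?k ?d"
          proof (intro compression.intro compression_axioms.intro)
            show "sgraph E n" by (rule sgraph_axioms)
            show "X0 \<subseteq> ?V" using o(1) unfolding X0_def by auto
            have "card X0 \<le> Suc (card (els \<tau> vOX))" unfolding X0_def by (rule card_insert_le_m1) simp_all
            with o(3) show "card X0 \<le> ?k + 1" by linarith
            show "sol ?k ?d ?V (X \<inter> ?V) (H \<inter> ?V)" by (rule sol_restrict[OF XH V finite_lessThan])
          qed (use V o eq in simp_all)
          then interpret compression E n ?V X0 oH "X \<inter> ?V" "H \<inter> ?V" ?k ?d .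
          have "?k + 1 + bound \<le> l" unfolding bound_def by (rule l) simp_all
          from attempt_succeeds[OF refl this] obtain c where "c < 3 ^ l"
            "sol ?k ?d ?V (cX (attempt X0 oH (Suc i) c)) (cH (attempt X0 oH (Suc i) c))" by blast
          moreover have "\<tau>2 vfound 0 = 0" using False by simp
          ultimately show False using se(2) by blast
        qed
        then show ?thesis unfolding t' using False by simp
      qed
    qed
    then show "?I (Suc i) (upd (sem ?body inp \<tau>) vi 0 (Suc i))"
      unfolding \<tau>'_def[symmetric] by (simp add: els_upd_other)
  qed simp
  then show ?thesis by (auto 0 3)
qed

lemma sem_rows: "rowed (sem rows inp \<sigma>)"
proof -
  let ?body = "Sq (PutAt vROW vu (Var vr)) (Asg vr (Pl (Var vr) (In (Cst 0))))"
  let ?I = "\<lambda>i (\<tau> :: arrs). \<tau> vr 0 = 3 + n * i \<and> (\<forall>u<i. \<tau> vROW u = 3 + n * u)"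
  have "?I n (sem (Loop vu ?body) inp (upd \<sigma> vr 0 3))"
    by (rule sem_Loop[where I = ?I]) (auto simp: less_Suc_eq inp_n)
  then show ?thesis by (simp add: rowed_def rows_def)
qed

end

subsection \<open>The number of guesses\<close>

definition guesses :: "nat \<Rightarrow> nat \<Rightarrow> nat" where
  "guesses a b = 3 ^ (16 ^ (a + b + 1))"

text \<open>With \<open>s = k + d + 1\<close> the left side is at most \<open>9 * s ^ 4\<close>, and
  \<open>s \<le> 2 ^ (k + d)\<close>. The fourth power explains the base 16, and the additional
  factor 16 absorbs the 9.\<close>

lemma digits_suffice:
  fixes k d :: nat
  shows "k + 1 + (k + (d + 1) * (k + 1) + 2 * (k + 1) + (d + 4) * ((k + 1) * ((k + d) * d))) \<le> 16 ^ (k + d + 1)"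
proof -
  define s where "s = k + d + 1"
  have s1: "1 \<le> s" by (simp add: s_def)
  have s2: "s \<le> s ^ 4" "s ^ 2 \<le> s ^ 4" using power_increasing[of 1 4 s] power_increasing[of 2 4 s] s1 by auto
  have "k + d < 2 ^ (k + d)" by (rule less_exp)
  then have "s \<le> 2 ^ (k + d)" unfolding s_def by linarith
  then have "s ^ 4 \<le> (2 ^ (k + d)) ^ 4" by (rule power_mono) simp
  also have "(2 ^ (k + d)) ^ 4 = ((2 :: nat) ^ 4) ^ (k + d)"
    by (simp only: power_mult[symmetric] mult.commute)
  also have "(2 :: nat) ^ 4 = 16" by simp
  finally have s4: "s ^ 4 \<le> 16 ^ (k + d)" .
  have "(d + 1) * (k + 1) \<le> s * s" by (intro mult_le_mono) (simp_all add: s_def)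
  then have a: "(d + 1) * (k + 1) \<le> s ^ 4" using s2 by (simp add: power2_eq_square)
  have "(d + 4) * ((k + 1) * ((k + d) * d)) \<le> (4 * s) * (s * (s * s))"
    by (intro mult_le_mono) (simp_all add: s_def)
  also have "\<dots> = 4 * s ^ 4" by (simp only: power4_eq_xxxx mult_ac)
  finally have b: "(d + 4) * ((k + 1) * ((k + d) * d)) \<le> 4 * s ^ 4" .
  have c: "k \<le> s ^ 4" "k + 1 \<le> s ^ 4" using s2(1) unfolding s_def by linarith+
  have "k + 1 + (k + p + 2 * (k + 1) + q) \<le> 9 * z"
    if "p \<le> z" "q \<le> 4 * z" "k \<le> z" "k + 1 \<le> z" for p q z :: nat
  proof -
    have "k + 1 + (k + p + 2 * (k + 1) + q) \<le> z + (z + z + 2 * z + 4 * z)"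
      by (intro add_mono mult_le_mono2 that)
    then show ?thesis by simp
  qed
  from this[OF a b c]
  have "k + 1 + (k + (d + 1) * (k + 1) + 2 * (k + 1) + (d + 4) * ((k + 1) * ((k + d) * d))) \<le> 9 * s ^ 4" .
  also have "\<dots> \<le> 9 * 16 ^ (k + d)" using s4 by simp
  also have "\<dots> \<le> 16 ^ (k + d + 1)" by simp
  finally show ?thesis .
qed

lemma sem_power_setup:
  shows "sem (power_setup (In (Cst a)) (In (Cst b))) inp \<sigma> vM 0 = guesses (inp a) (inp b)"
    "guesses (inp a) (inp b) \<le> B \<Longrightarrow> bdd B (power_setup (In (Cst a)) (In (Cst b))) inp \<sigma>"
proof -
  let ?q = "Sq (Asg vT (Pl (Var vT) (Var vT))) (Sq (Asg vT (Pl (Var vT) (Var vT))) (Sq (Asg vT (Pl (Var vT) (Var vT))) (Asg vT (Pl (Var vT) (Var vT)))))"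
  have q: "sem (For vt (In (Cst j)) ?q) inp \<tau> vT 0 = 16 ^ inp j * \<tau> vT 0" for j \<tau>
  proof -
    have "sem (For vt (In (Cst j)) ?q) inp \<tau> vT 0 = 16 ^ val (In (Cst j)) inp \<tau> * \<tau> vT 0"
      by (rule sem_For[where I = "\<lambda>i (\<rho> :: arrs). \<rho> vT 0 = 16 ^ i * \<tau> vT 0"]) simp_all
    then show ?thesis by simp
  qed
  define \<sigma>1 where "\<sigma>1 = sem (For vt (In (Cst a)) ?q) inp (upd \<sigma> vT 0 16)"
  define \<sigma>2 where "\<sigma>2 = sem (For vt (In (Cst b)) ?q) inp \<sigma>1"
  have T: "\<sigma>2 vT 0 = 16 ^ (inp a + inp b + 1)" unfolding \<sigma>2_def \<sigma>1_def q by (simp add: power_add)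
  let ?m = "Asg vM (Pl (Var vM) (Pl (Var vM) (Var vM)))"
  have "sem (For vt (Var vT) ?m) inp (upd \<sigma>2 vM 0 1) vM 0 = 3 ^ val (Var vT) inp (upd \<sigma>2 vM 0 1)"
    by (rule sem_For[where I = "\<lambda>i (\<rho> :: arrs). \<rho> vM 0 = 3 ^ i"]) simp_all
  then show "sem (power_setup (In (Cst a)) (In (Cst b))) inp \<sigma> vM 0 = guesses (inp a) (inp b)"
    unfolding power_setup_def using T by (simp add: \<sigma>2_def \<sigma>1_def guesses_def)
  assume B: "guesses (inp a) (inp b) \<le> B"
  have "inp a + inp b + 1 < 2 ^ (inp a + inp b + 1)" by (rule less_exp)
  also have "(2 :: nat) ^ (inp a + inp b + 1) \<le> 16 ^ (inp a + inp b + 1)" by (rule power_mono) simp_all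
  finally have 1: "inp a + inp b + 1 \<le> 16 ^ (inp a + inp b + 1)" by simp
  have "(16 :: nat) ^ (inp a + inp b + 1) < 2 ^ (16 ^ (inp a + inp b + 1))" by (rule less_exp)
  also have "\<dots> \<le> guesses (inp a) (inp b)" unfolding guesses_def by (rule power_mono) simp_all
  finally have 2: "16 ^ (inp a + inp b + 1) \<le> B" using B by simp
  have "inp a \<le> B" "inp b \<le> B" using 1 2 by linarith+
  then show "bdd B (power_setup (In (Cst a)) (In (Cst b))) inp \<sigma>"
    unfolding power_setup_def using 2 T by (simp add: \<sigma>2_def \<sigma>1_def)
qed

lemma writes_power_setup [simp]: "writes (power_setup e1 e2) = {vT, vt, vM}"
  by (auto simp: power_setup_def)

context program
begin

lemma sem_main:
  assumes "\<And>j i. \<sigma> j i = 0"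
  shows "sem main inp \<sigma> vyes 0 = (if \<exists>X H. sol (inp 1) (inp 2) {..<n} X H then 1 else 0)"
proof -
  define \<sigma>1 where "\<sigma>1 = sem (power_setup (In (Cst 1)) (In (Cst 2))) inp \<sigma>"
  define \<sigma>2 where "\<sigma>2 = sem rows inp \<sigma>1"
  define \<sigma>3 where "\<sigma>3 = upd \<sigma>2 vyes 0 1"
  have fr1: "\<sigma>1 j = \<sigma> j" if "j \<notin> {vT, vt, vM}" for j using that unfolding \<sigma>1_def by (intro sem_frame) simp
  have fr2: "\<sigma>2 j = \<sigma>1 j" if "j \<notin> {vROW, vr, vu}" for j
    using that unfolding \<sigma>2_def by (intro sem_frame) (auto simp: rows_def)
  have "rowed \<sigma>2" unfolding \<sigma>2_def by (rule sem_rows)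
  then have r: "rowed \<sigma>3" by (rule rowed_cong[rotated]) (simp add: \<sigma>3_def)
  have "\<sigma>1 vM 0 = guesses (inp 1) (inp 2)" unfolding \<sigma>1_def by (rule sem_power_setup)
  then have M: "\<sigma>3 vM 0 = 3 ^ (16 ^ (inp 1 + inp 2 + 1))" by (simp add: \<sigma>3_def fr2 guesses_def)
  have z: "els \<sigma>3 vOX = {}" "els \<sigma>3 vOH = {}" using assms by (simp_all add: els_def \<sigma>3_def fr1 fr2)
  have "sem main inp \<sigma> = sem compress_all inp \<sigma>3" by (simp add: main_def \<sigma>3_def \<sigma>2_def \<sigma>1_def)
  then show ?thesis
    using sem_compress_all[OF r z _ M] digits_suffice by (simp add: \<sigma>3_def)
qed

text \<open>\<open>power_setup\<close> computes the bound of its last loop itself and is treated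
  apart; afterwards every loop runs to \<open>n\<close> or to the fixed value of
  \<open>vM\<close>.\<close>

lemma bdd_main:
  assumes "n \<le> B" "guesses (inp 1) (inp 2) \<le> B"
  shows "bdd B main inp \<sigma>"
proof -
  define \<sigma>1 where "\<sigma>1 = sem (power_setup (In (Cst 1)) (In (Cst 2))) inp \<sigma>"
  have M: "\<sigma>1 vM 0 \<le> B" using sem_power_setup(1)[of 1 2 inp \<sigma>] assms(2) by (simp add: \<sigma>1_def)
  have "bdd B (Sq rows (Sq (Asg vyes (Cst 1)) compress_all)) inp \<sigma>1"
  proof (rule bdd_static[where W = "writes (Sq rows (Sq (Asg vyes (Cst 1)) compress_all))"])
    fix e assume "e \<in> bounds (Sq rows (Sq (Asg vyes (Cst 1)) compress_all))"
    then have "e = In (Cst 0) \<or> e = Var vM" by (auto simp: prog_defs)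
    moreover have "vM \<notin> writes (Sq rows (Sq (Asg vyes (Cst 1)) compress_all))"
      by (simp add: rows_def compress_all_def)
    ultimately show "reads e \<inter> writes (Sq rows (Sq (Asg vyes (Cst 1)) compress_all)) = {} \<and> val e inp \<sigma>1 \<le> B"
      using M assms(1) inp_n by auto
  qed simp
  then show ?thesis using sem_power_setup(2)[where inp = inp and a = 1 and b = 2, OF assms(2)] unfolding main_def \<sigma>1_def by simp
qed

end

subsection \<open>Computability of the running time bound\<close>

text \<open>Multiplication by repeated addition: \<open>vq\<close> starts with twice
  \<open>vr\<close> and gains \<open>vr\<close> in each of \<open>vM\<close> rounds, which
  multiplies by the number of guesses plus two.\<close>

definition "bound_program C D = Sq (power_setup (In (Cst 0)) (In (Cst 1))) (Sq (Asg vr (Cst C))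
  (For vi (Cst D) (Sq (Asg vq (Pl (Var vr) (Var vr))) (Sq (For vu (Var vM) (Asg vq (Pl (Var vq) (Var vr)))) (Asg vr (Var vq))))))"

lemma sem_bound_program:
  "sem (bound_program C D) inp \<sigma> vr 0 = C * (guesses (inp 0) (inp 1) + 2) ^ D"
proof -
  let ?m = "guesses (inp 0) (inp 1)"
  define \<sigma>1 where "\<sigma>1 = upd (sem (power_setup (In (Cst 0)) (In (Cst 1))) inp \<sigma>) vr 0 C"
  have M: "\<sigma>1 vM 0 = ?m" unfolding \<sigma>1_def by (simp add: sem_power_setup)
  let ?add = "Asg vq (Pl (Var vq) (Var vr))"
  let ?body = "Sq (Asg vq (Pl (Var vr) (Var vr))) (Sq (For vu (Var vM) ?add) (Asg vr (Var vq)))"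
  let ?I = "\<lambda>i (\<tau> :: arrs). \<tau> vr 0 = C * (?m + 2) ^ i \<and> \<tau> vM 0 = ?m"
  have "?I (val (Cst D) inp \<sigma>1) (sem (For vi (Cst D) ?body) inp \<sigma>1)"
  proof (rule sem_For)
    show "?I 0 (upd \<sigma>1 vi 0 0)" using M by (simp add: \<sigma>1_def)
    fix i and \<tau> :: arrs assume i: "?I i \<tau>"
    let ?\<tau> = "upd \<tau> vq 0 (\<tau> vr 0 + \<tau> vr 0)"
    let ?J = "\<lambda>i (\<rho> :: arrs). \<rho> vq 0 = (i + 2) * \<tau> vr 0 \<and> \<rho> vr 0 = \<tau> vr 0 \<and> \<rho> vM 0 = \<tau> vM 0"
    have "?J (val (Var vM) inp ?\<tau>) (sem (For vu (Var vM) ?add) inp ?\<tau>)"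
      by (rule sem_For) (simp_all add: algebra_simps)
    then show "?I (Suc i) (upd (sem ?body inp \<tau>) vi 0 (Suc i))" using i by (simp add: algebra_simps)
  qed simp
  then show ?thesis by (simp add: bound_program_def \<sigma>1_def)
qed

text \<open>The two conditionals replace negative arguments by zero, as \<open>nat\<close> does, so
  that the cells represent an input of the loop language.\<close>

lemma computable_bound: "computable2 (\<lambda>x y. C * (guesses (nat x) (nat y) + 2) ^ D)"
  unfolding computable2_def
proof (rule exI, intro allI)
  fix x y :: int
  let ?p = "Seq (IfPos (Mem (Const 0)) Skip (Store (Const 0) (Const 0)))
    (Seq (IfPos (Mem (Const 1)) Skip (Store (Const 1) (Const 0)))
    (Seq (compile (bound_program C D)) (Store (Const 0) (cexp (Var vr)))))"
  define s0 :: store where "s0 = (\<lambda>_. 0)(0 := x, 1 := y)"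
  define s1 where "s1 = s0(0 := int (nat x))"
  define s2 where "s2 = s1(1 := int (nat y))"
  define inp :: "nat \<Rightarrow> nat" where "inp = (\<lambda>_. 0)(0 := nat x, 1 := nat y)"
  define \<sigma> :: arrs where "\<sigma> = (\<lambda>_ _. 0)"
  have 1: "exec (IfPos (Mem (Const 0)) Skip (Store (Const 0) (Const 0))) s0 (1 + 1) s1"
  proof (cases "0 < x")
    case True
    then have "s1 = s0" by (simp add: s1_def s0_def fun_upd_def fun_eq_iff)
    moreover have "0 < eval (Mem (Const 0)) s0" using True by (simp add: s0_def)
    from exec.IfTrue[OF this exec.Skip] have "exec (IfPos (Mem (Const 0)) Skip (Store (Const 0) (Const 0))) s0 (1 + 1) s0" .
    ultimately show ?thesis by simp
  next
    case False
    then show ?thesis using exec.Store[of "Const 0" "Const 0" s0] unfolding s1_def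
      by (intro exec.IfFalse) (auto simp: s0_def)
  qed
  have 2: "exec (IfPos (Mem (Const 1)) Skip (Store (Const 1) (Const 0))) s1 (1 + 1) s2"
  proof (cases "0 < y")
    case True
    then have "s2 = s1" by (simp add: s2_def s1_def s0_def fun_upd_def fun_eq_iff)
    moreover have "0 < eval (Mem (Const 1)) s1" using True by (simp add: s1_def s0_def)
    from exec.IfTrue[OF this exec.Skip] have "exec (IfPos (Mem (Const 1)) Skip (Store (Const 1) (Const 0))) s1 (1 + 1) s1" .
    ultimately show ?thesis by simp
  next
    case False
    then show ?thesis using exec.Store[of "Const 1" "Const 0" s1] unfolding s2_def
      by (intro exec.IfFalse) (auto simp: s1_def s0_def)
  qed
  have "rep inp \<sigma> s2"
    by (auto simp: rep_def s2_def s1_def s0_def inp_def \<sigma>_def addr_def)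
  moreover have "wfc (bound_program C D)" by (simp add: bound_program_def power_setup_def)
  moreover obtain B where "bdd B (bound_program C D) inp \<sigma>" using bdd_exists by blast
  ultimately obtain t s3 where 3: "exec (compile (bound_program C D)) s2 t s3" "rep inp (sem (bound_program C D) inp \<sigma>) s3"
    using exec_compile by blast
  have v: "eval (cexp (Var vr)) s3 = int (C * (guesses (nat x) (nat y) + 2) ^ D)"
    using eval_cexp[OF 3(2), of "Var vr"] sem_bound_program[of C D inp \<sigma>] by (simp add: inp_def del: cexp.simps)
  let ?s4 = "s3(eval (Const 0) s3 := eval (cexp (Var vr)) s3)"
  have "exec ?p s0 (1 + 1 + (1 + 1 + (t + 1))) ?s4"
    by (rule exec.Seq[OF 1 exec.Seq[OF 2 exec.Seq[OF 3(1) exec.Store]]])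
  moreover have "?s4 0 = int (C * (guesses (nat x) (nat y) + 2) ^ D)" unfolding v by simp
  ultimately show "\<exists>t s. exec ?p ((\<lambda>_. 0)(0 := x, 1 := y)) t s \<and> s 0 = int (C * (guesses (nat x) (nat y) + 2) ^ D)"
    unfolding s0_def by blast
qed

section \<open>Quasi-forests of graphs\<close>

text \<open>Walks written by their vertices: the arc list is the vertex list zipped with its own
  shift.\<close>

lemma pcas_zip: "pcas x (zip (x # xs) (xs @ [y])) y"
  by (induction xs arbitrary: x) auto

lemma pawalk_verts_zip: "pawalk_verts x (zip (x # xs) (xs @ [y])) = x # xs @ [y]"
  by (induction xs arbitrary: x) auto

lemma pcas_imp_zip: "pcas u p v \<Longrightarrow> p \<noteq> [] \<Longrightarrow> \<exists>xs. p = zip (u # xs) (xs @ [v])"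
proof (induction p arbitrary: u)
  case (Cons e p)
  obtain a b where e: "e = (a, b)" by (cases e)
  then have a: "a = u" "pcas b p v" using Cons.prems by auto
  show ?case
  proof (cases "p = []")
    case True
    then show ?thesis using a e by (intro exI[of _ "[]"]) auto
  next
    case False
    then obtain xs where "p = zip (b # xs) (xs @ [v])" using Cons.IH[OF a(2)] by blast
    then show ?thesis using a e by (intro exI[of _ "b # xs"]) auto
  qed
qed simp

locale instance_graph = pair_graph G for G :: "nat pair_pre_digraph" +
  fixes n :: nat
  assumes pverts_G: "pverts G = {0..<n}"
begin

definition E :: "nat \<Rightarrow> nat \<Rightarrow> bool" where
  "E u v \<longleftrightarrow> (u, v) \<in> parcs G"

definition sub :: "nat set \<Rightarrow> (nat, nat \<times> nat) pre_digraph" where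
  "sub A = with_proj G \<restriction> A"

lemma E_lt: "E u v \<Longrightarrow> u < n" "E u v \<Longrightarrow> v < n"
  using wellformed'[of u v] pverts_G by (auto simp: E_def)

sublocale sgraph E n
proof
  fix u v
  show "E u v \<Longrightarrow> E v u" using sym_arcs by (auto simp: E_def symmetric_def sym_def)
  show "\<not> E u u" using pair_no_loops[of "(u, u)"] by (auto simp: E_def)
  show "E u v \<Longrightarrow> v < n" by (rule E_lt)
qed

lemma sub_simps [simp]:
  "verts (sub A) = A" "arcs (sub A) = {e. E (fst e) (snd e) \<and> fst e \<in> A \<and> snd e \<in> A}"
  "tail (sub A) = fst" "head (sub A) = snd"
  by (auto simp: sub_def E_def)

lemma sub_sub: "B \<subseteq> A \<Longrightarrow> sub A \<restriction> B = sub B"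
  by (auto simp: sub_def induce_subgraph_def)

lemma cycle_sub: "pre_digraph.cycle (sub A) p \<longleftrightarrow>
    (\<exists>u. u \<in> A \<and> set p \<subseteq> arcs (sub A) \<and> pcas u p u \<and> distinct (tl (pawalk_verts u p)) \<and> p \<noteq> [])"
proof -
  have c: "compatible (sub A) (with_proj G)" unfolding sub_def by (rule compatible_induce_subgraph)
  show ?thesis
    unfolding pre_digraph.cycle_def pre_digraph.awalk_def compatible_cas[OF c] compatible_awalk_verts[OF c]
      cas_with_proj_eq awalk_verts_with_proj_eq by (simp only: sub_simps(1) conj_assoc)
qed

lemma two_nbs: "x \<in> nb v T \<Longrightarrow> y \<in> nb v T \<Longrightarrow> x \<noteq> y \<Longrightarrow> 2 \<le> card (nb v T)"
  using card_mono[of "nb v T" "{x, y}"] by simp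

text \<open>Every vertex of the cycle has its predecessor and its successor as neighbours, and these
  differ because the length is at least three.\<close>

lemma cycle_imp_not_acyc:
  assumes "pre_digraph.cycle (sub A) p" "3 \<le> length p"
  shows "\<not> acyc A"
proof
  assume ac: "acyc A"
  obtain u where u: "u \<in> A" "set p \<subseteq> arcs (sub A)" "pcas u p u" "distinct (tl (pawalk_verts u p))" "p \<noteq> []"
    using assms(1) unfolding cycle_sub by blast
  obtain xs where p: "p = zip (u # xs) (xs @ [u])" using pcas_imp_zip[OF u(3,5)] by blast
  define ys where "ys = u # xs"
  define m where "m = length ys"
  have m: "3 \<le> m" using assms(2) by (simp add: p m_def ys_def)
  have dist: "distinct ys" using u(4) unfolding p pawalk_verts_zip ys_def by auto
  have step: "E (ys ! i) (ys ! (Suc i mod m)) \<and> ys ! i \<in> A" if "i < m" for i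
  proof -
    have "i < length p" using that by (simp add: p m_def ys_def)
    then have "p ! i \<in> arcs (sub A)" using u(2) nth_mem by blast
    moreover have "p ! i = (ys ! i, (xs @ [u]) ! i)" using that by (simp add: p m_def ys_def)
    moreover have "(xs @ [u]) ! i = ys ! (Suc i mod m)"
      using that by (cases "Suc i = m") (auto simp: m_def ys_def nth_append)
    ultimately show ?thesis by auto
  qed
  have T: "set ys \<subseteq> A" using step by (auto simp: in_set_conv_nth m_def)
  have "2 \<le> card (nb v (set ys))" if vys: "v \<in> set ys" for v
  proof -
    obtain i where i: "i < m" "v = ys ! i" using vys unfolding in_set_conv_nth m_def by blast
    \<comment> \<open>The predecessor of position \<open>i\<close>, wrapping around at 0.\<close>
    define j where "j = (if i = 0 then m - 1 else i - 1)"
    have j: "j < m" "Suc j mod m = i" using i m by (auto simp: j_def)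
    have "Suc i mod m < m" using m by simp
    moreover have "Suc i mod m \<noteq> j"
    proof (cases "Suc i = m")
      case True
      then show ?thesis using m by (auto simp: j_def)
    next
      case False
      then have "Suc i mod m = Suc i" using i(1) by simp
      then show ?thesis using m i(1) by (auto simp: j_def)
    qed
    ultimately have ne: "ys ! (Suc i mod m) \<noteq> ys ! j"
      using dist j(1) by (simp add: nth_eq_iff_index_eq m_def)
    have "ys ! (Suc i mod m) \<in> nb v (set ys)"
      using step[OF i(1)] \<open>Suc i mod m < m\<close> i(2) by (auto simp: nb_def m_def)
    moreover have "ys ! j \<in> nb v (set ys)"
      using step[OF j(1)] j i(2) E_sym by (auto simp: nb_def m_def)
    ultimately show ?thesis using ne by (rule two_nbs)
  qed
  note two = this
  have "set ys \<noteq> {}" by (simp add: ys_def)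
  then obtain v where v: "v \<in> set ys" "card (nb v (set ys)) \<le> 1" using ac[unfolded acyc_def, rule_format, OF T] by blast
  from two[OF v(1)] v(2) show False by linarith
qed

text \<open>In a longest path through a set of minimum degree two, the first vertex has a neighbour on the
  path besides its successor.\<close>

lemma not_acyc_imp_cycle:
  assumes "\<not> acyc A" "A \<subseteq> {..<n}"
  shows "\<exists>p. pre_digraph.cycle (sub A) p \<and> 3 \<le> length p"
proof -
  obtain T where T: "T \<subseteq> A" "T \<noteq> {}" "\<And>v. v \<in> T \<Longrightarrow> 2 \<le> card (nb v T)"
  proof -
    obtain T where T: "T \<subseteq> A" "T \<noteq> {}" "\<not> (\<exists>v \<in> T. card (nb v T) \<le> 1)"
      using assms(1) unfolding acyc_def by blast
    have "2 \<le> card (nb v T)" if "v \<in> T" for v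
    proof -
      have "\<not> card (nb v T) \<le> 1" using T(3) that by blast
      then show ?thesis by linarith
    qed
    with T(1,2) show thesis by (rule that)
  qed
  have finT: "finite T" by (rule finite_subset[OF subset_trans[OF T(1) assms(2)] finite_lessThan])
  define P where "P xs \<longleftrightarrow> xs \<noteq> [] \<and> distinct xs \<and> set xs \<subseteq> T \<and> (\<forall>i. Suc i < length xs \<longrightarrow> E (xs ! i) (xs ! Suc i))"
    for xs :: "nat list"
  have len: "length xs \<le> card T" if "P xs" for xs
    using that finT distinct_card[of xs] card_mono[of T "set xs"] by (auto simp: P_def)
  obtain t where "t \<in> T" using T(2) by blast
  then have "P [t]" by (simp add: P_def)
  moreover have "\<forall>ys. P ys \<longrightarrow> length ys < Suc (card T)" using len by (simp add: less_Suc_eq_le)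
  ultimately have "\<exists>xs. P xs \<and> (\<forall>ys. P ys \<longrightarrow> length ys \<le> length xs)"
    by (rule Lattices_Big.ex_has_greatest_nat)
  then obtain xs where xs: "P xs" "\<And>ys. P ys \<Longrightarrow> length ys \<le> length xs" by blast
  define x where "x = hd xs"
  obtain zs where zs: "xs = x # zs" using xs(1) unfolding P_def x_def by (cases xs) auto
  have x: "x \<in> T" "xs ! 0 = x" using xs(1) zs by (auto simp: P_def)
  have nbs: "nb x T \<subseteq> set xs"
  proof
    fix y assume y: "y \<in> nb x T"
    show "y \<in> set xs"
    proof (rule ccontr)
      assume "y \<notin> set xs"
      moreover have "y \<in> T" "E y x" using y E_sym by (auto simp: nb_def)
      ultimately have "P (y # xs)" using xs(1) zs by (auto simp: P_def nth_Cons split: nat.split)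
      with xs(2) show False by fastforce
    qed
  qed
  have "\<not> nb x T \<subseteq> {xs ! 1}"
  proof
    assume "nb x T \<subseteq> {xs ! 1}"
    then have "card (nb x T) \<le> card {xs ! 1}" by (intro card_mono) auto
    with T(3)[OF x(1)] show False by simp
  qed
  then obtain y where y: "y \<in> nb x T" "y \<noteq> xs ! 1" by blast
  obtain j where j: "j < length xs" "xs ! j = y" using subsetD[OF nbs y(1)] unfolding in_set_conv_nth by blast
  have "j \<noteq> 0"
  proof
    assume "j = 0"
    then have "y = x" using j(2) x(2) by simp
    with y(1) show False by (simp add: nb_def E_irrefl)
  qed
  moreover have "j \<noteq> 1" using j(2) y(2) by auto
  \<comment> \<open>\<open>y\<close> is neither \<open>x\<close> nor its successor on the path, so
    following the path from \<open>x\<close> to \<open>y\<close> and returning along the edge gives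
    \<open>j + 1\<close> arcs, at least three.\<close>
  ultimately have j2: "2 \<le> j" by simp
  define ws where "ws = take j zs"
  have ws: "x # ws = take (Suc j) xs" "length ws = j" using j(1) by (auto simp: ws_def zs)
  let ?p = "zip (x # ws) (ws @ [x])"
  have "distinct (x # ws)" unfolding ws(1) using xs(1) by (simp add: P_def distinct_take)
  then have "distinct (tl (pawalk_verts x ?p))" unfolding pawalk_verts_zip by auto
  moreover have "set ?p \<subseteq> arcs (sub A)"
  proof
    fix e assume "e \<in> set ?p"
    then obtain i where i: "i < length ?p" "?p ! i = e" unfolding in_set_conv_nth by blast
    then have ij: "i \<le> j" using ws(2) by simp
    have e: "e = ((x # ws) ! i, (ws @ [x]) ! i)" using i by (simp add: nth_zip)
    have f: "(x # ws) ! i = xs ! i" unfolding ws(1) using ij by simp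
    have in_T: "xs ! i \<in> T" using ij j(1) xs(1) by (auto simp: P_def)
    show "e \<in> arcs (sub A)"
    proof (cases "i = j")
      case True
      then have "(ws @ [x]) ! i = x" using ws(2) by (simp add: nth_append)
      then show ?thesis unfolding e f using True j(2) y(1) E_sym T(1) x(1) in_T by (auto simp: nb_def)
    next
      case False
      then have i': "i < j" using ij by simp
      then have "(ws @ [x]) ! i = xs ! Suc i" using ws(2) j(1) by (simp add: nth_append ws_def zs)
      moreover have "E (xs ! i) (xs ! Suc i)" "xs ! Suc i \<in> T" using i' j(1) xs(1) by (auto simp: P_def)
      ultimately show ?thesis unfolding e f using T(1) in_T by auto
    qed
  qed
  ultimately have "pre_digraph.cycle (sub A) ?p"
    unfolding cycle_sub using x(1) T(1) pcas_zip[of x ws x] by (intro exI[of _ x]) auto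
  moreover have "3 \<le> length ?p" using ws(2) j2 by simp
  ultimately show ?thesis by blast
qed

lemma acyclic_graph_sub: "A \<subseteq> {..<n} \<Longrightarrow> acyclic_graph (sub A) \<longleftrightarrow> acyc A"
  unfolding acyclic_graph_def using cycle_imp_not_acyc not_acyc_imp_cycle by blast

lemma reachable_sub: "u \<rightarrow>\<^sup>*\<^bsub>sub A\<^esub> v \<longleftrightarrow> u \<in> A \<and> conn A u v"
proof -
  have ends: "arcs_ends (sub A) = {(a, b). E a b \<and> a \<in> A \<and> b \<in> A}"
    by (auto simp: arcs_ends_conv image_iff)
  show ?thesis
  proof
    assume "u \<rightarrow>\<^sup>*\<^bsub>sub A\<^esub> v"
    then have "(u, v) \<in> rtrancl_on A {(a, b). E a b \<and> a \<in> A \<and> b \<in> A}"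
      unfolding reachable_def ends by simp
    then show "u \<in> A \<and> conn A u v"
    proof (induction rule: rtrancl_on_induct)
      case (step y z)
      then have "conn A y z" by (intro conn_step) auto
      with step show ?case using conn_trans[of A u y z] by simp
    qed simp
  next
    assume "u \<in> A \<and> conn A u v"
    then have u: "u \<in> A" and "(\<lambda>a b. a \<in> A \<and> b \<in> A \<and> E a b)\<^sup>*\<^sup>* u v" by (simp_all add: conn_def)
    from this(2) have "(u, v) \<in> rtrancl_on A {(a, b). E a b \<and> a \<in> A \<and> b \<in> A}"
    proof (induction rule: rtranclp_induct)
      case base
      show ?case using u by (rule rtrancl_on_refl)
    next
      case (step y z)
      show ?case by (rule rtrancl_on_into_rtrancl_on[OF step.IH]) (use step.hyps in auto)
    qed
    then show "u \<rightarrow>\<^sup>*\<^bsub>sub A\<^esub> v" unfolding reachable_def ends by simp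
  qed
qed

text \<open>\<open>E\<close> is symmetric, so mutual reachability is the same as
  connectedness.\<close>

lemma sccs_sub: "A \<subseteq> {..<n} \<Longrightarrow> pre_digraph.sccs (sub A) = (\<lambda>x. sub (cpt A x)) ` A"
proof -
  assume A: "A \<subseteq> {..<n}"
  have wf: "wf_digraph (sub A)" by unfold_locales auto
  have "pre_digraph.sccs_verts (sub A) = cpt A ` A"
  proof (intro equalityI subsetI)
    fix S assume "S \<in> pre_digraph.sccs_verts (sub A)"
    then have S: "S \<noteq> {}" "\<And>u v. u \<in> S \<Longrightarrow> v \<in> S \<Longrightarrow> u \<in> A \<and> conn A u v"
      "\<And>u v. u \<in> S \<Longrightarrow> v \<notin> S \<Longrightarrow> \<not> (u \<in> A \<and> conn A u v) \<or> \<not> (v \<in> A \<and> conn A v u)"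
      unfolding pre_digraph.sccs_verts_def reachable_sub by blast+
    obtain x where x: "x \<in> S" using S(1) by blast
    have xA: "x \<in> A" using S(2)[OF x x] by simp
    have "S = cpt A x"
    proof (intro equalityI subsetI)
      fix y assume "y \<in> S"
      then show "y \<in> cpt A x" using S(2)[OF x] by (simp add: cpt_def)
    next
      fix y assume "y \<in> cpt A x"
      then have "conn A x y" by (simp add: cpt_def)
      moreover from this have "conn A y x" "y \<in> A" using conn_sym conn_in xA by blast+
      ultimately show "y \<in> S" using S(3)[OF x, of y] xA by blast
    qed
    then show "S \<in> cpt A ` A" using xA by blast
  next
    fix S assume "S \<in> cpt A ` A"
    then obtain x where x: "x \<in> A" "S = cpt A x" by blast
    have c: "conn A u v" if "conn A x u" "conn A x v" for u v using conn_trans[OF conn_sym[OF that(1)] that(2)] .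
    show "S \<in> pre_digraph.sccs_verts (sub A)"
      unfolding pre_digraph.sccs_verts_def reachable_sub mem_Collect_eq
    proof (intro conjI ballI allI impI)
      show "S \<noteq> {}" unfolding x(2) cpt_def using conn_refl by blast
      fix u assume u: "u \<in> S"
      then have xu: "conn A x u" by (simp add: x(2) cpt_def)
      show "u \<in> A" using conn_in[OF xu x(1)] .
      show "conn A u v" if "v \<in> S" for v using that c[OF xu] by (simp add: x(2) cpt_def)
      fix v assume v: "v \<notin> S"
      show "\<not> (u \<in> A \<and> conn A u v) \<or> \<not> (v \<in> A \<and> conn A v u)"
        using v conn_trans[OF xu, of v] by (auto simp: x(2) cpt_def)
    qed
  qed
  then have "pre_digraph.sccs (sub A) = (\<lambda>S. sub A \<restriction> S) ` (cpt A ` A)"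
    using wf_digraph.sccs_conv_sccs_verts[OF wf] by simp
  also have "\<dots> = (\<lambda>x. sub (cpt A x)) ` A"
    unfolding image_image by (intro image_cong refl sub_sub cpt_subset)
  finally show ?thesis .
qed

lemma feedback_vertex_set_sub:
  assumes "K \<subseteq> {..<n}"
  shows "feedback_vertex_set (sub K) S \<longleftrightarrow> S \<subseteq> K \<and> acyc (K - S)"
  unfolding feedback_vertex_set_def using assms by (simp add: sub_sub acyclic_graph_sub subset_iff)

text \<open>The feedback vertex sets of the components are united to \<open>H\<close>; conversely
  \<open>H\<close> is cut down to each component. A subset of a union of components has a vertex of
  small degree as soon as its part in one component has one.\<close>

lemma quasi_forest_sub:
  assumes A: "A \<subseteq> {..<n}"
  shows "quasi_forest (int d) (sub A) \<longleftrightarrow> (\<exists>H \<subseteq> A. acyc (A - H) \<and> hb d A H)"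
proof -
  have K: "cpt A x \<subseteq> {..<n}" if "x \<in> A" for x using cpt_subset[OF that] A by blast
  have "quasi_forest (int d) (sub A) \<longleftrightarrow> (\<forall>x \<in> A. \<exists>S \<subseteq> cpt A x. acyc (cpt A x - S) \<and> card S \<le> d)"
    unfolding quasi_forest_def sccs_sub[OF A] using K by (auto simp: feedback_vertex_set_sub)
  also have "\<dots> \<longleftrightarrow> (\<exists>H \<subseteq> A. acyc (A - H) \<and> hb d A H)"
  proof
    assume "\<forall>x \<in> A. \<exists>S \<subseteq> cpt A x. acyc (cpt A x - S) \<and> card S \<le> d"
    \<comment> \<open>The choice is made per component, so that all vertices of a component obtain
      the same set.\<close>
    then have "\<forall>L \<in> cpt A ` A. \<exists>S. S \<subseteq> L \<and> acyc (L - S) \<and> card S \<le> d" by blast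
    from bchoice[OF this] obtain f where "\<forall>L \<in> cpt A ` A. f L \<subseteq> L \<and> acyc (L - f L) \<and> card (f L) \<le> d" ..
    then have f: "f (cpt A x) \<subseteq> cpt A x" "acyc (cpt A x - f (cpt A x))" "card (f (cpt A x)) \<le> d" if "x \<in> A" for x
      using that by blast+
    define H where "H = (\<Union>x \<in> A. f (cpt A x))"
    have HA: "H \<subseteq> A" unfolding H_def using f(1) cpt_subset by blast
    have H_cpt: "H \<inter> cpt A x = f (cpt A x)" if x: "x \<in> A" for x
    proof
      show "f (cpt A x) \<subseteq> H \<inter> cpt A x" unfolding H_def using f(1)[OF x] x by blast
      show "H \<inter> cpt A x \<subseteq> f (cpt A x)"
      proof
        fix h assume h: "h \<in> H \<inter> cpt A x"
        then obtain y where y: "y \<in> A" "h \<in> f (cpt A y)" by (auto simp: H_def)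
        then have "h \<in> cpt A y" using f(1) by blast
        then have "conn A y h" "conn A x h" using h by (simp_all add: cpt_def)
        then have "cpt A y = cpt A x" unfolding cpt_eq_iff by (rule conn_trans[OF _ conn_sym])
        with y(2) show "h \<in> f (cpt A x)" by simp
      qed
    qed
    have "acyc (A - H)"
      unfolding acyc_def
    proof (intro allI impI)
      fix T assume T: "T \<subseteq> A - H" "T \<noteq> {}"
      then obtain x where x: "x \<in> T" "x \<in> A" by blast
      let ?K = "cpt A x"
      have "T \<inter> ?K \<subseteq> ?K - f ?K" using T(1) H_cpt[OF x(2)] by blast
      moreover have "x \<in> T \<inter> ?K" using x by (simp add: cpt_def)
      ultimately obtain v where v: "v \<in> T \<inter> ?K" "card (nb v (T \<inter> ?K)) \<le> 1"
        using f(2)[OF x(2)] unfolding acyc_def by blast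
      have "u \<in> ?K" if "u \<in> T" "E v u" for u
      proof -
        have "conn A v u" using that v(1) T(1) by (intro conn_step) auto
        moreover have "conn A x v" using v(1) by (simp add: cpt_def)
        ultimately have "conn A x u" by (rule conn_trans[rotated])
        then show ?thesis by (simp add: cpt_def)
      qed
      then have "nb v T = nb v (T \<inter> ?K)" unfolding nb_def by blast
      with v(2) have "card (nb v T) \<le> 1" by simp
      with v(1) show "\<exists>v \<in> T. card (nb v T) \<le> 1" by blast
    qed
    moreover have "hb d A H"
      unfolding hb_def
    proof
      fix x assume x: "x \<in> A"
      have "{h \<in> H. h \<in> A \<and> conn A x h} = H \<inter> cpt A x" using HA by (auto simp: cpt_def)
      then show "card {h \<in> H. h \<in> A \<and> conn A x h} \<le> d" using H_cpt[OF x] f(3)[OF x] by simp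
    qed
    ultimately show "\<exists>H \<subseteq> A. acyc (A - H) \<and> hb d A H" using HA by blast
  next
    assume "\<exists>H \<subseteq> A. acyc (A - H) \<and> hb d A H"
    then obtain H where H: "H \<subseteq> A" "acyc (A - H)" "hb d A H" by blast
    show "\<forall>x \<in> A. \<exists>S \<subseteq> cpt A x. acyc (cpt A x - S) \<and> card S \<le> d"
    proof
      fix x assume x: "x \<in> A"
      have "acyc (cpt A x - H \<inter> cpt A x)" by (rule acyc_subset[OF H(2)]) (use cpt_subset[OF x] in blast)
      moreover have "{h \<in> H. h \<in> A \<and> conn A x h} = H \<inter> cpt A x" using H(1) by (auto simp: cpt_def)
      then have "card (H \<inter> cpt A x) \<le> d" using H(3) x unfolding hb_def by auto
      ultimately show "\<exists>S \<subseteq> cpt A x. acyc (cpt A x - S) \<and> card S \<le> d" by blast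
    qed
  qed
  finally show ?thesis .
qed

lemma deletion_iff_sol:
  "has_quasi_forest_deletion (with_proj G) (int k) (int d) \<longleftrightarrow> (\<exists>X H. sol k d {..<n} X H)"
proof -
  have V: "verts (with_proj G) = {..<n}" using pverts_G by (simp add: lessThan_atLeast0)
  have "has_quasi_forest_deletion (with_proj G) (int k) (int d) \<longleftrightarrow>
    (\<exists>X \<subseteq> {..<n}. card X \<le> k \<and> (\<exists>H \<subseteq> {..<n} - X. acyc ({..<n} - X - H) \<and> hb d ({..<n} - X) H))"
    unfolding has_quasi_forest_deletion_def V sub_def[symmetric] by (auto simp: quasi_forest_sub)
  then show ?thesis unfolding sol_def by blast
qed

lemma deletion_negative_k: "k < 0 \<Longrightarrow> \<not> has_quasi_forest_deletion (with_proj G) k d"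
  unfolding has_quasi_forest_deletion_def by auto

text \<open>No set has negative size, so a quasi-forest has no component at all and every vertex
  must be deleted.\<close>

lemma deletion_negative_d:
  assumes "d < 0"
  shows "has_quasi_forest_deletion (with_proj G) k d \<longleftrightarrow> int n \<le> k"
proof -
  have V: "verts (with_proj G) = {..<n}" using pverts_G by (simp add: lessThan_atLeast0)
  have "quasi_forest d (sub A) \<longleftrightarrow> A = {}" if "A \<subseteq> {..<n}" for A
    unfolding quasi_forest_def sccs_sub[OF that] using assms by auto
  then have "has_quasi_forest_deletion (with_proj G) k d \<longleftrightarrow> (\<exists>X \<subseteq> {..<n}. int (card X) \<le> k \<and> {..<n} - X = {})"
    unfolding has_quasi_forest_deletion_def V sub_def[symmetric] by auto
  also have "\<dots> \<longleftrightarrow> int n \<le> k"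
  proof
    assume "\<exists>X \<subseteq> {..<n}. int (card X) \<le> k \<and> {..<n} - X = {}"
    then obtain X where "X \<subseteq> {..<n}" "int (card X) \<le> k" "{..<n} - X = {}" by blast
    moreover from this have "X = {..<n}" by blast
    ultimately show "int n \<le> k" by simp
  qed (intro exI[of _ "{..<n}"], simp)
  finally show ?thesis .
qed

end

lemma adjacency_address:
  fixes n u v i j :: nat
  assumes "v < n" "j < n"
  shows "3 + n * u + v = 3 + n * i + j \<longleftrightarrow> u = i \<and> v = j"
proof
  assume "3 + n * u + v = 3 + n * i + j"
  then have "n * u + v = n * i + j" by simp
  moreover have "(n * u + v) div n = u" "(n * i + j) div n = i" "(n * u + v) mod n = v" "(n * i + j) mod n = j"
    using assms by auto
  ultimately show "u = i \<and> v = j" by metis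
qed simp

theorem theorem4:
  shows "\<exists>(p :: com) (f :: int \<Rightarrow> int \<Rightarrow> nat) (c :: nat). computable2 f \<and>
    (\<forall>(G :: nat pair_pre_digraph) (n :: nat) (k :: int) (d :: int).
       pair_graph G \<and> pverts G = {0..<n} \<longrightarrow>
       decides_within p (encode G k d)
         (has_quasi_forest_deletion (with_proj G) k d) (f k d * max 1 n ^ c))"
proof -
  obtain C D where CD: "\<And>B. tb B main \<le> C * (B + 1) ^ D" using tb_poly[of main] by blast
  \<comment> \<open>The summand 4 covers the steps spent on the signs of the parameters and on the
    output. With \<open>g\<close> guesses, \<open>n + g + 1\<close> is at most \<open>g + 2\<close>
    times \<open>max 1 n\<close>, which splits the polynomial in \<open>n + g\<close> into a
    parameter part and a power of \<open>max 1 n\<close>.\<close>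
  define f :: "int \<Rightarrow> int \<Rightarrow> nat" where "f k d = (C + 4) * (guesses (nat k) (nat d) + 2) ^ D" for k d
  let ?result = "Store (Const 0) (cexp (Var vyes))"
  \<comment> \<open>Negative parameters are decided separately, since the loop language works with
    natural numbers.\<close>
  let ?p = "IfPos (Sub (Const 0) (Mem (Const 1))) (Store (Const 0) (Const 0))
    (IfPos (Sub (Const 0) (Mem (Const 2)))
      (IfPos (Sub (Mem (Const 0)) (Mem (Const 1))) (Store (Const 0) (Const 0)) (Store (Const 0) (Const 1)))
      (Seq (compile main) ?result))"
  have "decides_within ?p (encode G k d) (has_quasi_forest_deletion (with_proj G) k d) (f k d * max 1 n ^ D)"
    if G: "pair_graph G" "pverts G = {0..<n}" for G :: "nat pair_pre_digraph" and n k d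
  proof -
    interpret instance_graph G n by (intro instance_graph.intro instance_graph_axioms.intro G)
    let ?s = "encode G k d"
    have enc: "?s 0 = int n" "?s 1 = k" "?s 2 = d" using G(2) by (simp_all add: encode_def)
    have time: "t + 4 \<le> f k d * max 1 n ^ D" if "t \<le> C * ((n + guesses (nat k) (nat d)) + 1) ^ D" for t
    proof -
      let ?g = "guesses (nat k) (nat d)" and ?m = "max 1 n"
      have "g \<le> g * m" if "1 \<le> m" for g m :: nat using mult_le_mono2[OF that, of g] by simp
      then have "m' + g + 1 \<le> (g + 2) * m" if "1 \<le> m" "m' \<le> m" for g m m' :: nat
        using that(2) add_mono[of g "g * m" "m' + 1" "2 * m"] that by (simp add: distrib_right)
      from this[of ?m n ?g] have "n + ?g + 1 \<le> (?g + 2) * ?m" by simp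
      then have "(n + ?g + 1) ^ D \<le> ((?g + 2) * ?m) ^ D" by (rule power_mono) simp
      then have "C * (n + ?g + 1) ^ D \<le> C * ((?g + 2) * ?m) ^ D" by (rule mult_le_mono2)
      moreover have "1 \<le> ((?g + 2) * ?m) ^ D" by (rule one_le_power) simp
      ultimately have "t + 4 \<le> (C + 4) * ((?g + 2) * ?m) ^ D" using that unfolding distrib_right by linarith
      then show ?thesis by (simp only: f_def power_mult_distrib mult.assoc)
    qed
    show ?thesis
    proof (cases "k < 0")
      case True
      have "exec ?p ?s (1 + 1) (?s(eval (Const 0) ?s := eval (Const 0) ?s))"
        by (rule exec.IfTrue[OF _ exec.Store]) (use True enc in simp)
      moreover have "1 + 1 \<le> f k d * max 1 n ^ D" using time[of 0] by simp
      ultimately show ?thesis unfolding decides_within_def using deletion_negative_k[OF True, of d] by fastforce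
    next
      case k: False
      show ?thesis
      proof (cases "d < 0")
        case True
        let ?e = "if k < int n then 0 else 1 :: int"
        have "exec (IfPos (Sub (Mem (Const 0)) (Mem (Const 1))) (Store (Const 0) (Const 0)) (Store (Const 0) (Const 1)))
            ?s (1 + 1) (?s(0 := ?e))"
        proof (cases "k < int n")
          case True
          then show ?thesis using exec.IfTrue[OF _ exec.Store[of "Const 0" "Const 0" ?s], of "Sub (Mem (Const 0)) (Mem (Const 1))"] enc
            by simp
        next
          case False
          then show ?thesis using exec.IfFalse[OF _ exec.Store[of "Const 0" "Const 1" ?s], of "Sub (Mem (Const 0)) (Mem (Const 1))"] enc
            by simp
        qed
        then have "exec ?p ?s (1 + 1 + 1 + 1) (?s(0 := ?e))"
          by (rule exec.IfFalse[OF _ exec.IfTrue, rotated 2]) (use True k enc in simp_all)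
        moreover have "1 + 1 + 1 + 1 \<le> f k d * max 1 n ^ D" using time[of 0] by simp
        ultimately show ?thesis unfolding decides_within_def
          using deletion_negative_d[OF True, of k] by (intro exI[of _ "1 + 1 + 1 + 1"] exI[of _ "?s(0 := ?e)"]) auto
      next
        case d: False
        define inp where "inp a = nat (?s (int a))" for a
        have kd: "int (nat k) = k" "int (nat d) = d" using k d by simp_all
        have inp: "inp 0 = n" "inp 1 = nat k" "inp 2 = nat d" using enc by (simp_all add: inp_def)
        have nonneg: "0 \<le> ?s a" for a using k d by (auto simp: encode_def Let_def)
        have neg: "?s a = 0" if "a < 0" for a
        proof -
          have "a \<noteq> int m" for m using that by linarith
          with that show ?thesis unfolding encode_def Let_def by (simp only: simp_thms if_False) simp
        qed
        have rep: "rep inp (\<lambda>_ _. 0) ?s"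
          unfolding rep_def inp_def using nonneg neg[OF addr_neg] by auto
        interpret program E n inp
        proof
          show "inp 0 = n" by (rule inp)
          fix u v assume uv: "u < n" "v < n"
          have eq: "(\<exists>i<n. \<exists>j<n. int (3 + n * u + v) = int (3 + n * i + j) \<and> (i, j) \<in> parcs G) \<longleftrightarrow> (u, v) \<in> parcs G"
            unfolding of_nat_eq_iff using adjacency_address uv by metis
          have card: "card (pverts G) = n" using G(2) by simp
          have "3 \<le> int (3 + n * u + v)" by simp
          then have ne: "int (3 + n * u + v) \<noteq> 0" "int (3 + n * u + v) \<noteq> 1" "int (3 + n * u + v) \<noteq> 2"
            by linarith+
          have "?s (int (3 + n * u + v)) = (if (u, v) \<in> parcs G then 1 else 0)"
            unfolding encode_def Let_def card using ne by (simp only: if_False eq)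
          then show "inp (3 + n * u + v) = (if E u v then 1 else 0)"
            unfolding inp_def E_def by simp
        qed
        let ?B = "n + guesses (nat k) (nat d)"
        have "bdd ?B main inp (\<lambda>_ _. 0)" by (rule bdd_main) (simp_all add: inp del: One_nat_def)
        from exec_compile[OF wfc_main rep this] obtain t s' where t: "exec (compile main) ?s t s'"
          "rep inp (sem main inp (\<lambda>_ _. 0)) s'" "t \<le> tb ?B main" by blast
        have yes: "eval (cexp (Var vyes)) s' = (if has_quasi_forest_deletion (with_proj G) k d then 1 else 0)"
        proof -
          have "sem main inp (\<lambda>_ _. 0) vyes 0 = (if has_quasi_forest_deletion (with_proj G) k d then 1 else 0)"
            using sem_main[of "\<lambda>_ _. 0"] deletion_iff_sol[of "nat k" "nat d", unfolded kd] unfolding inp by simp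
          then show ?thesis using eval_cexp[OF t(2), of "Var vyes"] by (simp del: cexp.simps)
        qed
        let ?s'' = "s'(eval (Const 0) s' := eval (cexp (Var vyes)) s')"
        have "exec ?p ?s (t + 1 + 1 + 1) ?s''"
          using k d enc by (intro exec.IfFalse exec.Seq[OF t(1) exec.Store]) simp_all
        moreover have "t + 1 + 1 + 1 \<le> f k d * max 1 n ^ D"
          using time[OF order_trans[OF t(3) CD]] by simp
        moreover have "?s'' 0 = (if has_quasi_forest_deletion (with_proj G) k d then 1 else 0)" using yes by simp
        ultimately show ?thesis unfolding decides_within_def by blast
      qed
    qed
  qed
  moreover have "computable2 f" unfolding f_def by (rule computable_bound)
  ultimately show ?thesis by blast
qed

end
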